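(* Suppose that the distribution of $Z$ is circularly symmetric, i.e., that $Z$ and $\mathrm{e}^{\mathrm{i}\vartheta}Z$ have the same distribution for each $\vartheta\in\Theta$ (hypothesis $H_0$). Then there is a centred Gaussian random element $V$ of $\mathbb{H}$ with covariance kernel $K(s,\vartheta;t,\eta)=\mathbb{E}[V(s,\vartheta)V(t,\eta)]$ given by \[ K(s,\vartheta;t,\eta)=\mathbb{E}\big[\ell(W,s,\vartheta)\,\ell(W,t,\eta)\big],\qquad s,t\in\mathbb{R}^{2d},\ \vartheta,\eta\in\Theta, \] such that $V_n$ converges in distribution to $V$ in $\mathbb{H}$ as $n\to\infty$.
   Context: Let $d\ge 1$ be a fixed integer, $\Theta:=[-\pi,\pi)$, and let $Z,Z_1,Z_2,\ldots$ be independent and identically distributed $\mathbb{C}^d$-valued random vectors defined on a common probability space $(\Omega,\mathcal{A},\mathbb{P})$. For $z=(z_1,\ldots,z_d)^\top\in\mathbb{C}^d$ put $\mathrm{RI}(z):=(\mathrm{Re}\,z_1,\ldots,\mathrm{Re}\,z_d,\mathrm{Im}\,z_1,\ldots,\mathrm{Im}\,z_d)^\top\in\mathbb{R}^{2d}$, and set $W:=\mathrm{RI}(Z)$, $W_j:=\mathrm{RI}(Z_j)$. For $\vartheta\in\Theta$ let \[ M_\vartheta=\begin{pmatrix}\cos\vartheta\,\mathrm{I}_d&-\sin\vartheta\,\mathrm{I}_d\\ \sin\vartheta\,\mathrm{I}_d&\cos\vartheta\,\mathrm{I}_d\end{pmatrix}, \] where $\mathrm{I}_d$ is the unit matrix of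 order $d$ (so $\mathrm{RI}(\mathrm{e}^{\mathrm{i}\vartheta}Z)=M_\vartheta W$). Let $\mathrm{CS}^+(\xi):=\cos\xi+\sin\xi$, $\xi\in\mathbb{R}$, and \[ \ell(w,s,\vartheta):=\mathrm{CS}^+(s^\top w)-\mathrm{CS}^+(s^\top M_\vartheta w),\qquad w,s\in\mathbb{R}^{2d},\ \vartheta\in\Theta, \] \[ V_n(s,\vartheta):=\frac1{\sqrt n}\sum_{j=1}^n\ell(W_j,s,\vartheta). \] Let $\|\cdot\|$ be the Euclidean norm on $\mathbb{R}^{2d}$, and let $w:[0,\infty)\to(0,\infty)$ be a measurable function (the weight function) such that $s\mapsto w(\|s\|)$ is (Lebesgue) integrable on $\mathbb{R}^{2d}$. $\mathbb{H}=L^2(\mathbb{R}^{2d}\times\Theta,\mathcal{B}(\mathbb{R}^{2d}\times\Theta),w(\|s\|)\,\mathrm{d}s\,\mathrm{d}\vartheta)$ is the separable Hilbert space of (equivalence classes of) real-valued measurable functions on $\mathbb{R}^{2d}\times\Theta$ that are square integrable with respect to $w(\|s\|)\,\mathrm{d}s\,\mathrm{d}\vartheta$, with inner product $\langle f,g\rangle_{\mathbb{H}}=\int_\Theta\int_{\mathbb{R}^{2d}}f(s,\vartheta)g(s,\vartheta)w(\|s\|)\,\mathrm{d}s\,\mathrm{d}\vartheta$. $V_n$ is regarded as a random element of $\mathbb{H}$. *)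

theory Defs
  imports "HOL-Probability.Probability"
begin

section \<open>The Hilbert space of square integrable functions\<close>

definition L2_fun :: "'x measure \<Rightarrow> ('x \<Rightarrow> real) set" where
  "L2_fun M = {f \<in> borel_measurable M. integrable M (\<lambda>x. (f x)\<^sup>2)}"

definition L2_rel :: "'x measure \<Rightarrow> (('x \<Rightarrow> real) \<times> ('x \<Rightarrow> real)) set" where
  "L2_rel M = {(f, g). f \<in> L2_fun M \<and> g \<in> L2_fun M \<and> (AE x in M. f x = g x)}"

definition L2 :: "'x measure \<Rightarrow> ('x \<Rightarrow> real) set set" where
  "L2 M = L2_fun M // L2_rel M"

definition L2_class :: "'x measure \<Rightarrow> ('x \<Rightarrow> real) \<Rightarrow> ('x \<Rightarrow> real) set" where
  "L2_class M f = L2_rel M `` {f}"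

definition L2_rep :: "('x \<Rightarrow> real) set \<Rightarrow> 'x \<Rightarrow> real" where
  "L2_rep u = (SOME f. f \<in> u)"

definition L2_inner :: "'x measure \<Rightarrow> ('x \<Rightarrow> real) set \<Rightarrow> ('x \<Rightarrow> real) set \<Rightarrow> real" where
  "L2_inner M u v = (LINT x|M. L2_rep u x * L2_rep v x)"

definition L2_dist :: "'x measure \<Rightarrow> ('x \<Rightarrow> real) set \<Rightarrow> ('x \<Rightarrow> real) set \<Rightarrow> real" where
  "L2_dist M u v = sqrt (LINT x|M. (L2_rep u x - L2_rep v x)\<^sup>2)"

definition L2_topology :: "'x measure \<Rightarrow> ('x \<Rightarrow> real) set topology" where
  "L2_topology M = Metric_space.mtopology (L2 M) (L2_dist M)"


section \<open>Random elements, convergence in distribution, Gaussian elements\<close>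

definition borel_of :: "'h topology \<Rightarrow> 'h measure" where
  "borel_of T = sigma (topspace T) {U. openin T U}"

text \<open>The random elements \<open>X n\<close> live on \<open>P\<close>, whereas the limit \<open>Y\<close> may live on a different
  probability space \<open>Q\<close>. Measurability is part of the notion; otherwise the Bochner integrals
  below could silently be 0.\<close>

definition converges_in_distribution ::
    "'h topology \<Rightarrow> 'a measure \<Rightarrow> (nat \<Rightarrow> 'a \<Rightarrow> 'h) \<Rightarrow> 'b measure \<Rightarrow> ('b \<Rightarrow> 'h) \<Rightarrow> bool" where
  "converges_in_distribution T P X Q Y \<longleftrightarrow>
     (\<forall>n. X n \<in> measurable P (borel_of T)) \<and> Y \<in> measurable Q (borel_of T) \<and>
     (\<forall>F. continuous_map T euclideanreal F \<and> bounded (F ` topspace T) \<longrightarrow>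
        (\<lambda>n. LINT \<omega>|P. F (X n \<omega>)) \<longlonglongrightarrow> (LINT \<omega>|Q. F (Y \<omega>)))"

text \<open>The normal law with mean \<open>\<mu>\<close> and standard deviation \<open>\<sigma> \<ge> 0\<close>; degenerate for \<open>\<sigma> = 0\<close>.\<close>

definition normal_law :: "real \<Rightarrow> real \<Rightarrow> real measure" where
  "normal_law \<mu> \<sigma> =
     (if \<sigma> = 0 then return borel \<mu> else density lborel (\<lambda>x. ennreal (normal_density \<mu> \<sigma> x)))"

definition gaussian_L2 :: "'x measure \<Rightarrow> 'b measure \<Rightarrow> ('b \<Rightarrow> ('x \<Rightarrow> real) set) \<Rightarrow> bool" where
  "gaussian_L2 M Q Y \<longleftrightarrow>
     Y \<in> measurable Q (borel_of (L2_topology M)) \<and>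
     (\<forall>u\<in>L2 M. \<exists>\<mu> \<sigma>. 0 \<le> \<sigma> \<and> distr Q borel (\<lambda>\<omega>. L2_inner M u (Y \<omega>)) = normal_law \<mu> \<sigma>)"

definition centred_L2 :: "'x measure \<Rightarrow> 'b measure \<Rightarrow> ('b \<Rightarrow> ('x \<Rightarrow> real) set) \<Rightarrow> bool" where
  "centred_L2 M Q Y \<longleftrightarrow> (\<forall>u\<in>L2 M. has_bochner_integral Q (\<lambda>\<omega>. L2_inner M u (Y \<omega>)) 0)"


section \<open>The statistic\<close>

text \<open>Vectors in \<open>\<real>\<^sup>2\<^sup>d\<close> are indexed by \<open>'d + 'd\<close>, with \<open>'d\<close> of cardinality \<open>d\<close>: the \<open>Inl\<close> coordinates
  form the first block and the \<open>Inr\<close> coordinates the second.\<close>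

definition Theta :: "real set" where
  "Theta = {-pi..<pi}"

definition RI :: "complex ^ 'd \<Rightarrow> real ^ ('d::finite + 'd)" where
  "RI z = (\<chi> i. case i of Inl k \<Rightarrow> Re (z $ k) | Inr k \<Rightarrow> Im (z $ k))"

definition rot_matrix :: "real \<Rightarrow> real ^ ('d::finite + 'd) ^ ('d + 'd)" where
  "rot_matrix \<theta> = (\<chi> i j. case (i, j) of
       (Inl k, Inl l) \<Rightarrow> mat (cos \<theta>) $ k $ l
     | (Inl k, Inr l) \<Rightarrow> - (mat (sin \<theta>) $ k $ l)
     | (Inr k, Inl l) \<Rightarrow> mat (sin \<theta>) $ k $ l
     | (Inr k, Inr l) \<Rightarrow> mat (cos \<theta>) $ k $ l)"

definition CSp :: "real \<Rightarrow> real" where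
  "CSp \<xi> = cos \<xi> + sin \<xi>"

definition ell :: "real ^ ('d::finite + 'd) \<Rightarrow> real ^ ('d + 'd) \<Rightarrow> real \<Rightarrow> real" where
  "ell x s \<theta> = CSp (s \<bullet> x) - CSp (s \<bullet> (rot_matrix \<theta> *v x))"

definition Vstat ::
    "(nat \<Rightarrow> 'a \<Rightarrow> complex ^ 'd) \<Rightarrow> nat \<Rightarrow> 'a \<Rightarrow> (real ^ ('d::finite + 'd)) \<times> real \<Rightarrow> real" where
  "Vstat Zs n \<omega> = (\<lambda>(s, \<theta>). 1 / sqrt (real n) * (\<Sum>j=1..n. ell (RI (Zs j \<omega>)) s \<theta>))"

definition cov_kernel ::
    "'a measure \<Rightarrow> ('a \<Rightarrow> complex ^ 'd) \<Rightarrow>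
     (real ^ ('d::finite + 'd)) \<times> real \<Rightarrow> (real ^ ('d + 'd)) \<times> real \<Rightarrow> real" where
  "cov_kernel P Z = (\<lambda>(s, \<theta>) (t, \<eta>). LINT \<omega>|P. ell (RI (Z \<omega>)) s \<theta> * ell (RI (Z \<omega>)) t \<eta>)"

definition weight_measure :: "(real \<Rightarrow> real) \<Rightarrow> ((real ^ ('d::finite + 'd)) \<times> real) measure" where
  "weight_measure w =
     density (lborel \<Otimes>\<^sub>M restrict_space lborel Theta) (\<lambda>(s, \<theta>). ennreal (w (norm s)))"

definition circularly_symmetric :: "'a measure \<Rightarrow> ('a \<Rightarrow> complex ^ 'd::finite) \<Rightarrow> bool" where
  "circularly_symmetric P Z \<longleftrightarrow>
     (\<forall>\<theta>\<in>Theta. distr P borel (\<lambda>\<omega>. exp (\<i> * of_real \<theta>) *s Z \<omega>) = distr P borel Z)"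


section \<open>The limit element\<close>

text \<open>An element of \<open>L\<^sup>2\<close> has no values at points. A covariance kernel \<open>E[V(x) V(y)]\<close> is therefore
  understood for a jointly measurable process \<open>V\<close> all of whose paths are square integrable and
  whose paths represent the random element \<open>\<omega> \<mapsto> L2_class M (V \<omega>)\<close>. By Fubini's theorem this
  determines the covariance operator of the random element.\<close>

definition centred_gaussian_with_kernel ::
    "'x measure \<Rightarrow> 'b measure \<Rightarrow> ('b \<Rightarrow> 'x \<Rightarrow> real) \<Rightarrow> ('x \<Rightarrow> 'x \<Rightarrow> real) \<Rightarrow> bool" where
  "centred_gaussian_with_kernel M Q V K \<longleftrightarrow>
     (\<lambda>(\<omega>, x). V \<omega> x) \<in> borel_measurable (Q \<Otimes>\<^sub>M M) \<and>
     (\<forall>\<omega>\<in>space Q. V \<omega> \<in> L2_fun M) \<and>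
     gaussian_L2 M Q (\<lambda>\<omega>. L2_class M (V \<omega>)) \<and>
     centred_L2 M Q (\<lambda>\<omega>. L2_class M (V \<omega>)) \<and>
     (\<forall>x\<in>space M. has_bochner_integral Q (\<lambda>\<omega>. V \<omega> x) 0) \<and>
     (\<forall>x\<in>space M. \<forall>y\<in>space M. has_bochner_integral Q (\<lambda>\<omega>. V \<omega> x * V \<omega> y) (K x y))"

end

theory Submission
  imports Defs
begin

text \<open>The functions \<open>l(W\<^sub>j, \<cdot>)\<close> are independent, centred elements of \<open>L\<^sup>2(M)\<close>. Gram-Schmidt in the variable
  \<open>w\<close>, applied to \<open>l(_, x\<^sub>0), l(_, x\<^sub>1), \<dots>\<close> for a dense sequence of parameters \<open>x\<^sub>n\<close>, splits
  \<open>l(w, x) = (\<Sum>k<N. \<phi>\<^sub>k(w) a\<^sub>k(x)) + f\<^sub>N(w, x)\<close> with orthonormal \<open>\<phi>\<^sub>k\<close>, so that the kernel is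
  \<open>K(x, y) = (\<Sum>k. a\<^sub>k(x) a\<^sub>k(y))\<close> at every pair of points. The limit is \<open>V = (\<Sum>k. \<xi>\<^sub>k a\<^sub>k)\<close> with independent
  standard normal \<open>\<xi>\<^sub>k\<close>. The first \<open>N\<close> coefficients of the empirical sum converge in distribution by
  the one-dimensional central limit theorem and characteristic functions, and both remainders have
  mean square norm at most \<open>\<integral> E f\<^sub>N(W, x)\<^sup>2 M(dx)\<close>, which tends to \<open>0\<close>. Circular symmetry is used
  only to see that \<open>l(W, x)\<close> is centred.\<close>

section \<open>The metric space of square integrable functions\<close>

text \<open>The claim asks for more than a law on the Hilbert space: the limit must be a process
  with a value at every point, with the exact covariance at every pair of points and with all paths
  square integrable. An eigenfunction expansion in \<open>L2 M\<close> gives the kernel identity at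
  first only up to null sets. Orthonormalising in \<open>w\<close> keeps the coefficients, which are
  integrals over \<open>w\<close>, defined at every \<open>x\<close>. Completeness becomes
  elementary too: the residual at \<open>x\<close> is no larger than the distance from
  \<open>l _ x\<close> to any member of the sequence already treated. The series for the limit is
  controlled in mean square, so its values at points and the square integrability of its paths call
  for two different subsequences, one depending on \<open>x\<close> and one not. Borel measurability
  into the L2 topology is always obtained by composing with a continuous map or as a pointwise limit
  of such compositions. Tightness enters through the second moments of finitely many coefficients;
  the truncation error is bounded uniformly in the sample size, and Lipschitz test functions carry
  the convergence over.\<close>

lemma L2_funI: "f \<in> borel_measurable M \<Longrightarrow> integrable M (\<lambda>x. (f x)\<^sup>2) \<Longrightarrow> f \<in> L2_fun M"
  by (simp add: L2_fun_def)

lemma L2_fun_measurable: "f \<in> L2_fun M \<Longrightarrow> f \<in> borel_measurable M"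
  by (simp add: L2_fun_def)

lemma L2_fun_integrable_square: "f \<in> L2_fun M \<Longrightarrow> integrable M (\<lambda>x. (f x)\<^sup>2)"
  by (simp add: L2_fun_def)

lemma L2_fun_integrable_mult:
  assumes "f \<in> L2_fun M" "g \<in> L2_fun M"
  shows "integrable M (\<lambda>x. f x * g x)"
proof (rule Bochner_Integration.integrable_bound[where f="\<lambda>x. (f x)\<^sup>2 + (g x)\<^sup>2"])
  show "integrable M (\<lambda>x. (f x)\<^sup>2 + (g x)\<^sup>2)"
    using assms by (auto dest: L2_fun_integrable_square)
  show "(\<lambda>x. f x * g x) \<in> borel_measurable M"
    using assms by (auto dest!: L2_fun_measurable)
  have "\<bar>a * b\<bar> \<le> a\<^sup>2 + b\<^sup>2" for a b :: real
  proof -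
    have "0 \<le> (\<bar>a\<bar> - \<bar>b\<bar>)\<^sup>2" "0 \<le> \<bar>a * b\<bar>" by simp_all
    then show ?thesis by (simp only: power2_diff power2_abs mult.assoc abs_mult[symmetric])
  qed
  then show "AE x in M. norm (f x * g x) \<le> norm ((f x)\<^sup>2 + (g x)\<^sup>2)"
    by auto
qed

lemma L2_fun_scale: "f \<in> L2_fun M \<Longrightarrow> (\<lambda>x. c * f x) \<in> L2_fun M"
  by (auto simp: L2_fun_def power_mult_distrib)

lemma L2_fun_add:
  assumes "f \<in> L2_fun M" "g \<in> L2_fun M"
  shows "(\<lambda>x. f x + g x) \<in> L2_fun M"
proof (rule L2_funI)
  have "integrable M (\<lambda>x. (f x)\<^sup>2 + 2 * (f x * g x) + (g x)\<^sup>2)"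
    using assms by (intro Bochner_Integration.integrable_add integrable_mult_right)
      (auto intro: L2_fun_integrable_mult L2_fun_integrable_square)
  then show "integrable M (\<lambda>x. (f x + g x)\<^sup>2)"
    by (simp add: power2_sum algebra_simps)
qed (use assms in \<open>auto dest!: L2_fun_measurable\<close>)

lemma L2_fun_diff: "f \<in> L2_fun M \<Longrightarrow> g \<in> L2_fun M \<Longrightarrow> (\<lambda>x. f x - g x) \<in> L2_fun M"
  using L2_fun_add[of f M "\<lambda>x. (-1) * g x"] L2_fun_scale[of g M "-1"] by simp

lemma L2_fun_zero: "(\<lambda>x. 0) \<in> L2_fun M"
  by (simp add: L2_fun_def)

lemma L2_fun_sum: "(\<And>i. i \<in> I \<Longrightarrow> f i \<in> L2_fun M) \<Longrightarrow> (\<lambda>x. \<Sum>i\<in>I. f i x) \<in> L2_fun M"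
  by (induction I rule: infinite_finite_induct) (auto intro: L2_fun_add L2_fun_zero)

lemma L2_fun_bounded:
  assumes "finite_measure M" "f \<in> borel_measurable M" "\<And>x. x \<in> space M \<Longrightarrow> \<bar>f x\<bar> \<le> B"
  shows "f \<in> L2_fun M"
proof -
  interpret finite_measure M by fact
  have "norm ((f x)\<^sup>2) \<le> B\<^sup>2" if "x \<in> space M" for x
    using power_mono[OF assms(3)[OF that] abs_ge_zero, of 2] by simp
  then show ?thesis
    using assms(2) by (intro L2_funI integrable_const_bound[where B="B\<^sup>2"] AE_I2) simp_all
qed

text \<open>The polynomial a + 2 t b + t^2 c in \<open>t\<close> is the integral of a square, so its
  discriminant is at most 0.\<close>

lemma L2_Cauchy_Schwarz:
  assumes f: "f \<in> L2_fun M" and g: "g \<in> L2_fun M"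
  shows "\<bar>LINT x|M. f x * g x\<bar> \<le> sqrt (LINT x|M. (f x)\<^sup>2) * sqrt (LINT x|M. (g x)\<^sup>2)"
proof -
  define a b c where "a = (LINT x|M. (f x)\<^sup>2)" and "b = (LINT x|M. f x * g x)" and "c = (LINT x|M. (g x)\<^sup>2)"
  note int = L2_fun_integrable_square[OF f] L2_fun_integrable_square[OF g] L2_fun_integrable_mult[OF f g]
  have q: "0 \<le> a + 2 * t * b + t\<^sup>2 * c" for t
  proof -
    have "0 \<le> (LINT x|M. (f x + t * g x)\<^sup>2)" by simp
    also have "\<dots> = (LINT x|M. (f x)\<^sup>2 + 2 * t * (f x * g x) + t\<^sup>2 * (g x)\<^sup>2)"
      by (simp add: power2_sum power_mult_distrib algebra_simps)
    also have "\<dots> = a + 2 * t * b + t\<^sup>2 * c"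
      using int by (simp add: a_def b_def c_def)
    finally show ?thesis .
  qed
  have "0 \<le> a" "0 \<le> c" by (simp_all add: a_def c_def)
  have "b\<^sup>2 \<le> a * c"
  proof (cases "c = 0")
    case True
    have "b = 0"
    proof (rule ccontr)
      assume "b \<noteq> 0"
      \<comment> \<open>With \<open>c = 0\<close> the polynomial is affine in \<open>t\<close>; this
        choice of \<open>t\<close> would give it the value -1.\<close>
      then have "2 * (- (a + 1) / (2 * b)) * b = - (a + 1)" by (simp add: field_simps)
      then show False using q[of "- (a + 1) / (2 * b)"] True by simp
    qed
    then show ?thesis using True by simp
  next
    case False
    \<comment> \<open>\<open>- b / c\<close> minimises the polynomial; the factor \<open>c\<close>
      clears the denominator.\<close>
    then have "0 \<le> (a + 2 * (- b / c) * b + (- b / c)\<^sup>2 * c) * c" 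
      using q[of "- b / c"] \<open>0 \<le> c\<close> by simp
    also have "\<dots> = a * c - b\<^sup>2" using False by (simp add: field_simps power2_eq_square)
    finally show ?thesis by simp
  qed
  then have "\<bar>b\<bar> \<le> sqrt (a * c)" using real_le_rsqrt[of "\<bar>b\<bar>"] by simp
  then show ?thesis by (simp add: real_sqrt_mult a_def b_def c_def)
qed

lemma L2_Minkowski:
  assumes f: "f \<in> L2_fun M" and g: "g \<in> L2_fun M"
  shows "sqrt (LINT x|M. (f x + g x)\<^sup>2) \<le> sqrt (LINT x|M. (f x)\<^sup>2) + sqrt (LINT x|M. (g x)\<^sup>2)"
proof (rule real_le_lsqrt)
  note int = L2_fun_integrable_square[OF f] L2_fun_integrable_square[OF g] L2_fun_integrable_mult[OF f g]
  have "(LINT x|M. (f x + g x)\<^sup>2) = (LINT x|M. (f x)\<^sup>2 + 2 * (f x * g x) + (g x)\<^sup>2)"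
    by (simp add: power2_sum algebra_simps)
  also have "\<dots> = (LINT x|M. (f x)\<^sup>2) + 2 * (LINT x|M. f x * g x) + (LINT x|M. (g x)\<^sup>2)"
    using int by simp
  also have "\<dots> \<le> (sqrt (LINT x|M. (f x)\<^sup>2) + sqrt (LINT x|M. (g x)\<^sup>2))\<^sup>2"
    using L2_Cauchy_Schwarz[OF f g] by (simp add: power2_sum)
  finally show "(LINT x|M. (f x + g x)\<^sup>2) \<le> (sqrt (LINT x|M. (f x)\<^sup>2) + sqrt (LINT x|M. (g x)\<^sup>2))\<^sup>2" .
qed simp_all

section \<open>Classes modulo almost everywhere equality\<close>

lemma equiv_L2_rel: "equiv (L2_fun M) (L2_rel M)"
proof (rule equivI)
  show "L2_rel M \<subseteq> L2_fun M \<times> L2_fun M" by (auto simp: L2_rel_def)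
  show "refl_on (L2_fun M) (L2_rel M)" by (auto simp: refl_on_def L2_rel_def)
  show "sym (L2_rel M)" by (auto simp: sym_def L2_rel_def elim: AE_mp)
  show "trans (L2_rel M)"
  proof (rule transI)
    fix f g h assume "(f, g) \<in> L2_rel M" "(g, h) \<in> L2_rel M"
    then show "(f, h) \<in> L2_rel M" by (auto simp: L2_rel_def)
  qed
qed

lemma L2_class_in_L2: "f \<in> L2_fun M \<Longrightarrow> L2_class M f \<in> L2 M"
  by (auto simp: L2_def L2_class_def quotient_def)

lemma L2_rep_in_class: "u \<in> L2 M \<Longrightarrow> L2_rep u \<in> u"
  unfolding L2_def L2_rep_def
  by (metis equiv_L2_rel in_quotient_imp_non_empty some_in_eq)

lemma L2_rep_in_L2_fun: "u \<in> L2 M \<Longrightarrow> L2_rep u \<in> L2_fun M"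
  using L2_rep_in_class[of u M] in_quotient_imp_subset[OF equiv_L2_rel] by (auto simp: L2_def)

lemma L2_rep_class:
  assumes "f \<in> L2_fun M"
  shows "AE x in M. L2_rep (L2_class M f) x = f x"
proof -
  have "(f, L2_rep (L2_class M f)) \<in> L2_rel M"
    using L2_rep_in_class[OF L2_class_in_L2[OF assms]] by (auto simp: L2_class_def)
  then show ?thesis by (auto simp: L2_rel_def)
qed

lemma L2_class_eqI:
  assumes "f \<in> L2_fun M" "g \<in> L2_fun M" "AE x in M. f x = g x"
  shows "L2_class M f = L2_class M g"
  unfolding L2_class_def using assms
  by (intro equiv_class_eq[OF equiv_L2_rel]) (auto simp: L2_rel_def)

lemma L2_class_rep:
  assumes "u \<in> L2 M"
  shows "L2_class M (L2_rep u) = u"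
proof -
  obtain f where f: "u = L2_rel M `` {f}" using assms unfolding L2_def by (rule quotientE)
  then have "(f, L2_rep u) \<in> L2_rel M" using L2_rep_in_class[OF assms] by simp
  then show ?thesis unfolding L2_class_def using equiv_class_eq[OF equiv_L2_rel] f by metis
qed

text \<open>\<open>L2_rep\<close> picks an arbitrary member of the class, but any two members agree
  almost everywhere, so distances may be computed with the functions at hand.\<close>

lemma L2_dist_class:
  assumes "f \<in> L2_fun M" "g \<in> L2_fun M"
  shows "L2_dist M (L2_class M f) (L2_class M g) = sqrt (LINT x|M. (f x - g x)\<^sup>2)"
  unfolding L2_dist_def
proof (rule arg_cong[of _ _ sqrt], rule integral_cong_AE)
  have [measurable]: "f \<in> borel_measurable M" "g \<in> borel_measurable M"
      "L2_rep (L2_class M f) \<in> borel_measurable M" "L2_rep (L2_class M g) \<in> borel_measurable M"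
    using assms by (auto intro!: L2_fun_measurable L2_rep_in_L2_fun L2_class_in_L2)
  show "(\<lambda>x. (L2_rep (L2_class M f) x - L2_rep (L2_class M g) x)\<^sup>2) \<in> borel_measurable M"
      "(\<lambda>x. (f x - g x)\<^sup>2) \<in> borel_measurable M"
    by measurable
  show "AE x in M. (L2_rep (L2_class M f) x - L2_rep (L2_class M g) x)\<^sup>2 = (f x - g x)\<^sup>2"
    using L2_rep_class[OF assms(1)] L2_rep_class[OF assms(2)] by eventually_elim simp
qed

lemma L2_inner_class:
  assumes u: "u \<in> L2 M" and g: "g \<in> L2_fun M"
  shows "L2_inner M u (L2_class M g) = (LINT x|M. L2_rep u x * g x)"
  unfolding L2_inner_def
proof (rule integral_cong_AE)
  have [measurable]: "g \<in> borel_measurable M"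
      "L2_rep u \<in> borel_measurable M" "L2_rep (L2_class M g) \<in> borel_measurable M"
    using assms by (auto intro!: L2_fun_measurable L2_rep_in_L2_fun L2_class_in_L2)
  show "(\<lambda>x. L2_rep u x * L2_rep (L2_class M g) x) \<in> borel_measurable M"
      "(\<lambda>x. L2_rep u x * g x) \<in> borel_measurable M"
    by measurable
  show "AE x in M. L2_rep u x * L2_rep (L2_class M g) x = L2_rep u x * g x"
    using L2_rep_class[OF g] by eventually_elim simp
qed

lemma Metric_space_L2: "Metric_space (L2 M) (L2_dist M)"
proof
  fix u v w
  show "0 \<le> L2_dist M u v" by (simp add: L2_dist_def)
  show "L2_dist M u v = L2_dist M v u" by (simp add: L2_dist_def power2_commute)
  assume u: "u \<in> L2 M" and v: "v \<in> L2 M"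
  note rep = L2_rep_in_L2_fun[OF u] L2_rep_in_L2_fun[OF v]
  have "L2_dist M u v = 0 \<longleftrightarrow> (AE x in M. (L2_rep u x - L2_rep v x)\<^sup>2 = 0)"
    unfolding L2_dist_def real_sqrt_eq_0_iff
    by (rule integral_nonneg_eq_0_iff_AE)
      (auto intro!: L2_fun_integrable_square[of "\<lambda>x. L2_rep u x - L2_rep v x"] L2_fun_diff rep)
  also have "\<dots> \<longleftrightarrow> (AE x in M. L2_rep u x = L2_rep v x)" by simp
  also have "\<dots> \<longleftrightarrow> u = v"
    using L2_class_eqI[OF rep] L2_class_rep[OF u] L2_class_rep[OF v] by auto
  finally show "L2_dist M u v = 0 \<longleftrightarrow> u = v" .
  assume w: "w \<in> L2 M"
  show "L2_dist M u w \<le> L2_dist M u v + L2_dist M v w"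
    using L2_Minkowski[OF L2_fun_diff[OF rep] L2_fun_diff[OF rep(2) L2_rep_in_L2_fun[OF w]]]
    by (simp add: L2_dist_def)
qed

section \<open>Measurable maps into the Borel sets of a topology\<close>

lemma space_borel_of: "space (borel_of T) = topspace T"
  unfolding borel_of_def by (rule space_measure_of) (auto dest: openin_subset)

lemma openin_in_borel_of: "openin T U \<Longrightarrow> U \<in> sets (borel_of T)"
  unfolding borel_of_def by (subst sets_measure_of) (auto dest: openin_subset)

lemma measurable_borel_of_iff:
  "f \<in> measurable N (borel_of T) \<longleftrightarrow>
     f \<in> space N \<rightarrow> topspace T \<and> (\<forall>U. openin T U \<longrightarrow> f -` U \<inter> space N \<in> sets N)"
proof
  assume "f \<in> measurable N (borel_of T)"
  then show "f \<in> space N \<rightarrow> topspace T \<and> (\<forall>U. openin T U \<longrightarrow> f -` U \<inter> space N \<in> sets N)"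
    using measurable_space[of f N "borel_of T"] measurable_sets[OF _ openin_in_borel_of]
    by (auto simp: space_borel_of)
next
  assume *: "f \<in> space N \<rightarrow> topspace T \<and> (\<forall>U. openin T U \<longrightarrow> f -` U \<inter> space N \<in> sets N)"
  show "f \<in> measurable N (borel_of T)"
    unfolding borel_of_def
    by (rule measurable_measure_of) (use * in \<open>auto dest: openin_subset\<close>)
qed

lemma measurable_borel_of_continuous_map:
  assumes "continuous_map T euclideanreal F"
  shows "F \<in> borel_measurable (borel_of T)"
proof (rule borel_measurableI)
  fix S :: "real set" assume "open S"
  then have "openin T {x \<in> topspace T. F x \<in> S}"
    using assms by (simp add: continuous_map_def)
  moreover have "F -` S \<inter> space (borel_of T) = {x \<in> topspace T. F x \<in> S}"
    by (auto simp: space_borel_of)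
  ultimately show "F -` S \<inter> space (borel_of T) \<in> sets (borel_of T)"
    by (metis openin_in_borel_of)
qed

text \<open>The parameter space is metric, so it suffices that preimages of complements of open sets
  are sequentially closed. This is the source of measurability for L2-valued maps that depend on a
  sequence of parameters, such as the partial sums and the empirical process.\<close>

lemma continuous_map_L2_class:
  fixes \<phi> :: "'b::metric_space \<Rightarrow> 'x \<Rightarrow> real"
  assumes L2: "\<And>b. \<phi> b \<in> L2_fun M"
    and cont: "\<And>X b. X \<longlonglongrightarrow> b \<Longrightarrow> (\<lambda>i. LINT x|M. (\<phi> (X i) x - \<phi> b x)\<^sup>2) \<longlonglongrightarrow> 0"
  shows "continuous_map euclidean (L2_topology M) (\<lambda>b. L2_class M (\<phi> b))"
proof -
  interpret Metric_space "L2 M" "L2_dist M" by (rule Metric_space_L2)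
  have op: "open {b. L2_class M (\<phi> b) \<in> U}" if U: "openin (L2_topology M) U" for U
  proof -
    have "closed {b. L2_class M (\<phi> b) \<notin> U}"
      unfolding closed_sequential_limits
    proof safe
      fix X b assume X: "\<forall>n. X n \<in> {b. L2_class M (\<phi> b) \<notin> U}" "X \<longlonglongrightarrow> b" and b: "L2_class M (\<phi> b) \<in> U"
      from b U obtain r where r: "r > 0" "mball (L2_class M (\<phi> b)) r \<subseteq> U"
        by (auto simp: L2_topology_def openin_mtopology)
      have "(\<lambda>i. sqrt (LINT x|M. (\<phi> (X i) x - \<phi> b x)\<^sup>2)) \<longlonglongrightarrow> 0"
        using tendsto_real_sqrt[OF cont[OF X(2)]] by simp
      then have "\<forall>\<^sub>F i in sequentially. sqrt (LINT x|M. (\<phi> (X i) x - \<phi> b x)\<^sup>2) < r"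
        using r(1) by (rule order_tendstoD(2))
      then obtain i where "sqrt (LINT x|M. (\<phi> (X i) x - \<phi> b x)\<^sup>2) < r"
        using eventually_happens'[OF sequentially_bot] by blast
      then have "L2_class M (\<phi> (X i)) \<in> mball (L2_class M (\<phi> b)) r"
        using L2 by (simp add: in_mball L2_class_in_L2 L2_dist_class power2_commute)
      then show False using r(2) X(1) by auto
    qed
    then show ?thesis by (simp add: closed_def Collect_neg_eq[symmetric] Compl_eq)
  qed
  show ?thesis
    using op by (auto simp: continuous_map_def L2_topology_def intro: L2_class_in_L2[OF L2])
qed

lemma measurable_continuous_map:
  assumes "continuous_map euclidean T f" "g \<in> borel_measurable N"
  shows "(\<lambda>\<omega>. f (g \<omega>)) \<in> measurable N (borel_of T)"
  unfolding measurable_borel_of_iff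
proof (intro conjI allI impI)
  show "(\<lambda>\<omega>. f (g \<omega>)) \<in> space N \<rightarrow> topspace T"
    using assms(1) by (auto simp: continuous_map_def)
  fix U assume "openin T U"
  then have "open {b. f b \<in> U}" using assms(1) by (auto simp: continuous_map_def)
  then have "g -` {b. f b \<in> U} \<inter> space N \<in> sets N"
    using assms(2) by (intro measurable_sets) auto
  then show "(\<lambda>\<omega>. f (g \<omega>)) -` U \<inter> space N \<in> sets N" by (simp add: vimage_def)
qed

text \<open>The limit lies in an open \<open>U\<close> iff, for some \<open>k\<close>, the
  approximations eventually stay out of \<open>A k\<close>, the open neighbourhood of the complement
  of \<open>U\<close> with radius 1/(k+1). This is a countable combination of measurable
  conditions.\<close>

lemma (in Metric_space) measurable_mtopology_limit:
  assumes X: "\<And>n. X n \<in> measurable N (borel_of mtopology)"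
    and Y: "\<And>\<omega>. \<omega> \<in> space N \<Longrightarrow> Y \<omega> \<in> M"
    and lim: "\<And>\<omega>. \<omega> \<in> space N \<Longrightarrow> (\<lambda>n. d (X n \<omega>) (Y \<omega>)) \<longlonglongrightarrow> 0"
  shows "Y \<in> measurable N (borel_of mtopology)"
  unfolding measurable_borel_of_iff
proof (intro conjI allI impI)
  show "Y \<in> space N \<rightarrow> topspace mtopology" using Y by auto
  fix U assume U: "openin mtopology U"
  have XM: "X n \<omega> \<in> M" if "\<omega> \<in> space N" for n \<omega>
    using X[of n] that by (auto simp: measurable_borel_of_iff)
  define A where "A k = (\<Union>x\<in>M - U. mball x (1 / real (Suc k)))" for k
  have A_open: "openin mtopology (A k)" for k unfolding A_def by auto
  have meas: "{\<omega> \<in> space N. X n \<omega> \<notin> A k} \<in> sets N" for n k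
  proof -
    have "X n -` A k \<inter> space N \<in> sets N" using X[of n] A_open by (auto simp: measurable_borel_of_iff)
    then have "space N - (X n -` A k \<inter> space N) \<in> sets N" by auto
    also have "space N - (X n -` A k \<inter> space N) = {\<omega> \<in> space N. X n \<omega> \<notin> A k}" by auto
    finally show ?thesis .
  qed
  have "Y \<omega> \<in> U \<longleftrightarrow> (\<exists>k m. \<forall>n\<ge>m. X n \<omega> \<notin> A k)" if \<omega>: "\<omega> \<in> space N" for \<omega>
  proof
    assume "Y \<omega> \<in> U"
    then obtain r where r: "r > 0" "mball (Y \<omega>) r \<subseteq> U" using U by (auto simp: openin_mtopology)
    \<comment> \<open>Half of the radius for the approximation, half for the balls in
      \<open>A k\<close>: together they would put a point outside \<open>U\<close> into
      \<open>mball (Y \<omega>) r\<close>.\<close>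
    obtain k where k: "1 / real (Suc k) < r / 2" using r(1) by (meson half_gt_zero nat_approx_posE)
    have "\<forall>\<^sub>F n in sequentially. d (X n \<omega>) (Y \<omega>) < r / 2"
      using lim[OF \<omega>] r(1) by (intro order_tendstoD(2)) auto
    then obtain m where m: "\<And>n. n \<ge> m \<Longrightarrow> d (X n \<omega>) (Y \<omega>) < r / 2"
      by (auto simp: eventually_sequentially)
    have "X n \<omega> \<notin> A k" if "n \<ge> m" for n
    proof
      assume "X n \<omega> \<in> A k"
      then obtain x where x: "x \<in> M" "x \<notin> U" "d x (X n \<omega>) < 1 / real (Suc k)" by (auto simp: A_def)
      then have "d (Y \<omega>) x < r"
        using triangle[OF Y[OF \<omega>] XM[OF \<omega>, of n] x(1)] m[OF that] k
        by (simp add: commute)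
      then show False using r(2) x Y[OF \<omega>] by (auto simp: in_mball)
    qed
    then show "\<exists>k m. \<forall>n\<ge>m. X n \<omega> \<notin> A k" by blast
  next
    assume "\<exists>k m. \<forall>n\<ge>m. X n \<omega> \<notin> A k"
    then obtain k m where km: "\<And>n. n \<ge> m \<Longrightarrow> X n \<omega> \<notin> A k" by blast
    show "Y \<omega> \<in> U"
    proof (rule ccontr)
      assume "Y \<omega> \<notin> U"
      have "\<forall>\<^sub>F n in sequentially. d (X n \<omega>) (Y \<omega>) < 1 / real (Suc k)"
        using lim[OF \<omega>] by (intro order_tendstoD(2)) auto
      then obtain n where "n \<ge> m" "d (X n \<omega>) (Y \<omega>) < 1 / real (Suc k)"
        using eventually_happens'[OF sequentially_bot eventually_conj[OF eventually_ge_at_top[of m]]] by blast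
      then have "X n \<omega> \<in> A k"
        using \<open>Y \<omega> \<notin> U\<close> Y[OF \<omega>] XM[OF \<omega>] unfolding A_def by (intro UN_I[of "Y \<omega>"]) (simp_all add: commute)
      then show False using km \<open>n \<ge> m\<close> by blast
    qed
  qed
  then have "Y -` U \<inter> space N = {\<omega> \<in> space N. \<exists>k m. \<forall>n\<ge>m. X n \<omega> \<notin> A k}"
    by blast
  also have "\<dots> \<in> sets N"
  proof -
    have [measurable]: "Measurable.pred N (\<lambda>\<omega>. X n \<omega> \<notin> A k)" for n k
      using meas by (simp add: pred_def)
    show ?thesis by measurable
  qed
  finally show "Y -` U \<inter> space N \<in> sets N" .
qed

section \<open>Convergence in distribution from Lipschitz test functions\<close>

context Metric_space begin

text \<open>Infimal convolution with the cost \<open>k * d\<close>: each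
  \<open>F y + k * d x y\<close> is \<open>k\<close>-Lipschitz in \<open>x\<close>, and this
  property survives the infimum over \<open>y\<close>.\<close>

lemma lipschitz_minorant:
  assumes ne: "M \<noteq> {}" and B: "\<And>x. x \<in> M \<Longrightarrow> \<bar>F x\<bar> \<le> (B::real)"
    and k: "k \<ge> 0"
  defines "G \<equiv> \<lambda>x. INF y\<in>M. F y + k * d x y"
  shows "x \<in> M \<Longrightarrow> G x \<le> F x"
    and "x \<in> M \<Longrightarrow> \<bar>G x\<bar> \<le> B"
    and "x \<in> M \<Longrightarrow> z \<in> M \<Longrightarrow> \<bar>G x - G z\<bar> \<le> k * d x z"
proof -
  have low: "- B \<le> F y + k * d x y" if "y \<in> M" for x y
  proof -
    have "0 \<le> k * d x y" using k by simp
    then show ?thesis using B[OF that] by linarith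
  qed
  have bdd: "bdd_below ((\<lambda>y. F y + k * d x y) ` M)" for x
    by (rule bdd_belowI2[of _ "- B"]) (rule low)
  show le: "G x \<le> F x" if "x \<in> M" for x
    unfolding G_def using cINF_lower[OF bdd that, of x] that by simp
  show "\<bar>G x\<bar> \<le> B" if x: "x \<in> M" for x
  proof -
    have "- B \<le> G x" unfolding G_def by (rule cINF_greatest[OF ne low])
    then show ?thesis using le[OF x] B[OF x] by linarith
  qed
  have *: "G x \<le> G z + k * d x z" if x: "x \<in> M" and z: "z \<in> M" for x z
  proof -
    have "G x - k * d x z \<le> F y + k * d z y" if y: "y \<in> M" for y
    proof -
      have "G x \<le> F y + k * d x y" unfolding G_def by (rule cINF_lower[OF bdd y])
      also have "\<dots> \<le> F y + k * (d x z + d z y)"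
        using triangle[OF x z y] k by (intro add_left_mono mult_left_mono)
      finally show ?thesis by (simp add: algebra_simps)
    qed
    then have "G x - k * d x z \<le> G z" unfolding G_def by (intro cINF_greatest[OF ne])
    then show ?thesis by simp
  qed
  show "\<bar>G x - G z\<bar> \<le> k * d x z" if "x \<in> M" "z \<in> M" for x z
    using *[OF that] *[OF that(2,1)] commute[of x z] by (simp add: abs_le_iff)
qed

text \<open>Near \<open>x\<close> continuity keeps \<open>F\<close> above
  \<open>F x - e / 2\<close>; at distance \<open>r\<close> or more the penalty is at least
  \<open>2 * B\<close>, the largest possible drop of \<open>F\<close>.\<close>

lemma lipschitz_minorant_tendsto:
  assumes F: "continuous_map mtopology euclideanreal F" and B: "\<And>x. x \<in> M \<Longrightarrow> \<bar>F x\<bar> \<le> B"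
    and x: "x \<in> M"
  shows "(\<lambda>k. INF y\<in>M. F y + real k * d x y) \<longlonglongrightarrow> F x"
proof (rule LIMSEQ_I)
  fix e :: real assume e: "e > 0"
  let ?G = "\<lambda>k. INF y\<in>M. F y + real k * d x y"
  have ne: "M \<noteq> {}" using x by auto
  have "openin mtopology {y \<in> M. F y \<in> {F x - e / 2<..}}"
    using openin_continuous_map_preimage[OF F, of "{F x - e / 2<..}"] by simp
  then obtain r where r: "r > 0" "mball x r \<subseteq> {y \<in> M. F y \<in> {F x - e / 2<..}}"
    using x e by (force simp: openin_mtopology)
  obtain k0 :: nat where k0: "2 * B / r < real k0" using reals_Archimedean2 by blast
  have "norm (?G k - F x) < e" if "k \<ge> k0" for k
  proof -
    have "F x - e / 2 \<le> F y + real k * d x y" if y: "y \<in> M" for y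
    proof (cases "d x y < r")
      case True
      then have "F x - e / 2 < F y" using r(2) x y by (auto simp: subset_iff)
      moreover have "0 \<le> real k * d x y" by simp
      ultimately show ?thesis by linarith
    next
      case False
      have "2 * B \<le> real k0 * r" using k0 r(1) by (simp add: field_simps)
      also have "\<dots> \<le> real k * d x y" using False \<open>k \<ge> k0\<close> r(1) by (intro mult_mono) auto
      finally show ?thesis using B[OF x] B[OF y] e by linarith
    qed
    then have "F x - e / 2 \<le> ?G k" by (intro cINF_greatest[OF ne])
    moreover have "?G k \<le> F x"
      by (rule lipschitz_minorant(1)[OF ne B _ x]) auto
    ultimately show ?thesis using e by simp
  qed
  then show "\<exists>no. \<forall>n\<ge>no. norm (?G n - F x) < e" by blast
qed

lemma lipschitz_continuous_map:
  assumes "\<And>x y. x \<in> M \<Longrightarrow> y \<in> M \<Longrightarrow> \<bar>G x - G y\<bar> \<le> k * d x y"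
  shows "continuous_map mtopology euclideanreal G"
proof -
  have "openin mtopology {x \<in> M. G x \<in> U}" if U: "open U" for U
    unfolding openin_mtopology
  proof (intro conjI allI impI)
    fix x assume x: "x \<in> {x \<in> M. G x \<in> U}"
    then obtain e where e: "e > 0" "\<And>y. dist y (G x) < e \<Longrightarrow> y \<in> U"
      using U by (auto simp: open_dist)
    \<comment> \<open>\<open>\<bar>k\<bar> + 1\<close> in place of \<open>k\<close> keeps the radius
      positive whatever the sign of \<open>k\<close>.\<close>
    have "mball x (e / (\<bar>k\<bar> + 1)) \<subseteq> {x \<in> M. G x \<in> U}"
    proof
      fix y assume y: "y \<in> mball x (e / (\<bar>k\<bar> + 1))"
      then have y': "y \<in> M" "d x y * (\<bar>k\<bar> + 1) < e" by (auto simp: pos_less_divide_eq)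
      have "\<bar>G y - G x\<bar> \<le> k * d x y" using assms[of y x] x y' by (simp add: commute)
      also have "\<dots> \<le> d x y * (\<bar>k\<bar> + 1)"
        using mult_right_mono[of k "\<bar>k\<bar> + 1" "d x y"] by (simp add: mult.commute)
      finally show "y \<in> {x \<in> M. G x \<in> U}" using y' e(2)[of "G y"] by (simp add: dist_real_def)
    qed
    then show "\<exists>r>0. mball x r \<subseteq> {x \<in> M. G x \<in> U}"
      using e(1) by (intro exI[of _ "e / (\<bar>k\<bar> + 1)"]) (auto intro!: divide_pos_pos)
  qed auto
  then show ?thesis by (simp add: continuous_map_def)
qed

text \<open>A continuous bounded \<open>F\<close> is the pointwise limit of its Lipschitz minorants,
  so the integrals of \<open>F\<close> along \<open>X n\<close> eventually exceed the integral along
  \<open>Y\<close> minus \<open>e\<close>. The same bound for \<open>- F\<close> gives the other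
  direction.\<close>

lemma converges_in_distribution_lipschitzI:
  assumes P: "prob_space P" and Q: "prob_space Q"
    and X: "\<And>n. X n \<in> measurable P (borel_of mtopology)" and Y: "Y \<in> measurable Q (borel_of mtopology)"
    and lip: "\<And>G B k. \<lbrakk>\<And>x. x \<in> M \<Longrightarrow> \<bar>G x\<bar> \<le> B; 0 \<le> k;
        \<And>x y. x \<in> M \<Longrightarrow> y \<in> M \<Longrightarrow> \<bar>G x - G y\<bar> \<le> k * d x y\<rbrakk> \<Longrightarrow>
        (\<lambda>n. LINT \<omega>|P. G (X n \<omega>)) \<longlonglongrightarrow> (LINT \<omega>|Q. G (Y \<omega>))"
  shows "converges_in_distribution mtopology P X Q Y"
  unfolding converges_in_distribution_def
proof (intro conjI allI impI X Y)
  interpret P: prob_space P by (rule P)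
  interpret Q: prob_space Q by (rule Q)
  have XM: "X n \<omega> \<in> M" if "\<omega> \<in> space P" for n \<omega>
    using measurable_space[OF X that] by (simp add: space_borel_of)
  have YM: "Y \<omega> \<in> M" if "\<omega> \<in> space Q" for \<omega>
    using measurable_space[OF Y that] by (simp add: space_borel_of)
  have ne: "M \<noteq> {}" using Q.not_empty YM by blast
  have lower: "\<forall>\<^sub>F n in sequentially. (LINT \<omega>|Q. F (Y \<omega>)) - e < (LINT \<omega>|P. F (X n \<omega>))"
    if F: "continuous_map mtopology euclideanreal F" and B: "\<And>x. x \<in> M \<Longrightarrow> \<bar>F x\<bar> \<le> B" and e: "e > 0"
    for F B e
  proof -
    define G where "G k x = (INF y\<in>M. F y + real k * d x y)" for k x
    have G: "x \<in> M \<Longrightarrow> G k x \<le> F x" "x \<in> M \<Longrightarrow> \<bar>G k x\<bar> \<le> B"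
      "x \<in> M \<Longrightarrow> z \<in> M \<Longrightarrow> \<bar>G k x - G k z\<bar> \<le> real k * d x z" for k x z
      unfolding G_def by (rule lipschitz_minorant[OF ne B of_nat_0_le_iff]; assumption)+
    have Gc: "continuous_map mtopology euclideanreal (G k)" for k
      by (rule lipschitz_continuous_map) (rule G(3))
    note [measurable] = measurable_compose[OF X measurable_borel_of_continuous_map]
      measurable_compose[OF Y measurable_borel_of_continuous_map]
    note [simp] = F Gc
    have intP: "integrable P (\<lambda>\<omega>. H (X n \<omega>))" if "continuous_map mtopology euclideanreal H" "\<And>x. x \<in> M \<Longrightarrow> \<bar>H x\<bar> \<le> B" for H n
      by (rule P.integrable_const_bound[of _ B])
        (use that XM in \<open>auto intro: measurable_compose[OF X measurable_borel_of_continuous_map]\<close>)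
    have "(\<lambda>k. LINT \<omega>|Q. G k (Y \<omega>)) \<longlonglongrightarrow> (LINT \<omega>|Q. F (Y \<omega>))"
    proof (rule integral_dominated_convergence[where w="\<lambda>_. B"])
      show "AE \<omega> in Q. (\<lambda>k. G k (Y \<omega>)) \<longlonglongrightarrow> F (Y \<omega>)"
        unfolding G_def by (rule AE_I2) (rule lipschitz_minorant_tendsto[OF F B YM])
      show "AE \<omega> in Q. norm (G k (Y \<omega>)) \<le> B" for k
        using G(2)[OF YM] by (intro AE_I2) auto
    qed (auto intro: measurable_compose[OF Y measurable_borel_of_continuous_map])
    then have "\<forall>\<^sub>F k in sequentially. (LINT \<omega>|Q. F (Y \<omega>)) - e < (LINT \<omega>|Q. G k (Y \<omega>))"
      using e by (intro order_tendstoD(1)) auto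
    then obtain k where k: "(LINT \<omega>|Q. F (Y \<omega>)) - e < (LINT \<omega>|Q. G k (Y \<omega>))"
      using eventually_happens'[OF sequentially_bot] by blast
    have "(\<lambda>n. LINT \<omega>|P. G k (X n \<omega>)) \<longlonglongrightarrow> (LINT \<omega>|Q. G k (Y \<omega>))"
      by (rule lip[OF G(2) of_nat_0_le_iff G(3)])
    then have "\<forall>\<^sub>F n in sequentially. (LINT \<omega>|Q. F (Y \<omega>)) - e < (LINT \<omega>|P. G k (X n \<omega>))"
      using k by (rule order_tendstoD(1))
    then show ?thesis
    proof eventually_elim
      case (elim n)
      have "(LINT \<omega>|P. G k (X n \<omega>)) \<le> (LINT \<omega>|P. F (X n \<omega>))"
        by (rule integral_mono[OF intP intP]) (use F B G(1,2) XM Gc in auto)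
      then show ?case using elim by linarith
    qed
  qed
  fix F assume F: "continuous_map mtopology euclideanreal F \<and> bounded (F ` topspace mtopology)"
  then obtain B where B: "\<And>x. x \<in> M \<Longrightarrow> \<bar>F x\<bar> \<le> B" by (auto simp: bounded_iff)
  have F': "continuous_map mtopology euclideanreal (\<lambda>x. - F x)"
    using F by (auto intro: continuous_map_minus)
  show "(\<lambda>n. LINT \<omega>|P. F (X n \<omega>)) \<longlonglongrightarrow> (LINT \<omega>|Q. F (Y \<omega>))"
    unfolding tendsto_iff
  proof (intro allI impI)
    fix e :: real assume e: "e > 0"
    have "\<forall>\<^sub>F n in sequentially. (LINT \<omega>|Q. F (Y \<omega>)) - e < (LINT \<omega>|P. F (X n \<omega>))"
      using F B e by (intro lower) auto
    moreover have "\<forall>\<^sub>F n in sequentially. (LINT \<omega>|Q. - F (Y \<omega>)) - e < (LINT \<omega>|P. - F (X n \<omega>))"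
      using F' B e by (intro lower[of _ B]) auto
    ultimately show "\<forall>\<^sub>F n in sequentially. dist (LINT \<omega>|P. F (X n \<omega>)) (LINT \<omega>|Q. F (Y \<omega>)) < e"
      by eventually_elim (simp add: dist_real_def)
  qed
qed

end

section \<open>Trigonometric test functions in finitely many coordinates\<close>

text \<open>The linear span of phase-shifted cosines: real functions whose expectations are
  determined by characteristic functions of linear combinations. The phase \<open>c\<close> includes
  the sines. Points are whole sequences although only the coordinates below \<open>N\<close> count,
  which avoids a separate type for each dimension.\<close>

inductive_set trig :: "nat \<Rightarrow> ((nat \<Rightarrow> real) \<Rightarrow> real) set" for N where
  cos: "(\<lambda>y. cos ((\<Sum>k<N. t k * y k) + c)) \<in> trig N"
| add: "f \<in> trig N \<Longrightarrow> g \<in> trig N \<Longrightarrow> (\<lambda>y. f y + g y) \<in> trig N"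
| scale: "f \<in> trig N \<Longrightarrow> (\<lambda>y. c * f y) \<in> trig N"

lemma trig_const: "(\<lambda>_. c) \<in> trig N"
  using trig.scale[OF trig.cos[where t="\<lambda>_. 0" and c=0 and N=N], of c] by simp

text \<open>The product-to-sum formula turns the span into an algebra, as Stone-Weierstrass
  requires.\<close>

lemma trig_mult_cos:
  assumes "f \<in> trig N"
  shows "(\<lambda>y. f y * cos ((\<Sum>k<N. t k * y k) + c)) \<in> trig N"
  using assms
proof induction
  case (cos s b)
  have "(\<lambda>y. cos ((\<Sum>k<N. s k * y k) + b) * cos ((\<Sum>k<N. t k * y k) + c)) =
      (\<lambda>y. 1/2 * (cos ((\<Sum>k<N. (s k - t k) * y k) + (b - c)) + cos ((\<Sum>k<N. (s k + t k) * y k) + (b + c))))"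
    by (auto simp: fun_eq_iff cos_times_cos sum.distrib sum_subtractf algebra_simps)
  also have "\<dots> \<in> trig N" by (intro trig.intros)
  finally show ?case .
next
  case (add f g)
  then show ?case by (auto simp: distrib_right intro: trig.add)
next
  case (scale f a)
  then show ?case by (auto simp: mult.assoc intro: trig.scale)
qed

lemma trig_mult:
  assumes "g \<in> trig N" "f \<in> trig N"
  shows "(\<lambda>y. f y * g y) \<in> trig N"
  using assms
proof induction
  case (cos t c)
  then show ?case by (rule trig_mult_cos)
next
  case (add g h)
  then show ?case by (auto simp: distrib_left intro: trig.add)
next
  case (scale g c)
  then show ?case by (auto simp: mult.left_commute intro: trig.scale)
qed

lemma trig_continuous: "f \<in> trig N \<Longrightarrow> continuous_on UNIV f"
proof (induction rule: trig.induct)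
  case (cos t c)
  then show ?case
    by (intro continuous_intros continuous_on_product_then_coordinatewise[OF continuous_on_id, simplified])
qed (auto intro!: continuous_intros)

lemma trig_bounded: "f \<in> trig N \<Longrightarrow> \<exists>B. \<forall>y. \<bar>f y\<bar> \<le> B"
proof (induction rule: trig.induct)
  case (cos t c)
  show ?case by (rule exI[of _ 1]) simp
next
  case (add f g)
  then obtain A B where "\<bar>f y\<bar> \<le> A" "\<bar>g y\<bar> \<le> B" for y by blast
  then have "\<bar>f y + g y\<bar> \<le> A + B" for y
    using abs_triangle_ineq[of "f y" "g y"] by (meson add_mono order_trans)
  then show ?case by blast
next
  case (scale f c)
  then obtain A where "\<bar>f y\<bar> \<le> A" for y by blast
  then have "\<bar>c * f y\<bar> \<le> \<bar>c\<bar> * A" for y by (simp add: abs_mult mult_left_mono)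
  then show ?case by blast
qed

lemma trig_polynomial:
  assumes "real_polynomial_function p" "f \<in> trig N"
  shows "(\<lambda>y. p (f y)) \<in> trig N"
  using assms(1)
proof induction
  case (linear h)
  then have "h x = h 1 * x" for x :: real
    using linear_scale[OF bounded_linear.linear[OF linear], of x 1] by simp
  then have "(\<lambda>y. h (f y)) = (\<lambda>y. h 1 * f y)" by (intro ext)
  then show ?case using trig.scale[OF assms(2)] by simp
qed (auto intro: trig_const trig.add trig_mult)

text \<open>Coordinates from \<open>N\<close> on are frozen at 0, since \<open>trig N\<close> cannot
  separate points that differ only there; compactness is then Tychonoff's theorem.\<close>

lemma compact_box:
  fixes R :: real
  shows "compact {y::nat \<Rightarrow> real. \<forall>k. y k \<in> (if k < N then {-R..R} else {0})}"
proof -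
  have "compactin (product_topology (\<lambda>_. euclidean) UNIV) (Pi\<^sub>E (UNIV::nat set) (\<lambda>k. if k < N then {-R..R} else {0}))"
    by (subst compactin_PiE) auto
  also have "Pi\<^sub>E (UNIV::nat set) (\<lambda>k. if k < N then {-R..R} else {0}) =
      {y::nat \<Rightarrow> real. \<forall>k. y k \<in> (if k < N then {-R..R} else {0})}"
    by (auto simp: PiE_UNIV_domain Pi_def)
  finally show ?thesis by (simp add: euclidean_product_topology)
qed

text \<open>Stone-Weierstrass alone gives no control of the approximant outside the compact box. Truncating
  it at level \<open>B\<close> restores a global bound, and the truncation is itself uniformly close to a polynomial
  on the bounded range of the approximant.\<close>

lemma trig_approximation:
  fixes h :: "(nat \<Rightarrow> real) \<Rightarrow> real" and R :: real and N :: nat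
  assumes h: "continuous_on UNIV h" and B: "\<And>y. \<bar>h y\<bar> \<le> B" and e: "e > 0"
  defines "S \<equiv> {y::nat \<Rightarrow> real. \<forall>k. y k \<in> (if k < N then {-R..R} else {0})}"
  shows "\<exists>g\<in>trig N. (\<forall>y\<in>S. \<bar>g y - h y\<bar> \<le> e) \<and> (\<forall>y. \<bar>g y\<bar> \<le> B + e)"
proof -
  interpret function_ring_on "trig N" S
  proof
    show "compact S" unfolding S_def by (rule compact_box)
    show "\<exists>f\<in>trig N. f x \<noteq> f y" if "x \<in> S" "y \<in> S" "x \<noteq> y" for x y
    proof -
      obtain i where i: "x i \<noteq> y i" using \<open>x \<noteq> y\<close> by (meson ext)
      then have "i < N" using that by (auto simp: S_def split: if_splits) (metis)
      \<comment> \<open>This scale puts \<open>c * x i\<close> and \<open>c * y i\<close> into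
        [-pi/2, pi/2], where the sine is injective; the phase \<open>- pi / 2\<close> in
        \<open>f\<close> turns the cosine into that sine.\<close>
      define c where "c = pi / (2 * (\<bar>x i\<bar> + \<bar>y i\<bar> + 1))"
      define f where "f = (\<lambda>z::nat\<Rightarrow>real. cos ((\<Sum>k<N. (if k = i then c else 0) * z k) + - pi / 2))"
      have f: "f z = sin (c * z i)" for z
      proof -
        have "(\<Sum>k<N. (if k = i then c else 0) * z k) = (\<Sum>k<N. if k = i then c * z i else 0)"
          by (intro sum.cong) auto
        also have "\<dots> = c * z i" using \<open>i < N\<close> by simp
        finally show ?thesis by (simp add: f_def cos_diff)
      qed
      have "c > 0" unfolding c_def by (intro divide_pos_pos) auto
      have bnd: "- (pi / 2) \<le> c * t \<and> c * t \<le> pi / 2" if "\<bar>t\<bar> \<le> \<bar>x i\<bar> + \<bar>y i\<bar> + 1" for t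
      proof -
        have "\<bar>c * t\<bar> \<le> c * (\<bar>x i\<bar> + \<bar>y i\<bar> + 1)"
          using that \<open>c > 0\<close> by (simp add: abs_mult)
        also have "\<dots> = pi / 2" by (simp add: c_def field_simps add_nonneg_eq_0_iff)
        finally show ?thesis by linarith
      qed
      have "f x \<noteq> f y"
      proof
        assume "f x = f y"
        then have "sin (c * x i) = sin (c * y i)" by (simp only: f)
        moreover have "\<bar>x i\<bar> \<le> \<bar>x i\<bar> + \<bar>y i\<bar> + 1" "\<bar>y i\<bar> \<le> \<bar>x i\<bar> + \<bar>y i\<bar> + 1" by simp_all
        ultimately have "c * x i = c * y i" using bnd by (meson sin_inj_pi)
        then show False using \<open>c > 0\<close> i by simp
      qed
      moreover have "f \<in> trig N" unfolding f_def by (rule trig.cos)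
      ultimately show ?thesis by blast
    qed
  qed (auto intro: trig.intros trig_mult trig_const continuous_on_subset[OF trig_continuous])
  have "B \<ge> 0" using B[of "\<lambda>_. 0"] by linarith
  obtain g where g: "g \<in> trig N" "\<And>y. y \<in> S \<Longrightarrow> \<bar>h y - g y\<bar> < e / 2"
    using Stone_Weierstrass_basic[OF continuous_on_subset[OF h], of "e / 2"] e by auto
  obtain C where C: "\<And>y. \<bar>g y\<bar> \<le> C" using trig_bounded[OF g(1)] by blast
  define clip where "clip t = max (- B) (min B t)" for t :: real
  have "continuous_on {-C..C} clip" unfolding clip_def by (intro continuous_intros)
  then obtain p where p: "real_polynomial_function p" "\<And>t. t \<in> {-C..C} \<Longrightarrow> \<bar>clip t - p t\<bar> < e / 2"
    using Stone_Weierstrass_real_polynomial_function[of "{-C..C}" clip "e / 2"] e by auto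
  have pg: "\<bar>clip (g y) - p (g y)\<bar> < e / 2" for y using C[of y] by (intro p(2)) (auto simp: abs_le_iff)
  \<comment> \<open>As \<open>\<bar>h y\<bar> \<le> B\<close>, clipping at \<open>B\<close> does not
    move \<open>g y\<close> away from \<open>h y\<close>.\<close>
  have "\<bar>p (g y) - h y\<bar> \<le> e" if "y \<in> S" for y
    using pg[of y] g(2)[OF that] B[of y] unfolding clip_def by linarith
  moreover have "\<bar>p (g y)\<bar> \<le> B + e" for y
    using pg[of y] \<open>B \<ge> 0\<close> e unfolding clip_def by linarith
  ultimately show ?thesis using trig_polynomial[OF p(1) g(1)]
    by (intro bexI[of _ "\<lambda>y. p (g y)"]) auto
qed

lemma borel_measurable_coordinate: "(\<lambda>y::nat \<Rightarrow> real. y k) \<in> borel_measurable borel"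
  by (rule measurable_product_then_coordinatewise) simp

lemma trig_measurable: "f \<in> trig N \<Longrightarrow> f \<in> borel_measurable borel"
  by (rule borel_measurable_continuous_onI[OF trig_continuous])

text \<open>Chebyshev's inequality in pointwise form: outside the box some coordinate exceeds
  \<open>R\<close>, so the crude bound \<open>B + C\<close> is at most
  \<open>(B + C) / R\<^sup>2\<close> times the sum of the squared coordinates.\<close>

lemma trig_expectation_error:
  fixes X :: "'a \<Rightarrow> nat \<Rightarrow> real" and g h :: "(nat \<Rightarrow> real) \<Rightarrow> real"
  assumes "prob_space P" and X: "X \<in> borel_measurable P"
    and supp: "\<And>\<omega> k. \<omega> \<in> space P \<Longrightarrow> N \<le> k \<Longrightarrow> X \<omega> k = 0"
    and int: "\<And>k. integrable P (\<lambda>\<omega>. (X \<omega> k)\<^sup>2)" and second: "\<And>k. (LINT \<omega>|P. (X \<omega> k)\<^sup>2) \<le> 1"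
    and h: "h \<in> borel_measurable borel" "\<And>y. \<bar>h y\<bar> \<le> B"
    and g: "g \<in> borel_measurable borel" "\<And>y. \<bar>g y\<bar> \<le> C"
    and R: "R > 0" and close: "\<And>y. (\<forall>k. y k \<in> (if k < N then {-R..R} else {0})) \<Longrightarrow> \<bar>g y - h y\<bar> \<le> e"
  shows "\<bar>(LINT \<omega>|P. g (X \<omega>)) - (LINT \<omega>|P. h (X \<omega>))\<bar> \<le> e + (B + C) * N / R\<^sup>2"
proof -
  interpret prob_space P by fact
  have meas: "(\<lambda>\<omega>. g (X \<omega>)) \<in> borel_measurable P" "(\<lambda>\<omega>. h (X \<omega>)) \<in> borel_measurable P"
    by (rule measurable_compose[OF X g(1)], rule measurable_compose[OF X h(1)])
  have intg: "integrable P (\<lambda>\<omega>. g (X \<omega>))" "integrable P (\<lambda>\<omega>. h (X \<omega>))"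
    by (rule integrable_const_bound[of _ C], use meas g in auto)
       (rule integrable_const_bound[of _ B], use meas h in auto)
  have e: "0 \<le> e" by (rule order_trans[OF abs_ge_zero close[of "\<lambda>_. 0"]]) (use R in auto)
  have BC: "0 \<le> B + C" by (intro add_nonneg_nonneg order_trans[OF abs_ge_zero h(2)] order_trans[OF abs_ge_zero g(2)])
  have pt: "\<bar>g (X \<omega>) - h (X \<omega>)\<bar> \<le> e + (B + C) / R\<^sup>2 * (\<Sum>k<N. (X \<omega> k)\<^sup>2)" if \<omega>: "\<omega> \<in> space P" for \<omega>
  proof (cases "\<forall>k<N. \<bar>X \<omega> k\<bar> \<le> R")
    case True
    then have "\<bar>g (X \<omega>) - h (X \<omega>)\<bar> \<le> e"
      by (intro close) (auto simp: supp[OF \<omega>] abs_le_iff)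
    moreover have "0 \<le> (B + C) / R\<^sup>2 * (\<Sum>k<N. (X \<omega> k)\<^sup>2)"
      using BC by (intro mult_nonneg_nonneg sum_nonneg) auto
    ultimately show ?thesis by linarith
  next
    case False
    then obtain k where k: "k < N" "R < \<bar>X \<omega> k\<bar>" by force
    then have "R\<^sup>2 \<le> (X \<omega> k)\<^sup>2" using R by (metis abs_le_square_iff abs_of_pos less_eq_real_def)
    also have "\<dots> \<le> (\<Sum>k<N. (X \<omega> k)\<^sup>2)" using k by (intro member_le_sum) auto
    finally have "(B + C) / R\<^sup>2 * R\<^sup>2 \<le> (B + C) / R\<^sup>2 * (\<Sum>k<N. (X \<omega> k)\<^sup>2)"
      using BC by (intro mult_left_mono) auto
    moreover have "(B + C) / R\<^sup>2 * R\<^sup>2 = B + C" using R by simp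
    ultimately show ?thesis using h(2)[of "X \<omega>"] g(2)[of "X \<omega>"] e by linarith
  qed
  have "\<bar>(LINT \<omega>|P. g (X \<omega>)) - (LINT \<omega>|P. h (X \<omega>))\<bar> = \<bar>LINT \<omega>|P. g (X \<omega>) - h (X \<omega>)\<bar>"
    using intg by simp
  also have "\<dots> \<le> (LINT \<omega>|P. \<bar>g (X \<omega>) - h (X \<omega>)\<bar>)" by simp
  also have "\<dots> \<le> (LINT \<omega>|P. e + (B + C) / R\<^sup>2 * (\<Sum>k<N. (X \<omega> k)\<^sup>2))"
    using pt intg int by (intro integral_mono) auto
  also have "\<dots> = e + (B + C) / R\<^sup>2 * (\<Sum>k<N. LINT \<omega>|P. (X \<omega> k)\<^sup>2)"
    using int by (simp add: prob_space)
  also have "\<dots> \<le> e + (B + C) / R\<^sup>2 * N"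
    using sum_mono[of "{..<N}" "\<lambda>k. LINT \<omega>|P. (X \<omega> k)\<^sup>2" "\<lambda>_. 1"] second BC
    by (intro add_left_mono mult_left_mono) auto
  finally show ?thesis by simp
qed

text \<open>Bounded second moments give tightness uniformly in \<open>n\<close>, so one box and one
  trigonometric approximant serve all \<open>X n\<close> and \<open>Y\<close>; for the approximant,
  convergence is \<open>conv\<close> extended by linearity.\<close>

proposition finite_dim_convergence:
  fixes X :: "nat \<Rightarrow> 'a \<Rightarrow> nat \<Rightarrow> real" and Y :: "'b \<Rightarrow> nat \<Rightarrow> real"
    and h :: "(nat \<Rightarrow> real) \<Rightarrow> real"
  assumes P: "prob_space P" and Q: "prob_space Q"
    and X: "\<And>n. X n \<in> borel_measurable P" and Y: "Y \<in> borel_measurable Q"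
    and X0: "\<And>n \<omega> k. \<omega> \<in> space P \<Longrightarrow> N \<le> k \<Longrightarrow> X n \<omega> k = 0"
    and Y0: "\<And>\<omega> k. \<omega> \<in> space Q \<Longrightarrow> N \<le> k \<Longrightarrow> Y \<omega> k = 0"
    and X2: "\<And>n k. integrable P (\<lambda>\<omega>. (X n \<omega> k)\<^sup>2)" "\<And>n k. (LINT \<omega>|P. (X n \<omega> k)\<^sup>2) \<le> 1"
    and Y2: "\<And>k. integrable Q (\<lambda>\<omega>. (Y \<omega> k)\<^sup>2)" "\<And>k. (LINT \<omega>|Q. (Y \<omega> k)\<^sup>2) \<le> 1"
    and conv: "\<And>t c. (\<lambda>n. LINT \<omega>|P. cos ((\<Sum>k<N. t k * X n \<omega> k) + c)) \<longlonglongrightarrow>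
        (LINT \<omega>|Q. cos ((\<Sum>k<N. t k * Y \<omega> k) + c))"
    and h: "continuous_on UNIV h" and B: "\<And>y. \<bar>h y\<bar> \<le> B"
  shows "(\<lambda>n. LINT \<omega>|P. h (X n \<omega>)) \<longlonglongrightarrow> (LINT \<omega>|Q. h (Y \<omega>))"
proof -
  interpret P: prob_space P by (rule P)
  interpret Q: prob_space Q by (rule Q)
  have int: "integrable P (\<lambda>\<omega>. f (X n \<omega>))" "integrable Q (\<lambda>\<omega>. f (Y \<omega>))" if f: "f \<in> trig N" for f n
  proof -
    obtain C where C: "\<And>y. \<bar>f y\<bar> \<le> C" using trig_bounded[OF f] by blast
    show "integrable P (\<lambda>\<omega>. f (X n \<omega>))" "integrable Q (\<lambda>\<omega>. f (Y \<omega>))"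
      by (rule P.integrable_const_bound[of _ C] Q.integrable_const_bound[of _ C];
        use C in \<open>auto intro!: measurable_compose[OF X trig_measurable[OF f]] measurable_compose[OF Y trig_measurable[OF f]]\<close>)+
  qed
  have trig: "(\<lambda>n. LINT \<omega>|P. f (X n \<omega>)) \<longlonglongrightarrow> (LINT \<omega>|Q. f (Y \<omega>))" if "f \<in> trig N" for f
    using that
  proof induction
    case (cos t c)
    show ?case by (rule conv)
  next
    case (add f g)
    then show ?case using int by (auto intro: tendsto_add)
  next
    case (scale f c)
    then show ?case by (auto intro: tendsto_mult)
  qed
  have hm: "h \<in> borel_measurable borel" by (rule borel_measurable_continuous_onI[OF h])
  have "0 \<le> B" by (rule order_trans[OF abs_ge_zero B])
  show ?thesis
    unfolding tendsto_iff
  proof (intro allI impI)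
    fix e :: real assume e: "e > 0"
    \<comment> \<open>Five errors of size at most \<open>e'\<close> arise: two for
      \<open>X n\<close>, two for \<open>Y\<close>, one for the trigonometric function. The cap 1
      lets \<open>B + 1\<close> bound the approximant independently of \<open>e\<close>.\<close>
    define e' where "e' = min 1 (e / 8)"
    have e': "e' > 0" "e' \<le> 1" "e' \<le> e / 8" using e by (auto simp: e'_def)
    define D where "D = (B + (B + 1)) * N"
    have "D \<ge> 0" using \<open>0 \<le> B\<close> by (simp add: D_def)
    \<comment> \<open>Chosen so that \<open>D / R\<^sup>2 \<le> e'\<close>; the summand 1 keeps
      \<open>R\<close> positive when \<open>D = 0\<close>.\<close>
    define R where "R = sqrt (D / e' + 1)"
    have "D / e' \<ge> 0" using \<open>D \<ge> 0\<close> e' by simp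
    then have R: "R > 0" "R\<^sup>2 = D / e' + 1" by (auto simp: R_def)
    have DR: "D / R\<^sup>2 \<le> e'"
    proof -
      have "D \<le> e' * R\<^sup>2" using e' by (simp add: R(2) field_simps)
      then show ?thesis using R(1) by (simp add: pos_divide_le_eq)
    qed
    obtain g where g: "g \<in> trig N"
        "\<And>y. \<forall>k. y k \<in> (if k < N then {-R..R} else {0}) \<Longrightarrow> \<bar>g y - h y\<bar> \<le> e'"
        "\<And>y. \<bar>g y\<bar> \<le> B + e'"
      using trig_approximation[OF h B e'(1), of N R] by blast
    have gB: "\<bar>g y\<bar> \<le> B + 1" for y using g(3)[of y] e' by linarith
    have eX: "\<bar>(LINT \<omega>|P. g (X n \<omega>)) - (LINT \<omega>|P. h (X n \<omega>))\<bar> \<le> e' + D / R\<^sup>2" for n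
      unfolding D_def
      by (rule trig_expectation_error[OF P X X0 X2 hm B trig_measurable[OF g(1)] gB R(1) g(2)])
    have eY: "\<bar>(LINT \<omega>|Q. g (Y \<omega>)) - (LINT \<omega>|Q. h (Y \<omega>))\<bar> \<le> e' + D / R\<^sup>2"
      unfolding D_def
      by (rule trig_expectation_error[OF Q Y Y0 Y2 hm B trig_measurable[OF g(1)] gB R(1) g(2)])
    have "\<forall>\<^sub>F n in sequentially. dist (LINT \<omega>|P. g (X n \<omega>)) (LINT \<omega>|Q. g (Y \<omega>)) < e'"
      using trig[OF g(1)] e'(1) by (auto simp: tendsto_iff)
    then show "\<forall>\<^sub>F n in sequentially. dist (LINT \<omega>|P. h (X n \<omega>)) (LINT \<omega>|Q. h (Y \<omega>)) < e"
    proof eventually_elim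
      case (elim n)
      then show ?case
        using eX[of n] eY DR e' e unfolding dist_real_def by linarith
    qed
  qed
qed

section \<open>Orthogonal expansion of the kernel\<close>

text \<open>Density of \<open>xs\<close> refers to the pseudometric that \<open>l\<close> induces
  from L2 of \<open>\<mu>\<close>, so the parameters may form an abstract finite measure
  space.\<close>

locale kernel_process = mu: prob_space \<mu> + M: finite_measure M
  for \<mu> :: "'s::{second_countable_topology, metric_space} measure" and M :: "'x measure" +
  fixes l :: "'s \<Rightarrow> 'x \<Rightarrow> real" and L :: real and xs :: "nat \<Rightarrow> 'x"
  assumes sets_mu: "sets \<mu> = sets borel"
    and l_measurable: "(\<lambda>(w, x). l w x) \<in> borel_measurable (borel \<Otimes>\<^sub>M M)"
    and l_bounded: "\<And>w x. x \<in> space M \<Longrightarrow> \<bar>l w x\<bar> \<le> L"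
    and l_continuous: "\<And>x. x \<in> space M \<Longrightarrow> continuous_on UNIV (\<lambda>w. l w x)"
    and l_centred: "\<And>x. x \<in> space M \<Longrightarrow> (LINT w|\<mu>. l w x) = 0"
    and xs_in: "\<And>n. xs n \<in> space M"
    and xs_dense: "\<And>x e. x \<in> space M \<Longrightarrow> 0 < e \<Longrightarrow> \<exists>j. (LINT w|\<mu>. (l w x - l w (xs j))\<^sup>2) < e"
begin

declare sets_mu [measurable_cong]

text \<open>Gram-Schmidt orthogonalisation in \<open>L\<^sup>2(\<mu>)\<close> along the dense sequence: \<open>res n _ x\<close> is the
  residual of \<open>l _ x\<close>. Where the pivot vanishes, division by \<open>0\<close> makes \<open>basis n\<close> and
  \<open>coef n\<close> identically \<open>0\<close>, as they should be.\<close>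

primrec res :: "nat \<Rightarrow> 's \<Rightarrow> 'x \<Rightarrow> real" where
  "res 0 w x = l w x"
| "res (Suc n) w x = res n w x -
     res n w (xs n) / sqrt (LINT v|\<mu>. res n v (xs n) * res n v (xs n)) *
     ((LINT v|\<mu>. res n v x * res n v (xs n)) / sqrt (LINT v|\<mu>. res n v (xs n) * res n v (xs n)))"

definition cov :: "nat \<Rightarrow> 'x \<Rightarrow> 'x \<Rightarrow> real" where
  "cov n x y = (LINT w|\<mu>. res n w x * res n w y)"

definition pivot :: "nat \<Rightarrow> real" where
  "pivot n = sqrt (cov n (xs n) (xs n))"

definition basis :: "nat \<Rightarrow> 's \<Rightarrow> real" where
  "basis n w = res n w (xs n) / pivot n"

definition coef :: "nat \<Rightarrow> 'x \<Rightarrow> real" where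
  "coef n x = cov n x (xs n) / pivot n"

text \<open>The readable form of the recursion: \<open>res\<close> has to spell out
  \<open>basis\<close> and \<open>coef\<close>, since these are defined from it.\<close>

lemma res_Suc: "res (Suc n) w x = res n w x - basis n w * coef n x"
  by (simp add: basis_def coef_def cov_def pivot_def)

declare res.simps(2) [simp del]

text \<open>The induction has to carry joint measurability, because the next coefficient is an
  integral over \<open>w\<close> depending on \<open>x\<close>.\<close>

lemma res_measurable: "(\<lambda>(w, x). res n w x) \<in> borel_measurable (borel \<Otimes>\<^sub>M M)"
proof (induction n)
  case 0
  then show ?case using l_measurable by simp
next
  case (Suc n)
  note [measurable] = Suc xs_in
  have [measurable]: "basis n \<in> borel_measurable borel"
    unfolding basis_def by measurable
  have [measurable]: "coef n \<in> borel_measurable M"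
    unfolding coef_def cov_def by measurable
  show ?case unfolding res_Suc by measurable
qed

lemmas [measurable] = res_measurable xs_in

lemma res_measurable_fst [measurable]: "x \<in> space M \<Longrightarrow> (\<lambda>w. res n w x) \<in> borel_measurable borel"
  by measurable

lemma basis_measurable [measurable]: "basis n \<in> borel_measurable borel"
  unfolding basis_def by measurable

lemma coef_measurable [measurable]: "coef n \<in> borel_measurable M"
  unfolding coef_def cov_def by measurable

lemma cov_diag_measurable [measurable]: "(\<lambda>x. cov n x x) \<in> borel_measurable M"
  unfolding cov_def by measurable

text \<open>This bound deteriorates with each division by a pivot and serves for integrability;
  bounds uniform in \<open>n\<close> come later from the diagonal of \<open>cov\<close>.\<close>

lemma res_bounded: "\<exists>C\<ge>0. \<forall>w. \<forall>x\<in>space M. \<bar>res n w x\<bar> \<le> C"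
proof (induction n)
  case 0
  obtain x where x: "x \<in> space M" using xs_in by blast
  show ?case
    using l_bounded order_trans[OF abs_ge_zero l_bounded[OF x]] by (intro exI[of _ L]) auto
next
  case (Suc n)
  then obtain C where C: "C \<ge> 0" "\<And>w x. x \<in> space M \<Longrightarrow> \<bar>res n w x\<bar> \<le> C" by blast
  have cov_le: "\<bar>cov n x (xs n)\<bar> \<le> C * C" if x: "x \<in> space M" for x
  proof -
    have "norm (cov n x (xs n)) \<le> (LINT w|\<mu>. norm (res n w x * res n w (xs n)))"
      unfolding cov_def by (rule integral_norm_bound)
    also have "\<dots> \<le> (LINT w|\<mu>. C * C)"
    proof (rule integral_mono')
      show "norm (res n w x * res n w (xs n)) \<le> C * C" for w
        using C(2)[OF x] C(2)[OF xs_in] C(1) by (simp add: abs_mult mult_mono)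
    qed (use C(1) in auto)
    finally show ?thesis by (simp add: mu.prob_space)
  qed
  have p: "pivot n \<ge> 0" by (simp add: pivot_def cov_def)
  have "\<bar>res (Suc n) w x\<bar> \<le> C + C / pivot n * (C * C / pivot n)" if x: "x \<in> space M" for w x
  proof -
    have "\<bar>basis n w\<bar> \<le> C / pivot n" "\<bar>coef n x\<bar> \<le> C * C / pivot n"
      using divide_right_mono[OF C(2)[OF xs_in] p] divide_right_mono[OF cov_le[OF x] p] p
      by (simp_all add: basis_def coef_def)
    then have "\<bar>basis n w * coef n x\<bar> \<le> C / pivot n * (C * C / pivot n)"
      unfolding abs_mult using C(1) p by (intro mult_mono) auto
    then show ?thesis unfolding res_Suc using C(2)[OF x, of w] by linarith
  qed
  moreover have "0 \<le> C + C / pivot n * (C * C / pivot n)" using C(1) p by simp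
  ultimately show ?case by blast
qed

lemma res_integrable: "x \<in> space M \<Longrightarrow> integrable \<mu> (\<lambda>w. res n w x)"
proof -
  assume x: "x \<in> space M"
  obtain C where C: "\<And>w x. x \<in> space M \<Longrightarrow> \<bar>res n w x\<bar> \<le> C" using res_bounded by blast
  then show ?thesis using x by (intro mu.integrable_const_bound[of _ C]) auto
qed

lemma res_mult_integrable:
  assumes "x \<in> space M" "y \<in> space M"
  shows "integrable \<mu> (\<lambda>w. res n w x * res m w y)"
proof -
  obtain C where C: "0 \<le> C" "\<And>w x. x \<in> space M \<Longrightarrow> \<bar>res n w x\<bar> \<le> C" using res_bounded by blast
  obtain D where D: "\<And>w x. x \<in> space M \<Longrightarrow> \<bar>res m w x\<bar> \<le> D" using res_bounded by blast
  show ?thesis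
    using assms C D by (intro mu.integrable_const_bound[of _ "C * D"]) (auto simp: abs_mult intro!: mult_mono)
qed

lemma res_centred: "x \<in> space M \<Longrightarrow> (LINT w|\<mu>. res n w x) = 0"
proof (induction n arbitrary: x)
  case 0
  then show ?case by (simp add: l_centred)
next
  case (Suc n)
  have "(LINT w|\<mu>. basis n w) = 0" unfolding basis_def by (simp add: Suc.IH[OF xs_in])
  moreover have "integrable \<mu> (basis n)"
    using res_integrable[OF xs_in] by (auto simp: basis_def[abs_def])
  ultimately show ?case
    unfolding res_Suc using Suc res_integrable by simp
qed

lemma basis_integrable: "integrable \<mu> (basis n)"
  using res_integrable[OF xs_in] by (auto simp: basis_def[abs_def])

lemma basis_centred: "(LINT w|\<mu>. basis n w) = 0"
  unfolding basis_def by (simp add: res_centred[OF xs_in])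

lemma basis_bounded: "\<exists>C\<ge>0. \<forall>w. \<bar>basis n w\<bar> \<le> C"
proof -
  obtain C where C: "0 \<le> C" "\<And>w x. x \<in> space M \<Longrightarrow> \<bar>res n w x\<bar> \<le> C" using res_bounded by blast
  have "pivot n \<ge> 0" by (simp add: pivot_def cov_def)
  then show ?thesis
    using C xs_in by (intro exI[of _ "C / pivot n"]) (auto simp: basis_def abs_divide intro!: divide_right_mono)
qed

lemma res_basis_integrable: "x \<in> space M \<Longrightarrow> integrable \<mu> (\<lambda>w. res n w x * basis m w)"
  using res_mult_integrable[OF _ xs_in, of x n m m] by (simp add: basis_def)

lemma basis_basis_integrable: "integrable \<mu> (\<lambda>w. basis n w * basis m w)"
  using res_mult_integrable[OF xs_in xs_in, of n n m m] by (simp add: basis_def)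

lemma pivot_square: "pivot n * pivot n = cov n (xs n) (xs n)"
  by (simp add: pivot_def cov_def)

lemma res_basis_self: "(LINT w|\<mu>. res n w x * basis n w) = coef n x"
  by (simp add: basis_def coef_def cov_def)

lemma basis_norm: "(LINT w|\<mu>. basis n w * basis n w) = (if pivot n = 0 then 0 else 1)"
proof -
  have "(LINT w|\<mu>. basis n w * basis n w) = cov n (xs n) (xs n) / (pivot n * pivot n)"
    by (simp add: basis_def cov_def)
  then show ?thesis by (simp add: pivot_square[symmetric])
qed

lemma coef_pivot_0: "pivot n = 0 \<Longrightarrow> coef n x = 0"
  by (simp add: coef_def)

text \<open>Step \<open>n\<close> removes the projection onto \<open>basis n\<close>, and
  \<open>basis n\<close> is a multiple of a residual already orthogonal to the earlier basis
  functions, so no earlier orthogonality is lost.\<close>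

lemma res_basis_orthogonal: "k < n \<Longrightarrow> x \<in> space M \<Longrightarrow> (LINT w|\<mu>. res n w x * basis k w) = 0"
proof (induction n arbitrary: x)
  case (Suc n)
  have "(LINT w|\<mu>. res (Suc n) w x * basis k w) =
      (LINT w|\<mu>. res n w x * basis k w - coef n x * (basis n w * basis k w))"
    unfolding res_Suc by (simp add: algebra_simps)
  also have "\<dots> = (LINT w|\<mu>. res n w x * basis k w) - coef n x * (LINT w|\<mu>. basis n w * basis k w)"
    using Suc.prems res_basis_integrable basis_basis_integrable by simp
  also have "\<dots> = 0"
  proof (cases "k = n")
    case True
    \<comment> \<open>At a zero pivot the squared norm of \<open>basis n\<close> is 0 instead of 1,
      but then \<open>coef n x\<close> is 0 too.\<close>
    then show ?thesis by (simp add: res_basis_self basis_norm coef_pivot_0)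
  next
    case False
    then have "k < n" using Suc.prems by simp
    have "(LINT w|\<mu>. basis n w * basis k w) = (LINT w|\<mu>. res n w (xs n) * basis k w) / pivot n"
      by (simp add: basis_def[of n])
    then show ?thesis using Suc.IH[OF \<open>k < n\<close>] xs_in Suc.prems by simp
  qed
  finally show ?case .
qed simp

lemma basis_orthogonal: "k \<noteq> n \<Longrightarrow> (LINT w|\<mu>. basis k w * basis n w) = 0"
proof (induction k n rule: linorder_wlog)
  case (le k n)
  then have "(LINT w|\<mu>. res n w (xs n) * basis k w) = 0" by (intro res_basis_orthogonal xs_in) simp
  then show ?case by (simp add: basis_def[of n] mult.commute)
next
  case (sym k n)
  then show ?case by (simp add: mult.commute)
qed

text \<open>Removing a projection subtracts a rank-one kernel; at a zero pivot the subtracted term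
  is 0.\<close>

lemma cov_Suc:
  assumes x: "x \<in> space M" and y: "y \<in> space M"
  shows "cov (Suc n) x y = cov n x y - coef n x * coef n y"
proof -
  note int = res_mult_integrable[OF x y, of n n] res_basis_integrable[OF x, of n n]
    res_basis_integrable[OF y, of n n] basis_basis_integrable[of n n]
  have "cov (Suc n) x y = (LINT w|\<mu>. res n w x * res n w y - coef n y * (res n w x * basis n w)
      - coef n x * (res n w y * basis n w) + coef n x * coef n y * (basis n w * basis n w))"
    unfolding cov_def res_Suc by (simp add: algebra_simps)
  also have "\<dots> = cov n x y - coef n y * coef n x - coef n x * coef n y
      + coef n x * coef n y * (if pivot n = 0 then 0 else 1)"
    using int by (simp add: cov_def[symmetric] res_basis_self basis_norm)
  also have "\<dots> = cov n x y - coef n x * coef n y" by (simp add: coef_pivot_0)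
  finally show ?thesis .
qed

section \<open>Decay of the residual kernel\<close>

lemma cov_sum:
  "x \<in> space M \<Longrightarrow> y \<in> space M \<Longrightarrow> cov 0 x y = (\<Sum>k<n. coef k x * coef k y) + cov n x y"
  by (induction n) (simp_all add: cov_Suc)

lemma l_expansion: "l w x = (\<Sum>k<n. basis k w * coef k x) + res n w x"
  by (induction n) (simp_all add: res_Suc)

lemma cov_nonneg: "0 \<le> cov n x x"
  by (simp add: cov_def)

lemma cov_antimono:
  assumes "x \<in> space M" "m \<le> n"
  shows "cov n x x \<le> cov m x x"
  using assms(2) by (induction n rule: dec_induct) (auto simp: cov_Suc[OF assms(1,1)] intro: order_trans[rotated])

text \<open>The left side is the squared L2 distance between the residuals at \<open>x\<close> and
  \<open>y\<close>. Each step subtracts the square of a difference of coefficients, so it never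
  exceeds its initial value.\<close>

lemma cov_diff_le:
  assumes x: "x \<in> space M" and y: "y \<in> space M"
  shows "cov n x x - 2 * cov n x y + cov n y y \<le> (LINT w|\<mu>. (l w x - l w y)\<^sup>2)"
proof (induction n)
  case 0
  have "(LINT w|\<mu>. (l w x - l w y)\<^sup>2) = (LINT w|\<mu>. l w x * l w x - 2 * (l w x * l w y) + l w y * l w y)"
    by (simp add: power2_diff algebra_simps power2_eq_square)
  also have "\<dots> = cov 0 x x - 2 * cov 0 x y + cov 0 y y"
    using res_mult_integrable[OF x x, of 0 0] res_mult_integrable[OF x y, of 0 0]
      res_mult_integrable[OF y y, of 0 0] by (simp add: cov_def)
  finally show ?case by simp
next
  case (Suc n)
  have "cov (Suc n) x x - 2 * cov (Suc n) x y + cov (Suc n) y y =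
      cov n x x - 2 * cov n x y + cov n y y - (coef n x - coef n y)\<^sup>2"
    by (simp add: cov_Suc x y power2_diff power2_eq_square algebra_simps)
  also have "\<dots> \<le> cov n x x - 2 * cov n x y + cov n y y" by simp
  finally show ?case using Suc by simp
qed

text \<open>The direction removed at step \<open>j\<close> is the residual at \<open>xs j\<close>
  itself, which thereby becomes null; antitonicity of the diagonal keeps it null, and a null
  residual makes the mixed terms vanish.\<close>

lemma cov_xs:
  assumes "j < n" and x: "x \<in> space M"
  shows "cov n x (xs j) = 0" "cov n (xs j) (xs j) = 0"
proof -
  have "coef j (xs j) = pivot j"
    by (simp add: coef_def pivot_square[symmetric])
  then have "cov (Suc j) (xs j) (xs j) = 0"
    using pivot_square[of j] by (simp add: cov_Suc xs_in)
  then show *: "cov n (xs j) (xs j) = 0"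
    using cov_antimono[OF xs_in, of "Suc j" n j] cov_nonneg[of n "xs j"] assms(1) by simp
  have "AE w in \<mu>. res n w (xs j) * res n w (xs j) = 0"
    using * res_mult_integrable[OF xs_in xs_in, of n j n j] unfolding cov_def
    by (subst (asm) integral_nonneg_eq_0_iff_AE) auto
  then show "cov n x (xs j) = 0"
    unfolding cov_def by (intro integral_eq_zero_AE) (auto elim!: eventually_mono)
qed

text \<open>Once \<open>xs j\<close> has been treated its residual is null, and the contraction
  bound leaves \<open>cov n x x\<close> at most the squared distance from \<open>l _ x\<close> to
  \<open>l _ (xs j)\<close>.\<close>

lemma cov_tendsto_0:
  assumes x: "x \<in> space M"
  shows "(\<lambda>n. cov n x x) \<longlonglongrightarrow> 0"
proof (rule LIMSEQ_I)
  fix e :: real assume "e > 0"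
  then obtain j where j: "(LINT w|\<mu>. (l w x - l w (xs j))\<^sup>2) < e" using xs_dense[OF x] by blast
  have "norm (cov n x x - 0) < e" if "n \<ge> Suc j" for n
    using cov_diff_le[OF x xs_in, of n j] cov_xs[of j n x] that x j cov_nonneg[of n x] by simp
  then show "\<exists>no. \<forall>n\<ge>no. norm (cov n x x - 0) < e" by blast
qed

text \<open>The mean squared norm of the residual in L2 of \<open>M\<close>; this one sequence
  bounds the truncation error of both the sample and the limit.\<close>

definition tail :: "nat \<Rightarrow> real" where
  "tail n = (LINT x|M. cov n x x)"

lemma cov_diag_bounded: "\<exists>C\<ge>0. \<forall>n. \<forall>x\<in>space M. cov n x x \<le> C"
proof -
  have "cov n x x \<le> L * L" if x: "x \<in> space M" for n x
  proof -
    have "cov n x x \<le> cov 0 x x" by (rule cov_antimono[OF x]) simp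
    also have "\<dots> \<le> (LINT w|\<mu>. L * L)"
      unfolding cov_def
    proof (rule integral_mono')
      show "res 0 w x * res 0 w x \<le> L * L" for w
        using l_bounded[OF x, of w] abs_le_square_iff[of "l w x" L] by (simp add: power2_eq_square)
    qed auto
    finally show ?thesis by (simp add: mu.prob_space)
  qed
  then show ?thesis by (intro exI[of _ "L * L"]) auto
qed

lemma cov_diag_integrable: "integrable M (\<lambda>x. cov n x x)"
proof -
  obtain C where "\<And>n x. x \<in> space M \<Longrightarrow> cov n x x \<le> C" using cov_diag_bounded by blast
  then show ?thesis using cov_nonneg by (intro M.integrable_const_bound[of _ C]) auto
qed

lemma tail_nonneg: "0 \<le> tail n"
  by (simp add: tail_def cov_nonneg)

lemma tail_tendsto_0: "tail \<longlonglongrightarrow> 0"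
proof -
  obtain C where C: "\<And>n x. x \<in> space M \<Longrightarrow> cov n x x \<le> C" using cov_diag_bounded by blast
  have "(\<lambda>n. LINT x|M. cov n x x) \<longlonglongrightarrow> (LINT x|M. 0)"
    by (rule integral_dominated_convergence[where w="\<lambda>_. C"])
      (use C cov_nonneg cov_tendsto_0 in \<open>auto intro!: AE_I2\<close>)
  then show ?thesis by (simp add: tail_def[abs_def])
qed

text \<open>Bessel's inequality: \<open>(coef n x)\<^sup>2\<close> is the drop of the diagonal
  \<open>cov n x x\<close> at step \<open>n\<close>.\<close>

lemma coef_bounded: "\<exists>C\<ge>0. \<forall>n. \<forall>x\<in>space M. \<bar>coef n x\<bar> \<le> C"
proof -
  obtain C where C: "C \<ge> 0" "\<And>n x. x \<in> space M \<Longrightarrow> cov n x x \<le> C" using cov_diag_bounded by blast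
  have "\<bar>coef n x\<bar> \<le> sqrt C" if x: "x \<in> space M" for n x
  proof -
    have "(coef n x)\<^sup>2 \<le> C"
      using cov_Suc[OF x x, of n] cov_nonneg[of "Suc n" x] C(2)[OF x, of n] by (simp add: power2_eq_square)
    then show ?thesis using real_sqrt_le_mono by fastforce
  qed
  then show ?thesis using C(1) by (intro exI[of _ "sqrt C"]) auto
qed

lemma coef_L2: "coef n \<in> L2_fun M"
proof -
  obtain C where "\<And>n x. x \<in> space M \<Longrightarrow> \<bar>coef n x\<bar> \<le> C" using coef_bounded by blast
  then show ?thesis by (intro L2_fun_bounded[OF M.finite_measure_axioms, of _ C]) auto
qed

end

section \<open>Square integrable random variables and Gaussian sequences\<close>

text \<open>Formulated for functions and not for classes, as it will be applied to the values of the
  process at single points and to inner products with it.\<close>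

definition L2_tendsto :: "'x measure \<Rightarrow> (nat \<Rightarrow> 'x \<Rightarrow> real) \<Rightarrow> ('x \<Rightarrow> real) \<Rightarrow> bool" where
  "L2_tendsto M F f \<longleftrightarrow> (\<forall>n. F n \<in> L2_fun M) \<and> f \<in> L2_fun M \<and>
     (\<lambda>n. LINT x|M. (f x - F n x)\<^sup>2) \<longlonglongrightarrow> 0"

lemma L2_tendsto_const: "f \<in> L2_fun M \<Longrightarrow> L2_tendsto M (\<lambda>_. f) f"
  by (simp add: L2_tendsto_def)

lemma L2_tendstoD:
  assumes "L2_tendsto M F f"
  shows "F n \<in> L2_fun M" "f \<in> L2_fun M" "(\<lambda>n. LINT x|M. (f x - F n x)\<^sup>2) \<longlonglongrightarrow> 0"
  using assms by (auto simp: L2_tendsto_def)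

lemma L2_tendstoI_bound:
  assumes "\<And>n. F n \<in> L2_fun M" "f \<in> L2_fun M" "\<And>n. (LINT x|M. (f x - F n x)\<^sup>2) \<le> b n" "b \<longlonglongrightarrow> 0"
  shows "L2_tendsto M F f"
  unfolding L2_tendsto_def
proof (intro conjI allI assms)
  show "(\<lambda>n. LINT x|M. (f x - F n x)\<^sup>2) \<longlonglongrightarrow> 0"
    by (rule tendsto_sandwich[OF _ _ tendsto_const assms(4)]) (auto intro!: always_eventually assms(3))
qed

text \<open>Write \<open>F n\<close> as \<open>f\<close> minus its error and likewise for
  \<open>G n\<close>; Cauchy-Schwarz bounds the three products that contain an error.\<close>

lemma L2_tendsto_inner:
  assumes "L2_tendsto M F f" "L2_tendsto M G g"
  shows "(\<lambda>n. LINT x|M. F n x * G n x) \<longlonglongrightarrow> (LINT x|M. f x * g x)"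
proof -
  note F = L2_tendstoD[OF assms(1)] and G = L2_tendstoD[OF assms(2)]
  note FD = L2_fun_diff[OF F(2) F(1)] and GD = L2_fun_diff[OF G(2) G(1)]
  let ?F = "\<lambda>n. sqrt (LINT x|M. (f x - F n x)\<^sup>2)" and ?G = "\<lambda>n. sqrt (LINT x|M. (g x - G n x)\<^sup>2)"
  let ?f = "sqrt (LINT x|M. (f x)\<^sup>2)" and ?g = "sqrt (LINT x|M. (g x)\<^sup>2)"
  have F0: "?F \<longlonglongrightarrow> 0" and G0: "?G \<longlonglongrightarrow> 0"
    using tendsto_real_sqrt[OF F(3)] tendsto_real_sqrt[OF G(3)] by simp_all
  have bound: "norm ((LINT x|M. F n x * G n x) - (LINT x|M. f x * g x)) \<le> ?F n * ?g + ?f * ?G n + ?F n * ?G n" for n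
  proof -
    have "(LINT x|M. F n x * G n x) = (LINT x|M. f x * g x - (f x - F n x) * g x - f x * (g x - G n x)
        + (f x - F n x) * (g x - G n x))"
      by (simp add: algebra_simps)
    also have "\<dots> = (LINT x|M. f x * g x) - (LINT x|M. (f x - F n x) * g x) - (LINT x|M. f x * (g x - G n x))
        + (LINT x|M. (f x - F n x) * (g x - G n x))"
      using L2_fun_integrable_mult[OF F(2) G(2)] L2_fun_integrable_mult[OF FD G(2)]
        L2_fun_integrable_mult[OF F(2) GD] L2_fun_integrable_mult[OF FD GD]
      by simp
    finally show ?thesis
      using L2_Cauchy_Schwarz[OF FD G(2), of n] L2_Cauchy_Schwarz[OF F(2) GD, of n]
        L2_Cauchy_Schwarz[OF FD GD, of n n] unfolding real_norm_def by linarith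
  qed
  have "(\<lambda>n. ?F n * ?g + ?f * ?G n + ?F n * ?G n) \<longlonglongrightarrow> 0 * ?g + ?f * 0 + 0 * 0"
    by (intro tendsto_intros F0 G0)
  then have lim: "(\<lambda>n. ?F n * ?g + ?f * ?G n + ?F n * ?G n) \<longlonglongrightarrow> 0"
    by (simp only: mult_zero_left mult_zero_right add_0_right)
  show ?thesis
    by (rule LIM_zero_cancel, rule Lim_null_comparison[OF always_eventually lim]) (rule allI, rule bound)
qed

lemma suminf_finiteD:
  fixes f :: "nat \<Rightarrow> ennreal"
  assumes "(\<Sum>m. f m) < top"
  shows "f m < top" "summable (\<lambda>m. enn2real (f m))"
proof -
  have top: "f m < top" for m
    using sum_le_suminf[of f "{m}"] assms by (auto intro: le_less_trans)
  then show "f m < top" .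
  have "(\<Sum>m. ennreal (enn2real (f m))) \<noteq> top" using assms top by simp
  then show "summable (\<lambda>m. enn2real (f m))" by (intro summable_suminf_not_top) auto
qed

section \<open>Mean square and almost sure limits of random variables\<close>

context prob_space begin

lemma L2_fun_one: "(\<lambda>_. 1) \<in> L2_fun M"
  by (simp add: L2_fun_def)

lemma L2_fun_integrable: "f \<in> L2_fun M \<Longrightarrow> integrable M f"
  using L2_fun_integrable_mult[OF _ L2_fun_one, of f] by simp

lemma L2_tendsto_expectation:
  assumes "L2_tendsto M F f"
  shows "(\<lambda>n. expectation (F n)) \<longlonglongrightarrow> expectation f"
  using L2_tendsto_inner[OF assms L2_tendsto_const[OF L2_fun_one]] by simp

lemma expectation_abs_le_L2:
  assumes "f \<in> L2_fun M"
  shows "expectation (\<lambda>x. \<bar>f x\<bar>) \<le> sqrt (expectation (\<lambda>x. (f x)\<^sup>2))"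
proof -
  have "(\<lambda>x. \<bar>f x\<bar>) \<in> L2_fun M" using assms by (auto simp: L2_fun_def)
  from L2_Cauchy_Schwarz[OF this L2_fun_one] show ?thesis by (simp add: prob_space)
qed

text \<open>Rests on |exp(i y) - 1| \<le> |y| and on the first absolute moment being at most the
  root of the second. It carries Gaussianity from finite sums to their mean square limits.\<close>

lemma L2_tendsto_char:
  assumes "L2_tendsto M F f"
  shows "(\<lambda>n. char (distr M borel (F n)) t) \<longlonglongrightarrow> char (distr M borel f) t"
proof -
  note F = L2_tendstoD[OF assms]
  note FD = L2_fun_diff[OF F(2) F(1)]
  note [measurable] = L2_fun_measurable[OF F(1)] L2_fun_measurable[OF F(2)]
  have int: "integrable M (\<lambda>x. iexp (t * g x))" if "g \<in> borel_measurable M" for g :: "'a \<Rightarrow> real"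
    using that by (intro integrable_const_bound[where B=1]) auto
  have bound: "norm (char (distr M borel (F n)) t - char (distr M borel f) t)
      \<le> \<bar>t\<bar> * sqrt (LINT x|M. (f x - F n x)\<^sup>2)" for n
  proof -
    have "char (distr M borel (F n)) t - char (distr M borel f) t
        = (CLINT x|M. iexp (t * F n x) - iexp (t * f x))"
      using Bochner_Integration.integral_diff[OF int int, of "F n" f] by (simp add: char_def integral_distr)
    also have "norm \<dots> \<le> (LINT x|M. norm (iexp (t * F n x) - iexp (t * f x)))"
      by (rule integral_norm_bound)
    also have "\<dots> \<le> (LINT x|M. \<bar>t\<bar> * \<bar>f x - F n x\<bar>)"
    proof (rule integral_mono)
      show "integrable M (\<lambda>x. norm (iexp (t * F n x) - iexp (t * f x)))" by (intro integrable_norm Bochner_Integration.integrable_diff int) auto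
      show "integrable M (\<lambda>x. \<bar>t\<bar> * \<bar>f x - F n x\<bar>)" using L2_fun_integrable[OF FD] by simp
      fix x
      have "iexp (t * F n x) - iexp (t * f x) = iexp (t * f x) * (iexp (t * (F n x - f x)) - 1)"
        by (simp add: algebra_simps mult_exp_exp)
      then have "norm (iexp (t * F n x) - iexp (t * f x)) = norm (iexp (t * (F n x - f x)) - 1)"
        by (simp add: norm_mult)
      also have "\<dots> \<le> \<bar>t * (F n x - f x)\<bar>"
        using iexp_approx1[of "t * (F n x - f x)" 0] by simp
      finally show "norm (iexp (t * F n x) - iexp (t * f x)) \<le> \<bar>t\<bar> * \<bar>f x - F n x\<bar>"
        by (simp add: abs_mult abs_minus_commute)
    qed
    also have "\<dots> \<le> \<bar>t\<bar> * sqrt (LINT x|M. (f x - F n x)\<^sup>2)"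
      using expectation_abs_le_L2[OF FD, of n] by (simp add: mult_left_mono)
    finally show ?thesis .
  qed
  have "(\<lambda>n. \<bar>t\<bar> * sqrt (LINT x|M. (f x - F n x)\<^sup>2)) \<longlonglongrightarrow> \<bar>t\<bar> * sqrt 0"
    by (intro tendsto_intros F(3))
  then have lim: "(\<lambda>n. \<bar>t\<bar> * sqrt (LINT x|M. (f x - F n x)\<^sup>2)) \<longlonglongrightarrow> 0"
    by (simp only: real_sqrt_zero mult_zero_right)
  show ?thesis
    by (rule LIM_zero_cancel, rule Lim_null_comparison[OF always_eventually lim]) (rule allI, rule bound)
qed

lemma indep_uncorrelated:
  fixes X :: "'i \<Rightarrow> 'a \<Rightarrow> real"
  assumes "indep_vars (\<lambda>_. borel) X I" "i \<in> I" "j \<in> I" "i \<noteq> j"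
    and "integrable M (X i)" "integrable M (X j)"
  shows "integrable M (\<lambda>\<omega>. X i \<omega> * X j \<omega>)"
    and "expectation (\<lambda>\<omega>. X i \<omega> * X j \<omega>) = expectation (X i) * expectation (X j)"
proof -
  have "indep_vars (\<lambda>_. borel) X {i, j}"
    using assms by (intro indep_vars_subset[OF assms(1)]) auto
  from indep_vars_integrable[OF _ this] indep_vars_lebesgue_integral[OF _ this]
  show "integrable M (\<lambda>\<omega>. X i \<omega> * X j \<omega>)"
    "expectation (\<lambda>\<omega>. X i \<omega> * X j \<omega>) = expectation (X i) * expectation (X j)"
    using assms(4-6) by auto
qed

text \<open>The diagonal second moments stay arbitrary, so that the same computation covers the
  normal coordinates, the terms of the sample and the basis functions, some of which may
  vanish.\<close>

lemma orthonormal_sum_product: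
  fixes X :: "'i \<Rightarrow> 'a \<Rightarrow> real"
  assumes "finite I" and int: "\<And>i j. i \<in> I \<Longrightarrow> j \<in> I \<Longrightarrow> integrable M (\<lambda>\<omega>. X i \<omega> * X j \<omega>)"
    and orth: "\<And>i j. i \<in> I \<Longrightarrow> j \<in> I \<Longrightarrow> i \<noteq> j \<Longrightarrow> expectation (\<lambda>\<omega>. X i \<omega> * X j \<omega>) = 0"
  shows "expectation (\<lambda>\<omega>. (\<Sum>i\<in>I. c i * X i \<omega>) * (\<Sum>i\<in>I. d i * X i \<omega>)) =
      (\<Sum>i\<in>I. c i * d i * expectation (\<lambda>\<omega>. X i \<omega> * X i \<omega>))"
proof -
  have "expectation (\<lambda>\<omega>. (\<Sum>i\<in>I. c i * X i \<omega>) * (\<Sum>i\<in>I. d i * X i \<omega>)) =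
      expectation (\<lambda>\<omega>. \<Sum>i\<in>I. \<Sum>j\<in>I. c i * d j * (X i \<omega> * X j \<omega>))"
    by (simp add: sum_product algebra_simps)
  also have "\<dots> = (\<Sum>i\<in>I. \<Sum>j\<in>I. c i * d j * expectation (\<lambda>\<omega>. X i \<omega> * X j \<omega>))"
    using int by (simp add: Bochner_Integration.integral_sum)
  also have "\<dots> = (\<Sum>i\<in>I. \<Sum>j\<in>I. if j = i then c i * d i * expectation (\<lambda>\<omega>. X i \<omega> * X i \<omega>) else 0)"
    using orth by (intro sum.cong) auto
  also have "\<dots> = (\<Sum>i\<in>I. c i * d i * expectation (\<lambda>\<omega>. X i \<omega> * X i \<omega>))"
    using \<open>finite I\<close> by simp
  finally show ?thesis .
qed

text \<open>Expectations with a finite sum force the sum itself to be finite almost surely; this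
  turns mean estimates along a fast subsequence into almost sure convergence.\<close>

lemma AE_suminf_finite:
  fixes f :: "nat \<Rightarrow> 'a \<Rightarrow> ennreal"
  assumes [measurable]: "\<And>m. f m \<in> borel_measurable M"
    and le: "\<And>m. (\<integral>\<^sup>+ \<omega>. f m \<omega> \<partial>M) \<le> ennreal (b m)" and b: "\<And>m. 0 \<le> b m" "summable b"
  shows "AE \<omega> in M. (\<Sum>m. f m \<omega>) < top"
proof -
  have "(\<integral>\<^sup>+ \<omega>. (\<Sum>m. f m \<omega>) \<partial>M) = (\<Sum>m. \<integral>\<^sup>+ \<omega>. f m \<omega> \<partial>M)"
    by (rule nn_integral_suminf) simp
  also have "\<dots> \<le> (\<Sum>m. ennreal (b m))" by (intro suminf_le le) auto
  also have "\<dots> = ennreal (\<Sum>m. b m)" by (rule suminf_ennreal2[OF b])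
  also have "\<dots> < \<infinity>" by simp
  finally have "AE \<omega> in M. (\<Sum>m. f m \<omega>) \<noteq> \<infinity>"
    by (intro nn_integral_noteq_infinite) auto
  then show ?thesis by (simp add: less_top)
qed

text \<open>Fatou's lemma for the squares. Square integrability of the limit is a conclusion,
  because only almost sure convergence is given.\<close>

lemma L2_fun_Fatou:
  assumes X: "\<And>m. X m \<in> L2_fun M" and Y: "Y \<in> borel_measurable M"
    and lim: "AE \<omega> in M. (\<lambda>m. X m \<omega>) \<longlonglongrightarrow> Y \<omega>"
    and le: "\<And>m. expectation (\<lambda>\<omega>. (X m \<omega>)\<^sup>2) \<le> b m" and b: "b \<longlonglongrightarrow> c"
  shows "Y \<in> L2_fun M" "expectation (\<lambda>\<omega>. (Y \<omega>)\<^sup>2) \<le> c"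
proof -
  note [measurable] = L2_fun_measurable[OF X] Y
  have b0: "0 \<le> b m" for m by (rule order_trans[OF _ le]) simp
  then have c: "0 \<le> c" using b by (simp add: LIMSEQ_le_const)
  have "(\<integral>\<^sup>+ \<omega>. ennreal ((Y \<omega>)\<^sup>2) \<partial>M) = (\<integral>\<^sup>+ \<omega>. liminf (\<lambda>m. ennreal ((X m \<omega>)\<^sup>2)) \<partial>M)"
  proof (rule nn_integral_cong_AE)
    show "AE \<omega> in M. ennreal ((Y \<omega>)\<^sup>2) = liminf (\<lambda>m. ennreal ((X m \<omega>)\<^sup>2))"
      using lim
    proof eventually_elim
      case (elim \<omega>)
      then have "(\<lambda>m. ennreal ((X m \<omega>)\<^sup>2)) \<longlonglongrightarrow> ennreal ((Y \<omega>)\<^sup>2)"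
        by (intro tendsto_ennrealI tendsto_intros)
      then show ?case by (rule lim_imp_Liminf[OF sequentially_bot, symmetric])
    qed
  qed
  also have "\<dots> \<le> liminf (\<lambda>m. \<integral>\<^sup>+ \<omega>. ennreal ((X m \<omega>)\<^sup>2) \<partial>M)"
    by (rule nn_integral_liminf) simp
  also have "\<dots> = liminf (\<lambda>m. ennreal (expectation (\<lambda>\<omega>. (X m \<omega>)\<^sup>2)))"
    by (simp add: nn_integral_eq_integral L2_fun_integrable_square[OF X])
  also have "\<dots> \<le> liminf (\<lambda>m. ennreal (b m))"
    by (intro Liminf_mono always_eventually allI ennreal_leI le)
  also have "\<dots> = ennreal c"
    by (intro lim_imp_Liminf tendsto_ennrealI b) simp
  finally have *: "(\<integral>\<^sup>+ \<omega>. ennreal ((Y \<omega>)\<^sup>2) \<partial>M) \<le> ennreal c" .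
  also have "\<dots> < \<infinity>" by simp
  finally have "integrable M (\<lambda>\<omega>. (Y \<omega>)\<^sup>2)" by (intro integrableI_nonneg) auto
  then show "Y \<in> L2_fun M" by (intro L2_funI Y)
  show "expectation (\<lambda>\<omega>. (Y \<omega>)\<^sup>2) \<le> c"
    using * c \<open>integrable M (\<lambda>\<omega>. (Y \<omega>)\<^sup>2)\<close> by (simp add: nn_integral_eq_integral)
qed

end

section \<open>Independent standard normal coordinates\<close>

definition gauss_seq :: "(nat \<Rightarrow> real) measure" where
  "gauss_seq = PiM UNIV (\<lambda>_. std_normal_distribution)"

interpretation std_normal: prob_space std_normal_distribution
  using real_dist_normal_dist by (simp add: real_distribution_def)

interpretation gauss_seq: product_prob_space "\<lambda>_::nat. std_normal_distribution" UNIV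
  rewrites "PiM UNIV (\<lambda>_::nat. std_normal_distribution) = gauss_seq"
  by unfold_locales (simp add: gauss_seq_def)

text \<open>The product sigma-algebra on sequences is the Borel algebra of the product topology, so
  continuous functions of the whole sequence are measurable.\<close>

lemma sets_gauss_seq [measurable_cong]: "sets gauss_seq = sets borel"
proof -
  have "sets gauss_seq = sets (PiM UNIV (\<lambda>_::nat. borel :: real measure))"
    unfolding gauss_seq_def by (intro sets_PiM_cong) auto
  then show ?thesis by (simp add: sets_PiM_equal_borel)
qed

lemma space_gauss_seq: "space gauss_seq = UNIV"
  using sets_eq_imp_space_eq[OF sets_gauss_seq] by simp

lemma coordinate_measurable [measurable]: "(\<lambda>\<omega>. \<omega> k) \<in> borel_measurable gauss_seq"
  using borel_measurable_coordinate by (simp cong: measurable_cong_sets add: measurable_cong_sets[OF sets_gauss_seq refl])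

lemma distr_gauss_seq: "distr gauss_seq borel (\<lambda>\<omega>. \<omega> k) = std_normal_distribution"
proof (rule measure_eqI)
  fix A assume "A \<in> sets (distr gauss_seq borel (\<lambda>\<omega>. \<omega> k))"
  then have A: "A \<in> sets borel" by simp
  have "emeasure (distr gauss_seq borel (\<lambda>\<omega>. \<omega> k)) A = emeasure gauss_seq {\<omega> \<in> space gauss_seq. \<omega> k \<in> A}"
    using A by (simp add: emeasure_distr vimage_def Int_def conj_commute)
  also have "\<dots> = emeasure std_normal_distribution A"
    using A by (intro gauss_seq.emeasure_PiM_Collect_single) auto
  finally show "emeasure (distr gauss_seq borel (\<lambda>\<omega>. \<omega> k)) A = emeasure std_normal_distribution A" .
qed simp

lemma indep_gauss_seq: "gauss_seq.indep_vars (\<lambda>_. borel) (\<lambda>k \<omega>. \<omega> k) UNIV"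
proof (subst gauss_seq.indep_vars_iff_distr_eq_PiM)
  have "distr gauss_seq (PiM UNIV (\<lambda>_::nat. borel :: real measure)) (\<lambda>\<omega>. \<omega>) = gauss_seq"
    by (rule distr_id2) (simp add: sets_gauss_seq sets_PiM_equal_borel)
  then show "distr gauss_seq (PiM UNIV (\<lambda>_. borel)) (\<lambda>\<omega>. \<lambda>k\<in>UNIV. \<omega> k) =
      PiM UNIV (\<lambda>k. distr gauss_seq borel (\<lambda>\<omega>. \<omega> k))"
    by (simp add: distr_gauss_seq restrict_UNIV) (simp add: gauss_seq_def)
qed (auto simp: coordinate_measurable)

lemma gauss_seq_moment: "integrable gauss_seq (\<lambda>\<omega>. (\<omega> k) ^ n)"
  "(LINT \<omega>|gauss_seq. (\<omega> k) ^ n) = (LINT x|std_normal_distribution. x ^ n)"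
proof -
  have "integrable (distr gauss_seq borel (\<lambda>\<omega>. \<omega> k)) (\<lambda>x. x ^ n)"
    unfolding distr_gauss_seq by (rule integrable_std_normal_distribution_moment)
  then show "integrable gauss_seq (\<lambda>\<omega>. (\<omega> k) ^ n)" by (simp add: integrable_distr_eq)
  show "(LINT \<omega>|gauss_seq. (\<omega> k) ^ n) = (LINT x|std_normal_distribution. x ^ n)"
    unfolding distr_gauss_seq[of k, symmetric] by (simp add: integral_distr)
qed

lemma gauss_seq_coordinate:
  "integrable gauss_seq (\<lambda>\<omega>. \<omega> k)" "(LINT \<omega>|gauss_seq. \<omega> k) = 0"
  "integrable gauss_seq (\<lambda>\<omega>. (\<omega> k)\<^sup>2)" "(LINT \<omega>|gauss_seq. (\<omega> k)\<^sup>2) = 1"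
  using gauss_seq_moment[of k 1] gauss_seq_moment[of k 2] integral_std_normal_distribution_moment_odd[of 1]
    std_normal_distribution_even_moments(1)[of 1] by simp_all

lemma gauss_seq_mult_integrable: "integrable gauss_seq (\<lambda>\<omega>. \<omega> i * \<omega> j)"
proof -
  have "(\<lambda>\<omega>. \<omega> k) \<in> L2_fun gauss_seq" for k
    by (intro L2_funI coordinate_measurable gauss_seq_coordinate)
  then show ?thesis by (intro L2_fun_integrable_mult)
qed

lemma gauss_seq_inner:
  assumes "finite I"
  shows "(LINT \<omega>|gauss_seq. (\<Sum>i\<in>I. c i * \<omega> i) * (\<Sum>i\<in>I. d i * \<omega> i)) = (\<Sum>i\<in>I. c i * d i)"
proof -
  have "(LINT \<omega>|gauss_seq. \<omega> i * \<omega> j) = 0" if "i \<noteq> j" for i j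
    using gauss_seq.indep_uncorrelated(2)[OF indep_gauss_seq UNIV_I UNIV_I that] gauss_seq_coordinate by simp
  then show ?thesis
    using gauss_seq_coordinate(4)
    by (subst gauss_seq.orthonormal_sum_product[OF assms gauss_seq_mult_integrable]) (auto simp: power2_eq_square)
qed

lemma gauss_seq_sum_L2: "(\<lambda>\<omega>. \<Sum>i\<in>I. c i * \<omega> i) \<in> L2_fun gauss_seq"
  by (intro L2_fun_sum L2_fun_scale L2_funI coordinate_measurable gauss_seq_coordinate)

lemma gauss_seq_sum_centred: "(LINT \<omega>|gauss_seq. (\<Sum>i\<in>I. c i * \<omega> i)) = 0"
  using gauss_seq_coordinate by (simp add: Bochner_Integration.integral_sum)

lemma gauss_seq_char:
  assumes "finite I"
  shows "char (distr gauss_seq borel (\<lambda>\<omega>. \<Sum>i\<in>I. c i * \<omega> i)) t = exp (- (t\<^sup>2 * (\<Sum>i\<in>I. (c i)\<^sup>2)) / 2)"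
proof -
  have 1: "char (distr gauss_seq borel (\<lambda>\<omega>. c i * \<omega> i)) t = exp (- ((t * c i)\<^sup>2) / 2)" for i
  proof -
    have "char (distr gauss_seq borel (\<lambda>\<omega>. c i * \<omega> i)) t = char (distr gauss_seq borel (\<lambda>\<omega>. \<omega> i)) (t * c i)"
      by (simp add: char_def integral_distr mult.assoc)
    then show ?thesis by (simp add: distr_gauss_seq char_std_normal_distribution)
  qed
  have "gauss_seq.indep_vars (\<lambda>_. borel) (\<lambda>i \<omega>. c i * \<omega> i) I"
    using gauss_seq.indep_vars_compose2[OF gauss_seq.indep_vars_subset[OF indep_gauss_seq subset_UNIV], of I "\<lambda>i x. c i * x"]
    by simp
  then have "char (distr gauss_seq borel (\<lambda>\<omega>. \<Sum>i\<in>I. c i * \<omega> i)) t = (\<Prod>i\<in>I. exp (- ((t * c i)\<^sup>2) / 2))"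
    by (simp add: gauss_seq.char_distr_sum 1)
  also have "\<dots> = exp (\<Sum>i\<in>I. - ((t * c i)\<^sup>2) / 2)" using assms by (simp add: exp_sum)
  also have "(\<Sum>i\<in>I. - ((t * c i)\<^sup>2) / 2) = - (t\<^sup>2 * (\<Sum>i\<in>I. (c i)\<^sup>2)) / 2"
    by (simp add: sum_negf sum_divide_distrib sum_distrib_left power_mult_distrib)
  finally show ?thesis .
qed

text \<open>A positive \<open>\<sigma>\<close> gives the image of the standard normal law under
  scaling, and \<open>\<sigma> = 0\<close> the point mass; one formula covers both, so degenerate
  functionals of the limit fit in.\<close>

lemma char_normal_law:
  assumes "0 \<le> \<sigma>"
  shows "char (normal_law 0 \<sigma>) t = exp (- (t\<^sup>2 * \<sigma>\<^sup>2) / 2)"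
proof (cases "\<sigma> = 0")
  case True
  then show ?thesis by (simp add: normal_law_def char_def integral_return)
next
  case False
  then have \<sigma>: "\<sigma> > 0" using assms by simp
  have "distributed std_normal_distribution lborel (\<lambda>x. x) std_normal_density"
    by (auto simp: distributed_def intro!: distr_id2)
  then have "distributed std_normal_distribution lborel (\<lambda>x. 0 + \<sigma> * x) (normal_density (0 + \<sigma> * 0) (\<bar>\<sigma>\<bar> * 1))"
    using \<sigma> by (intro std_normal.normal_density_affine) auto
  then have "distr std_normal_distribution lborel (\<lambda>x. \<sigma> * x) = density lborel (normal_density 0 \<sigma>)"
    using \<sigma> by (auto simp: distributed_def)
  moreover have "distr std_normal_distribution lborel (\<lambda>x. \<sigma> * x) = distr std_normal_distribution borel (\<lambda>x. \<sigma> * x)"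
    by (rule distr_cong) auto
  ultimately have "normal_law 0 \<sigma> = distr std_normal_distribution borel (\<lambda>x. \<sigma> * x)"
    using False by (simp add: normal_law_def)
  then have "char (normal_law 0 \<sigma>) t = char std_normal_distribution (t * \<sigma>)"
    by (simp add: char_def integral_distr mult.assoc)
  then show ?thesis by (simp add: char_std_normal_distribution power_mult_distrib)
qed

lemma real_distribution_normal_law:
  assumes "0 \<le> \<sigma>"
  shows "real_distribution (normal_law \<mu> \<sigma>)"
proof (cases "\<sigma> = 0")
  case True
  then show ?thesis
    by (auto simp: normal_law_def real_distribution_def real_distribution_axioms_def intro: prob_space_return)
next
  case False
  then show ?thesis
    using assms prob_space_normal_density[of \<sigma> \<mu>]
    by (auto simp: normal_law_def real_distribution_def real_distribution_axioms_def)
qed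

section \<open>The limit process\<close>

context kernel_process begin

definition psum :: "nat \<Rightarrow> (nat \<Rightarrow> real) \<Rightarrow> 'x \<Rightarrow> real" where
  "psum n \<omega> x = (\<Sum>k<n. \<omega> k * coef k x)"

lemma psum_measurable [measurable]: "(\<lambda>(\<omega>, x). psum n \<omega> x) \<in> borel_measurable (gauss_seq \<Otimes>\<^sub>M M)"
  unfolding psum_def by measurable

lemma psum_L2: "psum n \<omega> \<in> L2_fun M"
  unfolding psum_def by (intro L2_fun_sum L2_fun_scale coef_L2)

lemma psum_L2_gauss: "(\<lambda>\<omega>. psum n \<omega> x) \<in> L2_fun gauss_seq"
  using gauss_seq_sum_L2[of "\<lambda>k. coef k x" "{..<n}"] by (simp add: psum_def mult.commute)

lemma psum_inner:
  assumes "x \<in> space M" "y \<in> space M"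
  shows "(LINT \<omega>|gauss_seq. psum n \<omega> x * psum n \<omega> y) = cov 0 x y - cov n x y"
  using gauss_seq_inner[of "{..<n}" "\<lambda>k. coef k x" "\<lambda>k. coef k y"] cov_sum[OF assms, of n]
  by (simp add: psum_def mult.commute)

text \<open>By orthonormality the left side is the sum of squared coefficients between
  \<open>p\<close> and \<open>q\<close>, which telescopes into a difference of residual
  kernels.\<close>

lemma psum_diff_square:
  assumes x: "x \<in> space M" and "p \<le> q"
  shows "(LINT \<omega>|gauss_seq. (psum q \<omega> x - psum p \<omega> x)\<^sup>2) = cov p x x - cov q x x"
proof -
  have *: "{..<q} = {..<p} \<union> {p..<q}" using \<open>p \<le> q\<close> by auto
  have "psum q \<omega> x - psum p \<omega> x = (\<Sum>k\<in>{p..<q}. coef k x * \<omega> k)" for \<omega>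
    unfolding psum_def * by (subst sum.union_disjoint) (auto simp: mult.commute)
  then have "(LINT \<omega>|gauss_seq. (psum q \<omega> x - psum p \<omega> x)\<^sup>2) = (\<Sum>k\<in>{p..<q}. coef k x * coef k x)"
    using gauss_seq_inner[of "{p..<q}" "\<lambda>k. coef k x" "\<lambda>k. coef k x"] by (simp add: power2_eq_square)
  moreover have "(\<Sum>k<q. coef k x * coef k x) = (\<Sum>k<p. coef k x * coef k x) + (\<Sum>k\<in>{p..<q}. coef k x * coef k x)"
    unfolding * by (rule sum.union_disjoint) auto
  ultimately show ?thesis using cov_sum[OF x x, of p] cov_sum[OF x x, of q] by simp
qed

lemma psum_diff_square_abs:
  assumes x: "x \<in> space M"
  shows "(LINT \<omega>|gauss_seq. (psum q \<omega> x - psum p \<omega> x)\<^sup>2) = \<bar>cov p x x - cov q x x\<bar>"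
proof (cases "p \<le> q")
  case True
  then show ?thesis using psum_diff_square[OF x True] cov_antimono[OF x True] by simp
next
  case False
  then have "q \<le> p" by simp
  then show ?thesis using psum_diff_square[OF x \<open>q \<le> p\<close>] cov_antimono[OF x \<open>q \<le> p\<close>]
    by (simp add: power2_commute)
qed

text \<open>The limit process has to exist at every point \<open>x\<close>, not just almost everywhere. Truncating the
  series at a level that depends measurably on \<open>x\<close> makes the truncations converge almost surely
  for each fixed \<open>x\<close>.\<close>

definition depth :: "nat \<Rightarrow> 'x \<Rightarrow> nat" where
  "depth m x = (LEAST n. cov n x x \<le> (1/4) ^ m)"

lemma depth_measurable [measurable]: "depth m \<in> measurable M (count_space UNIV)"
  unfolding depth_def by measurable

lemma depth_le:
  assumes "x \<in> space M"
  shows "cov (depth m x) x x \<le> (1/4) ^ m"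
proof -
  have "\<forall>\<^sub>F n in sequentially. cov n x x < (1/4) ^ m"
    by (rule order_tendstoD(2)[OF cov_tendsto_0[OF assms]]) simp
  then obtain n where "cov n x x \<le> (1/4) ^ m"
    using eventually_happens'[OF sequentially_bot] less_imp_le by blast
  then show ?thesis unfolding depth_def by (rule LeastI)
qed

lemma depth_mono:
  assumes "x \<in> space M"
  shows "depth m x \<le> depth (Suc m) x"
proof -
  have "cov (depth (Suc m) x) x x \<le> (1/4) ^ m"
    using depth_le[OF assms, of "Suc m"] zero_le_power[of "1/4::real" m] by (simp del: zero_le_power)
  then show ?thesis unfolding depth_def[of m] by (rule Least_le)
qed

text \<open>Off the set of convergence \<open>lim\<close> yields an unspecified constant, which does
  not disturb measurability; for each \<open>x\<close> in the space of \<open>M\<close> the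
  exceptional set is null.\<close>

definition vlim :: "(nat \<Rightarrow> real) \<Rightarrow> 'x \<Rightarrow> real" where
  "vlim \<omega> x = lim (\<lambda>m. psum (depth m x) \<omega> x)"

lemma psum_depth_measurable [measurable]:
  "(\<lambda>(\<omega>, x). psum (depth m x) \<omega> x) \<in> borel_measurable (gauss_seq \<Otimes>\<^sub>M M)"
proof -
  have "(\<lambda>z. psum (depth m (snd z)) (fst z) (snd z)) \<in> borel_measurable (gauss_seq \<Otimes>\<^sub>M M)"
    by (rule measurable_compose_countable[where f="\<lambda>n z. psum n (fst z) (snd z)"]) measurable
  then show ?thesis by (simp add: case_prod_beta')
qed

lemma vlim_measurable [measurable]: "(\<lambda>(\<omega>, x). vlim \<omega> x) \<in> borel_measurable (gauss_seq \<Otimes>\<^sub>M M)"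
proof -
  have "(\<lambda>z. lim (\<lambda>m. psum (depth m (snd z)) (fst z) (snd z))) \<in> borel_measurable (gauss_seq \<Otimes>\<^sub>M M)"
    using psum_depth_measurable by (intro borel_measurable_lim_metric) (simp add: case_prod_beta')
  then show ?thesis by (simp add: vlim_def case_prod_beta')
qed

lemma vlim_measurable_fst [measurable]: "x \<in> space M \<Longrightarrow> (\<lambda>\<omega>. vlim \<omega> x) \<in> borel_measurable gauss_seq"
  by measurable

lemma vlim_measurable_snd [measurable]: "vlim \<omega> \<in> borel_measurable M"
  using measurable_compose[OF measurable_Pair1' vlim_measurable, of \<omega>] by (simp add: space_gauss_seq)

text \<open>The threshold \<open>(1/4) ^ m\<close> makes increment \<open>m\<close> at most
  \<open>(1/2) ^ m\<close> in the first absolute mean. These bounds are summable, so the telescoping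
  series converges absolutely almost surely.\<close>

lemma vlim_AE:
  assumes x: "x \<in> space M"
  shows "AE \<omega> in gauss_seq. (\<lambda>m. psum (depth m x) \<omega> x) \<longlonglongrightarrow> vlim \<omega> x"
proof -
  define D where "D m \<omega> = psum (depth (Suc m) x) \<omega> x - psum (depth m x) \<omega> x" for m \<omega>
  have DL2: "D m \<in> L2_fun gauss_seq" for m
    unfolding D_def by (intro L2_fun_diff psum_L2_gauss)
  note [measurable] = L2_fun_measurable[OF DL2]
  have "AE \<omega> in gauss_seq. (\<Sum>m. ennreal \<bar>D m \<omega>\<bar>) < top"
  proof (rule gauss_seq.AE_suminf_finite[where b="\<lambda>m. (1/2) ^ m"])
    show "(\<integral>\<^sup>+ \<omega>. ennreal \<bar>D m \<omega>\<bar> \<partial>gauss_seq) \<le> ennreal ((1/2) ^ m)" for m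
    proof -
      have "(LINT \<omega>|gauss_seq. (D m \<omega>)\<^sup>2) \<le> (1/4) ^ m"
        unfolding D_def using psum_diff_square[OF x depth_mono[OF x, of m]] depth_le[OF x, of m]
          cov_nonneg[of "depth (Suc m) x" x] by linarith
      then have "sqrt (LINT \<omega>|gauss_seq. (D m \<omega>)\<^sup>2) \<le> sqrt ((1/4) ^ m)"
        by (rule real_sqrt_le_mono)
      also have "sqrt ((1/4) ^ m) = (1/2) ^ m" by (simp add: real_sqrt_power real_sqrt_divide)
      finally have "(LINT \<omega>|gauss_seq. \<bar>D m \<omega>\<bar>) \<le> (1/2) ^ m"
        using gauss_seq.expectation_abs_le_L2[OF DL2, of m] by linarith
      moreover have "(\<integral>\<^sup>+ \<omega>. ennreal \<bar>D m \<omega>\<bar> \<partial>gauss_seq) = ennreal (LINT \<omega>|gauss_seq. \<bar>D m \<omega>\<bar>)"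
        using gauss_seq.L2_fun_integrable[OF DL2] by (intro nn_integral_eq_integral) auto
      ultimately show ?thesis by (simp add: ennreal_leI)
    qed
  qed (auto intro: summable_geometric)
  then show ?thesis
  proof eventually_elim
    case (elim \<omega>)
    then have "summable (\<lambda>m. enn2real (ennreal \<bar>D m \<omega>\<bar>))" by (rule suminf_finiteD)
    then have "summable (\<lambda>m. D m \<omega>)" by (simp add: summable_rabs_cancel)
    then have "convergent (\<lambda>m. \<Sum>i<m. D i \<omega>)" by (simp add: summable_iff_convergent)
    then have "convergent (\<lambda>m. psum (depth 0 x) \<omega> x + (\<Sum>i<m. D i \<omega>))"
      by (simp add: convergent_add_const_iff)
    also have "(\<lambda>m. psum (depth 0 x) \<omega> x + (\<Sum>i<m. D i \<omega>)) = (\<lambda>m. psum (depth m x) \<omega> x)"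
      unfolding D_def using sum_lessThan_telescope[of "\<lambda>i. psum (depth i x) \<omega> x"] by simp
    finally show ?case unfolding vlim_def by (simp add: convergent_LIMSEQ_iff)
  qed
qed

text \<open>Fatou along the truncations: whichever of the two levels is larger, the mean squared
  distance of the partial sums is at most \<open>cov n x x + (1/4) ^ m\<close>, and the last term
  tends to 0.\<close>

lemma vlim_error:
  assumes x: "x \<in> space M"
  shows "(\<lambda>\<omega>. vlim \<omega> x - psum n \<omega> x) \<in> L2_fun gauss_seq"
    and "(LINT \<omega>|gauss_seq. (vlim \<omega> x - psum n \<omega> x)\<^sup>2) \<le> cov n x x"
proof -
  have 1: "(\<lambda>\<omega>. psum (depth m x) \<omega> x - psum n \<omega> x) \<in> L2_fun gauss_seq" for m
    by (intro L2_fun_diff psum_L2_gauss)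
  have 2: "(\<lambda>\<omega>. vlim \<omega> x - psum n \<omega> x) \<in> borel_measurable gauss_seq"
    using x psum_L2_gauss[THEN L2_fun_measurable] by measurable
  have 3: "AE \<omega> in gauss_seq. (\<lambda>m. psum (depth m x) \<omega> x - psum n \<omega> x) \<longlonglongrightarrow> vlim \<omega> x - psum n \<omega> x"
    using vlim_AE[OF x] by eventually_elim (intro tendsto_intros)
  have 4: "(LINT \<omega>|gauss_seq. (psum (depth m x) \<omega> x - psum n \<omega> x)\<^sup>2) \<le> cov n x x + (1/4) ^ m" for m
    unfolding psum_diff_square_abs[OF x] using depth_le[OF x, of m] cov_nonneg[of n x] cov_nonneg[of "depth m x" x]
    by linarith
  have "(\<lambda>m. cov n x x + (1/4::real) ^ m) \<longlonglongrightarrow> cov n x x + 0"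
    by (intro tendsto_intros LIMSEQ_power_zero) simp
  then have 5: "(\<lambda>m. cov n x x + (1/4::real) ^ m) \<longlonglongrightarrow> cov n x x" by simp
  show "(\<lambda>\<omega>. vlim \<omega> x - psum n \<omega> x) \<in> L2_fun gauss_seq"
    by (rule gauss_seq.L2_fun_Fatou(1)[OF 1 2 3 4 5])
  show "(LINT \<omega>|gauss_seq. (vlim \<omega> x - psum n \<omega> x)\<^sup>2) \<le> cov n x x"
    by (rule gauss_seq.L2_fun_Fatou(2)[OF 1 2 3 4 5])
qed

text \<open>Taken in \<open>ennreal\<close>, because the paths of \<open>vlim\<close> are not yet
  known to be square integrable.\<close>

definition err :: "nat \<Rightarrow> (nat \<Rightarrow> real) \<Rightarrow> ennreal" where
  "err n \<omega> = (\<integral>\<^sup>+ x. ennreal ((vlim \<omega> x - psum n \<omega> x)\<^sup>2) \<partial>M)"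

lemma err_measurable [measurable]: "err n \<in> borel_measurable gauss_seq"
  unfolding err_def by measurable

lemma err_le: "(\<integral>\<^sup>+ \<omega>. err n \<omega> \<partial>gauss_seq) \<le> ennreal (tail n)"
proof -
  interpret pair_sigma_finite gauss_seq M ..
  have "(\<integral>\<^sup>+ \<omega>. err n \<omega> \<partial>gauss_seq) = (\<integral>\<^sup>+ x. \<integral>\<^sup>+ \<omega>. ennreal ((vlim \<omega> x - psum n \<omega> x)\<^sup>2) \<partial>gauss_seq \<partial>M)"
    unfolding err_def by (rule Fubini'[symmetric]) measurable
  also have "\<dots> \<le> (\<integral>\<^sup>+ x. ennreal (cov n x x) \<partial>M)"
  proof (rule nn_integral_mono)
    fix x assume x: "x \<in> space M"
    show "(\<integral>\<^sup>+ \<omega>. ennreal ((vlim \<omega> x - psum n \<omega> x)\<^sup>2) \<partial>gauss_seq) \<le> ennreal (cov n x x)"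
      using vlim_error[OF x, of n]
      by (subst nn_integral_eq_integral) (auto intro: L2_fun_integrable_square ennreal_leI)
  qed
  also have "\<dots> = ennreal (tail n)"
    unfolding tail_def using cov_nonneg by (intro nn_integral_eq_integral cov_diag_integrable) auto
  finally show ?thesis .
qed

text \<open>A subsequence with summable mean errors; unlike \<open>depth\<close> it does not depend
  on \<open>x\<close>, since it has to control whole paths.\<close>

definition level :: "nat \<Rightarrow> nat" where
  "level m = (LEAST n. tail n \<le> (1/2) ^ m)"

lemma level_le: "tail (level m) \<le> (1/2) ^ m"
proof -
  have "\<forall>\<^sub>F n in sequentially. tail n < (1/2) ^ m"
    by (rule order_tendstoD(2)[OF tail_tendsto_0]) simp
  then obtain n where "tail n \<le> (1/2) ^ m"
    using eventually_happens'[OF sequentially_bot] less_imp_le by blast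
  then show ?thesis unfolding level_def by (rule LeastI)
qed

definition good :: "(nat \<Rightarrow> real) set" where
  "good = {\<omega> \<in> space gauss_seq. (\<Sum>m. err (level m) \<omega>) < top}"

lemma good_sets [measurable]: "good \<in> sets gauss_seq"
  unfolding good_def by measurable

lemma AE_good: "AE \<omega> in gauss_seq. \<omega> \<in> good"
proof -
  have "AE \<omega> in gauss_seq. (\<Sum>m. err (level m) \<omega>) < top"
    by (rule gauss_seq.AE_suminf_finite[where b="\<lambda>m. (1/2) ^ m"])
      (auto intro: summable_geometric order_trans[OF err_le] ennreal_leI level_le)
  then show ?thesis by (simp add: good_def)
qed

text \<open>Setting the path to 0 off \<open>good\<close> makes every path square integrable, and it
  alters the values at all points \<open>x\<close> on one common null set.\<close>

definition V :: "(nat \<Rightarrow> real) \<Rightarrow> 'x \<Rightarrow> real" where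
  "V \<omega> x = (if \<omega> \<in> good then vlim \<omega> x else 0)"

lemma V_measurable [measurable]: "(\<lambda>(\<omega>, x). V \<omega> x) \<in> borel_measurable (gauss_seq \<Otimes>\<^sub>M M)"
  unfolding V_def by measurable

lemma V_measurable_fst [measurable]: "x \<in> space M \<Longrightarrow> (\<lambda>\<omega>. V \<omega> x) \<in> borel_measurable gauss_seq"
  by measurable

lemma AE_V: "AE \<omega> in gauss_seq. \<forall>x. V \<omega> x = vlim \<omega> x"
  using AE_good by eventually_elim (simp add: V_def)

lemma good_error:
  assumes "\<omega> \<in> good"
  shows "(\<lambda>x. vlim \<omega> x - psum (level m) \<omega> x) \<in> L2_fun M"
    and "(\<lambda>m. LINT x|M. (vlim \<omega> x - psum (level m) \<omega> x)\<^sup>2) \<longlonglongrightarrow> 0"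
proof -
  have fin: "(\<Sum>m. err (level m) \<omega>) < top" using assms by (simp add: good_def)
  have meas: "(\<lambda>x. vlim \<omega> x - psum n \<omega> x) \<in> borel_measurable M" for n
    using L2_fun_measurable[OF psum_L2] by measurable
  have L2: "(\<lambda>x. vlim \<omega> x - psum (level m) \<omega> x) \<in> L2_fun M" for m
    using suminf_finiteD(1)[OF fin, of m] meas[of "level m"]
    by (intro L2_funI integrableI_nonneg) (auto simp: err_def)
  then show "(\<lambda>x. vlim \<omega> x - psum (level m) \<omega> x) \<in> L2_fun M" .
  have "enn2real (err (level m) \<omega>) = (LINT x|M. (vlim \<omega> x - psum (level m) \<omega> x)\<^sup>2)" for m
    unfolding err_def by (subst nn_integral_eq_integral[OF L2_fun_integrable_square[OF L2]]) auto
  then show "(\<lambda>m. LINT x|M. (vlim \<omega> x - psum (level m) \<omega> x)\<^sup>2) \<longlonglongrightarrow> 0"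
    using summable_LIMSEQ_zero[OF suminf_finiteD(2)[OF fin]] by simp
qed

lemma V_L2: "V \<omega> \<in> L2_fun M"
proof (cases "\<omega> \<in> good")
  case True
  then show ?thesis
    using L2_fun_add[OF good_error(1)[OF True, of 0] psum_L2[of "level 0" \<omega>]] by (simp add: V_def[abs_def])
next
  case False
  then show ?thesis by (simp add: V_def[abs_def] L2_fun_zero)
qed

text \<open>The squared distance is a quadratic form in the coordinate differences with the Gram
  matrix of the \<open>coef k\<close>, so coordinatewise convergence suffices.\<close>

lemma psum_continuous_map: "continuous_map euclidean (L2_topology M) (\<lambda>y. L2_class M (psum n y))"
proof (rule continuous_map_L2_class[OF psum_L2])
  fix X :: "nat \<Rightarrow> nat \<Rightarrow> real" and b assume X: "X \<longlonglongrightarrow> b"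
  have Xk: "(\<lambda>i. X i k) \<longlonglongrightarrow> b k" for k
    using continuous_on_tendsto_compose[OF continuous_on_product_coordinates[of k] X] by simp
  have eq: "(LINT x|M. (psum n (X i) x - psum n b x)\<^sup>2) =
      (\<Sum>k<n. \<Sum>j<n. (X i k - b k) * (X i j - b j) * (LINT x|M. coef k x * coef j x))" for i
  proof -
    have "(psum n (X i) x - psum n b x)\<^sup>2 =
        (\<Sum>k<n. \<Sum>j<n. (X i k - b k) * (X i j - b j) * (coef k x * coef j x))" for x
      unfolding psum_def sum_subtractf[symmetric] power2_eq_square sum_product
      by (intro sum.cong refl) (simp add: algebra_simps)
    then show ?thesis
      by (simp add: Bochner_Integration.integral_sum L2_fun_integrable_mult coef_L2)
  qed
  have "(\<lambda>i. \<Sum>k<n. \<Sum>j<n. (X i k - b k) * (X i j - b j) * (LINT x|M. coef k x * coef j x))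
      \<longlonglongrightarrow> (\<Sum>k<n. \<Sum>j<n. (b k - b k) * (b j - b j) * (LINT x|M. coef k x * coef j x))"
    by (intro tendsto_intros Xk)
  then show "(\<lambda>i. LINT x|M. (psum n (X i) x - psum n b x)\<^sup>2) \<longlonglongrightarrow> 0"
    unfolding eq by simp
qed

text \<open>Convergence along \<open>level\<close> holds on \<open>good\<close>; multiplying the
  coordinates by its indicator makes approximations and limit both vanish elsewhere, so that the
  convergence holds at every \<open>\<omega>\<close>.\<close>

lemma V_class_measurable: "(\<lambda>\<omega>. L2_class M (V \<omega>)) \<in> measurable gauss_seq (borel_of (L2_topology M))"
  unfolding L2_topology_def
proof (rule Metric_space.measurable_mtopology_limit[OF Metric_space_L2])
  let ?g = "\<lambda>\<omega> k. indicator good \<omega> * \<omega> k"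
  have g: "?g \<in> borel_measurable gauss_seq"
    by (rule measurable_coordinatewise_then_product) measurable
  show "(\<lambda>\<omega>. L2_class M (psum (level m) (?g \<omega>))) \<in>
      measurable gauss_seq (borel_of (Metric_space.mtopology (L2 M) (L2_dist M)))" for m
    using measurable_continuous_map[OF psum_continuous_map g] by (simp add: L2_topology_def)
  show "L2_class M (V \<omega>) \<in> L2 M" for \<omega> by (intro L2_class_in_L2 V_L2)
  show "(\<lambda>m. L2_dist M (L2_class M (psum (level m) (?g \<omega>))) (L2_class M (V \<omega>))) \<longlonglongrightarrow> 0" for \<omega>
  proof (cases "\<omega> \<in> good")
    case True
    have "(\<lambda>m. sqrt (LINT x|M. (vlim \<omega> x - psum (level m) \<omega> x)\<^sup>2)) \<longlonglongrightarrow> 0"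
      using tendsto_real_sqrt[OF good_error(2)[OF True]] by simp
    then show ?thesis
      using True by (simp add: L2_dist_class psum_L2 V_L2 V_def power2_commute)
  next
    case False
    then show ?thesis by (simp add: L2_dist_class psum_L2 V_L2 V_def psum_def)
  qed
qed

section \<open>Moments and linear functionals of the limit\<close>

lemma V_error:
  assumes x: "x \<in> space M"
  shows "(\<lambda>\<omega>. V \<omega> x - psum n \<omega> x) \<in> L2_fun gauss_seq"
    and "(LINT \<omega>|gauss_seq. (V \<omega> x - psum n \<omega> x)\<^sup>2) \<le> cov n x x"
proof -
  note [measurable] = L2_fun_measurable[OF psum_L2_gauss[of n x]]
  have ae: "AE \<omega> in gauss_seq. (V \<omega> x - psum n \<omega> x)\<^sup>2 = (vlim \<omega> x - psum n \<omega> x)\<^sup>2"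
    using AE_V by eventually_elim simp
  have m: "(\<lambda>\<omega>. (V \<omega> x - psum n \<omega> x)\<^sup>2) \<in> borel_measurable gauss_seq"
      "(\<lambda>\<omega>. (vlim \<omega> x - psum n \<omega> x)\<^sup>2) \<in> borel_measurable gauss_seq"
    using x by measurable
  show "(LINT \<omega>|gauss_seq. (V \<omega> x - psum n \<omega> x)\<^sup>2) \<le> cov n x x"
    using vlim_error(2)[OF x, of n] integral_cong_AE[OF m ae] by simp
  show "(\<lambda>\<omega>. V \<omega> x - psum n \<omega> x) \<in> L2_fun gauss_seq"
    using integrable_cong_AE[OF m ae] L2_fun_integrable_square[OF vlim_error(1)[OF x, of n]] x
    by (intro L2_funI) auto
qed

lemma V_L2_tendsto:
  assumes x: "x \<in> space M"
  shows "L2_tendsto gauss_seq (\<lambda>n \<omega>. psum n \<omega> x) (\<lambda>\<omega>. V \<omega> x)"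
  \<comment> \<open>\<open>psum 0\<close> is 0, so the case \<open>n = 0\<close> says that
    \<open>V _ x\<close> is square integrable.\<close>
  using V_error(1)[OF x, of 0]
  by (intro L2_tendstoI_bound[OF psum_L2_gauss _ V_error(2)[OF x] cov_tendsto_0[OF x]]) (simp add: psum_def)

lemma V_centred:
  assumes x: "x \<in> space M"
  shows "has_bochner_integral gauss_seq (\<lambda>\<omega>. V \<omega> x) 0"
proof -
  have "(\<lambda>n. LINT \<omega>|gauss_seq. psum n \<omega> x) \<longlonglongrightarrow> (LINT \<omega>|gauss_seq. V \<omega> x)"
    by (rule gauss_seq.L2_tendsto_expectation[OF V_L2_tendsto[OF x]])
  moreover have "(LINT \<omega>|gauss_seq. psum n \<omega> x) = 0" for n
    using gauss_seq_sum_centred[of "\<lambda>k. coef k x" "{..<n}"] by (simp add: psum_def mult.commute)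
  ultimately have "(LINT \<omega>|gauss_seq. V \<omega> x) = 0" by (simp add: LIMSEQ_const_iff)
  then show ?thesis
    using gauss_seq.L2_fun_integrable[OF L2_tendstoD(2)[OF V_L2_tendsto[OF x]]]
    by (simp add: has_bochner_integral_iff)
qed

lemma cov_offdiagonal_tendsto_0:
  assumes x: "x \<in> space M" and y: "y \<in> space M"
  shows "(\<lambda>n. cov n x y) \<longlonglongrightarrow> 0"
proof (rule Lim_null_comparison[OF always_eventually])
  show "\<forall>n. norm (cov n x y) \<le> sqrt (cov n x x) * sqrt (cov n y y)"
  proof
    fix n
    have "(\<lambda>w. res n w x) \<in> L2_fun \<mu>" if "x \<in> space M" for x
      using res_mult_integrable[OF that that, of n n] that by (intro L2_funI) (auto simp: power2_eq_square)
    from L2_Cauchy_Schwarz[OF this[OF x] this[OF y]]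
    show "norm (cov n x y) \<le> sqrt (cov n x x) * sqrt (cov n y y)"
      by (simp add: cov_def power2_eq_square)
  qed
  have "(\<lambda>n. sqrt (cov n x x) * sqrt (cov n y y)) \<longlonglongrightarrow> sqrt 0 * sqrt 0"
    by (intro tendsto_intros cov_tendsto_0 x y)
  then show "(\<lambda>n. sqrt (cov n x x) * sqrt (cov n y y)) \<longlonglongrightarrow> 0" by simp
qed

text \<open>The partial sums have covariance \<open>cov 0 x y - cov n x y\<close>, and mean square
  convergence at the two points passes to the expected product.\<close>

lemma V_covariance:
  assumes x: "x \<in> space M" and y: "y \<in> space M"
  shows "has_bochner_integral gauss_seq (\<lambda>\<omega>. V \<omega> x * V \<omega> y) (cov 0 x y)"
proof -
  have "(\<lambda>n. LINT \<omega>|gauss_seq. psum n \<omega> x * psum n \<omega> y) \<longlonglongrightarrow> (LINT \<omega>|gauss_seq. V \<omega> x * V \<omega> y)"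
    by (rule L2_tendsto_inner[OF V_L2_tendsto[OF x] V_L2_tendsto[OF y]])
  then have "(\<lambda>n. cov 0 x y - cov n x y) \<longlonglongrightarrow> (LINT \<omega>|gauss_seq. V \<omega> x * V \<omega> y)"
    by (simp add: psum_inner[OF x y])
  moreover have "(\<lambda>n. cov 0 x y - cov n x y) \<longlonglongrightarrow> cov 0 x y - 0"
    by (intro tendsto_intros cov_offdiagonal_tendsto_0 x y)
  ultimately have "(LINT \<omega>|gauss_seq. V \<omega> x * V \<omega> y) = cov 0 x y"
    using LIMSEQ_unique by fastforce
  then show ?thesis
    using L2_fun_integrable_mult[OF L2_tendstoD(2)[OF V_L2_tendsto[OF x]] L2_tendstoD(2)[OF V_L2_tendsto[OF y]]]
    by (simp add: has_bochner_integral_iff)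
qed

lemma V_total_error:
  shows "integrable gauss_seq (\<lambda>\<omega>. LINT x|M. (V \<omega> x - psum n \<omega> x)\<^sup>2)"
    and "(LINT \<omega>|gauss_seq. LINT x|M. (V \<omega> x - psum n \<omega> x)\<^sup>2) \<le> tail n"
proof -
  let ?f = "\<lambda>\<omega>. LINT x|M. (V \<omega> x - psum n \<omega> x)\<^sup>2"
  have m: "?f \<in> borel_measurable gauss_seq" by measurable
  have "(\<integral>\<^sup>+ \<omega>. ennreal (?f \<omega>) \<partial>gauss_seq) = (\<integral>\<^sup>+ \<omega>. err n \<omega> \<partial>gauss_seq)"
  proof (rule nn_integral_cong_AE)
    show "AE \<omega> in gauss_seq. ennreal (?f \<omega>) = err n \<omega>"
      using AE_V
    proof eventually_elim
      case (elim \<omega>)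
      have "ennreal (?f \<omega>) = (\<integral>\<^sup>+ x. ennreal ((V \<omega> x - psum n \<omega> x)\<^sup>2) \<partial>M)"
        by (rule nn_integral_eq_integral[symmetric])
          (auto intro!: L2_fun_integrable_square[of "\<lambda>x. V \<omega> x - psum n \<omega> x"] L2_fun_diff V_L2 psum_L2)
      then show ?case using elim by (simp add: err_def)
    qed
  qed
  also have "\<dots> \<le> ennreal (tail n)" by (rule err_le)
  finally have le: "(\<integral>\<^sup>+ \<omega>. ennreal (?f \<omega>) \<partial>gauss_seq) \<le> ennreal (tail n)" .
  then have "(\<integral>\<^sup>+ \<omega>. ennreal (?f \<omega>) \<partial>gauss_seq) < \<infinity>"
    by (rule le_less_trans) simp
  then show int: "integrable gauss_seq ?f" using m by (intro integrableI_nonneg) auto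
  show "(LINT \<omega>|gauss_seq. ?f \<omega>) \<le> tail n"
    using le tail_nonneg[of n] by (simp add: nn_integral_eq_integral[OF int])
qed

text \<open>A linear functional of a partial sum is a finite Gaussian sum, and Cauchy-Schwarz in
  \<open>M\<close> bounds its mean square error by the squared norm of \<open>r\<close> times
  \<open>tail n\<close>.\<close>

lemma V_inner_L2_tendsto:
  assumes r: "r \<in> L2_fun M"
  shows "L2_tendsto gauss_seq (\<lambda>n \<omega>. \<Sum>k<n. (LINT x|M. r x * coef k x) * \<omega> k) (\<lambda>\<omega>. LINT x|M. r x * V \<omega> x)"
proof -
  have [measurable]: "r \<in> borel_measurable M" using r by (rule L2_fun_measurable)
  have F: "(\<Sum>k<n. (LINT x|M. r x * coef k x) * \<omega> k) = (LINT x|M. r x * psum n \<omega> x)" for n \<omega>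
  proof -
    have "(LINT x|M. r x * psum n \<omega> x) = (LINT x|M. (\<Sum>k<n. \<omega> k * (r x * coef k x)))"
      by (simp add: psum_def sum_distrib_left algebra_simps)
    also have "\<dots> = (\<Sum>k<n. \<omega> k * (LINT x|M. r x * coef k x))"
      by (subst Bochner_Integration.integral_sum) (auto intro!: L2_fun_integrable_mult r coef_L2)
    finally show ?thesis by (simp add: mult.commute)
  qed
  have FL2: "(\<lambda>\<omega>. LINT x|M. r x * psum n \<omega> x) \<in> L2_fun gauss_seq" for n
    unfolding F[symmetric] by (rule gauss_seq_sum_L2)
  have m: "(\<lambda>\<omega>. LINT x|M. r x * V \<omega> x) \<in> borel_measurable gauss_seq" by measurable
  let ?R = "LINT x|M. (r x)\<^sup>2"
  have pt: "((LINT x|M. r x * V \<omega> x) - (LINT x|M. r x * psum n \<omega> x))\<^sup>2 \<le> ?R * (LINT x|M. (V \<omega> x - psum n \<omega> x)\<^sup>2)" for n \<omega>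
  proof -
    have "(LINT x|M. r x * V \<omega> x) - (LINT x|M. r x * psum n \<omega> x) = (LINT x|M. r x * (V \<omega> x - psum n \<omega> x))"
      by (simp add: right_diff_distrib Bochner_Integration.integral_diff L2_fun_integrable_mult r V_L2 psum_L2)
    then have "\<bar>(LINT x|M. r x * V \<omega> x) - (LINT x|M. r x * psum n \<omega> x)\<bar> \<le> sqrt (?R * (LINT x|M. (V \<omega> x - psum n \<omega> x)\<^sup>2))"
      using L2_Cauchy_Schwarz[OF r L2_fun_diff[OF V_L2[of \<omega>] psum_L2[of n \<omega>]]] by (simp add: real_sqrt_mult)
    then have "\<bar>(LINT x|M. r x * V \<omega> x) - (LINT x|M. r x * psum n \<omega> x)\<bar>\<^sup>2 \<le> (sqrt (?R * (LINT x|M. (V \<omega> x - psum n \<omega> x)\<^sup>2)))\<^sup>2"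
      by (intro power_mono) auto
    then show ?thesis by simp
  qed
  have int: "integrable gauss_seq (\<lambda>\<omega>. ((LINT x|M. r x * V \<omega> x) - (LINT x|M. r x * psum n \<omega> x))\<^sup>2)" for n
    using m L2_fun_measurable[OF FL2, of n] pt
    by (intro Bochner_Integration.integrable_bound[OF integrable_mult_right[OF V_total_error(1)[of n], of ?R]])
      (auto intro!: AE_I2)
  show ?thesis
    unfolding F
  proof (rule L2_tendstoI_bound[OF FL2])
    have "(\<lambda>\<omega>. (LINT x|M. r x * V \<omega> x) - (LINT x|M. r x * psum 0 \<omega> x)) \<in> L2_fun gauss_seq"
      using m L2_fun_measurable[OF FL2, of 0] by (intro L2_funI int) auto
    then show "(\<lambda>\<omega>. LINT x|M. r x * V \<omega> x) \<in> L2_fun gauss_seq" by (simp add: psum_def)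
    show "(LINT \<omega>|gauss_seq. ((LINT x|M. r x * V \<omega> x) - (LINT x|M. r x * psum n \<omega> x))\<^sup>2) \<le> ?R * tail n" for n
    proof -
      have "(LINT \<omega>|gauss_seq. ((LINT x|M. r x * V \<omega> x) - (LINT x|M. r x * psum n \<omega> x))\<^sup>2)
          \<le> (LINT \<omega>|gauss_seq. ?R * (LINT x|M. (V \<omega> x - psum n \<omega> x)\<^sup>2))"
        by (rule integral_mono[OF int integrable_mult_right[OF V_total_error(1)] pt])
      also have "\<dots> \<le> ?R * tail n"
        using V_total_error(2)[of n] by (simp add: mult_left_mono)
      finally show ?thesis .
    qed
    show "(\<lambda>n. ?R * tail n) \<longlonglongrightarrow> 0" using tendsto_mult_left[OF tail_tendsto_0, of ?R] by simp
  qed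
qed

text \<open>The variances of the approximating Gaussian sums converge to the second moment of the
  functional. This identifies the limit of their characteristic functions, and uniqueness identifies
  the law; the variance may be 0.\<close>

lemma V_inner_normal:
  assumes r: "r \<in> L2_fun M"
  shows "\<exists>\<sigma>\<ge>0. distr gauss_seq borel (\<lambda>\<omega>. LINT x|M. r x * V \<omega> x) = normal_law 0 \<sigma>"
proof -
  let ?f = "\<lambda>\<omega>. LINT x|M. r x * V \<omega> x" and ?c = "\<lambda>k. LINT x|M. r x * coef k x"
  note lim = V_inner_L2_tendsto[OF r]
  define \<sigma> where "\<sigma> = sqrt (LINT \<omega>|gauss_seq. ?f \<omega> * ?f \<omega>)"
  have \<sigma>: "\<sigma> \<ge> 0" "\<sigma>\<^sup>2 = (LINT \<omega>|gauss_seq. ?f \<omega> * ?f \<omega>)" by (auto simp: \<sigma>_def)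
  have "(\<lambda>n. \<Sum>k<n. (?c k)\<^sup>2) \<longlonglongrightarrow> \<sigma>\<^sup>2"
    using L2_tendsto_inner[OF lim lim] unfolding \<sigma>(2) by (simp add: gauss_seq_inner power2_eq_square)
  then have 1: "(\<lambda>n. complex_of_real (exp (- (t\<^sup>2 * (\<Sum>k<n. (?c k)\<^sup>2)) / 2))) \<longlonglongrightarrow> exp (- (t\<^sup>2 * \<sigma>\<^sup>2) / 2)" for t
    by (intro tendsto_intros) auto
  have "(\<lambda>n. complex_of_real (exp (- (t\<^sup>2 * (\<Sum>k<n. (?c k)\<^sup>2)) / 2))) \<longlonglongrightarrow> char (distr gauss_seq borel ?f) t" for t
    using gauss_seq.L2_tendsto_char[OF lim, of t] by (simp only: gauss_seq_char[OF finite_lessThan])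
  then have "char (distr gauss_seq borel ?f) t = exp (- (t\<^sup>2 * \<sigma>\<^sup>2) / 2)" for t
    using LIMSEQ_unique[OF _ 1] by blast
  then have "char (distr gauss_seq borel ?f) = char (normal_law 0 \<sigma>)"
    by (intro ext) (simp add: char_normal_law[OF \<sigma>(1)])
  then have "distr gauss_seq borel ?f = normal_law 0 \<sigma>"
    using L2_fun_measurable[OF L2_tendstoD(2)[OF lim]]
    by (intro Levy_uniqueness real_distribution_normal_law \<sigma> gauss_seq.real_distribution_distr) auto
  then show ?thesis using \<sigma>(1) by blast
qed

lemma V_inner_centred:
  assumes r: "r \<in> L2_fun M"
  shows "has_bochner_integral gauss_seq (\<lambda>\<omega>. LINT x|M. r x * V \<omega> x) 0"
proof -
  note lim = V_inner_L2_tendsto[OF r]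
  have "(LINT \<omega>|gauss_seq. LINT x|M. r x * V \<omega> x) = 0"
    using gauss_seq.L2_tendsto_expectation[OF lim] by (simp add: gauss_seq_sum_centred LIMSEQ_const_iff)
  then show ?thesis
    using gauss_seq.L2_fun_integrable[OF L2_tendstoD(2)[OF lim]] by (simp add: has_bochner_integral_iff)
qed

theorem centred_gaussian_V: "centred_gaussian_with_kernel M gauss_seq V (cov 0)"
proof -
  have "\<exists>\<mu> \<sigma>. 0 \<le> \<sigma> \<and> distr gauss_seq borel (\<lambda>\<omega>. LINT x|M. L2_rep u x * V \<omega> x) = normal_law \<mu> \<sigma>"
    if "u \<in> L2 M" for u
    using V_inner_normal[OF L2_rep_in_L2_fun[OF that]] by blast
  then show ?thesis
    unfolding centred_gaussian_with_kernel_def gaussian_L2_def centred_L2_def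
    using V_measurable V_L2 V_class_measurable V_centred V_covariance V_inner_centred[OF L2_rep_in_L2_fun]
    by (auto simp: L2_inner_class)
qed

end

section \<open>The central limit theorem for the empirical process\<close>

text \<open>The phase \<open>c\<close> becomes a factor \<open>iexp c\<close>, so convergence of
  characteristic functions yields that of the generators of \<open>trig N\<close>.\<close>

lemma (in prob_space) expectation_cos_char:
  assumes [measurable]: "X \<in> borel_measurable M"
  shows "expectation (\<lambda>\<omega>. cos (X \<omega> + c)) = Re (iexp c * char (distr M borel X) 1)"
proof -
  have int: "integrable M (\<lambda>\<omega>. iexp (X \<omega> + c))" by (intro integrable_const_bound[where B=1]) auto
  have "iexp c * char (distr M borel X) 1 = (CLINT \<omega>|M. iexp c * iexp (X \<omega>))"
    by (simp add: char_def integral_distr)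
  also have "\<dots> = (CLINT \<omega>|M. iexp (X \<omega> + c))"
    by (intro Bochner_Integration.integral_cong) (simp_all add: exp_add distrib_left)
  finally have "Re (iexp c * char (distr M borel X) 1) = expectation (\<lambda>\<omega>. Re (iexp (X \<omega> + c)))"
    using int by (simp add: integral_Re)
  then show ?thesis by (simp add: Re_exp)
qed

text \<open>Both random elements live on one space, so the expectations of \<open>F\<close> differ
  by at most \<open>\<kappa>\<close> times the mean distance, itself at most the root of the mean
  squared distance. The sample and the limit are both truncated with this estimate.\<close>

lemma (in prob_space) L2_lipschitz_error:
  assumes \<phi>: "\<And>\<omega>. \<omega> \<in> space M \<Longrightarrow> \<phi> \<omega> \<in> L2_fun N" "(\<lambda>\<omega>. L2_class N (\<phi> \<omega>)) \<in> measurable M (borel_of (L2_topology N))"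
    and \<psi>: "\<And>\<omega>. \<omega> \<in> space M \<Longrightarrow> \<psi> \<omega> \<in> L2_fun N" "(\<lambda>\<omega>. L2_class N (\<psi> \<omega>)) \<in> measurable M (borel_of (L2_topology N))"
    and Z: "integrable M (\<lambda>\<omega>. LINT x|N. (\<phi> \<omega> x - \<psi> \<omega> x)\<^sup>2)"
      "expectation (\<lambda>\<omega>. LINT x|N. (\<phi> \<omega> x - \<psi> \<omega> x)\<^sup>2) \<le> \<tau>"
    and F: "\<And>u. u \<in> L2 N \<Longrightarrow> \<bar>F u\<bar> \<le> B" "0 \<le> \<kappa>"
      "\<And>u v. u \<in> L2 N \<Longrightarrow> v \<in> L2 N \<Longrightarrow> \<bar>F u - F v\<bar> \<le> \<kappa> * L2_dist N u v"
  shows "\<bar>expectation (\<lambda>\<omega>. F (L2_class N (\<phi> \<omega>))) - expectation (\<lambda>\<omega>. F (L2_class N (\<psi> \<omega>)))\<bar> \<le> \<kappa> * sqrt \<tau>"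
proof -
  let ?Z = "\<lambda>\<omega>. LINT x|N. (\<phi> \<omega> x - \<psi> \<omega> x)\<^sup>2"
  have "continuous_map (L2_topology N) euclideanreal F"
    unfolding L2_topology_def by (rule Metric_space.lipschitz_continuous_map[OF Metric_space_L2 F(3)])
  note Fm = measurable_borel_of_continuous_map[OF this]
  have int\<phi>: "integrable M (\<lambda>\<omega>. F (L2_class N (\<phi> \<omega>)))"
    by (intro integrable_const_bound[of _ B] AE_I2 measurable_compose[OF \<phi>(2) Fm])
      (auto intro!: F(1) L2_class_in_L2 \<phi>)
  have int\<psi>: "integrable M (\<lambda>\<omega>. F (L2_class N (\<psi> \<omega>)))"
    by (intro integrable_const_bound[of _ B] AE_I2 measurable_compose[OF \<psi>(2) Fm])
      (auto intro!: F(1) L2_class_in_L2 \<psi>)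
  have sZ: "(\<lambda>\<omega>. sqrt (?Z \<omega>)) \<in> L2_fun M"
    using Z(1) by (intro L2_funI) auto
  have "\<bar>expectation (\<lambda>\<omega>. F (L2_class N (\<phi> \<omega>))) - expectation (\<lambda>\<omega>. F (L2_class N (\<psi> \<omega>)))\<bar>
      = \<bar>expectation (\<lambda>\<omega>. F (L2_class N (\<phi> \<omega>)) - F (L2_class N (\<psi> \<omega>)))\<bar>"
    using int\<phi> int\<psi> by simp
  also have "\<dots> \<le> expectation (\<lambda>\<omega>. \<bar>F (L2_class N (\<phi> \<omega>)) - F (L2_class N (\<psi> \<omega>))\<bar>)" by simp
  also have "\<dots> \<le> expectation (\<lambda>\<omega>. \<kappa> * sqrt (?Z \<omega>))"
  proof (rule integral_mono)
    show "integrable M (\<lambda>\<omega>. \<bar>F (L2_class N (\<phi> \<omega>)) - F (L2_class N (\<psi> \<omega>))\<bar>)" using int\<phi> int\<psi> by simp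
    show "integrable M (\<lambda>\<omega>. \<kappa> * sqrt (?Z \<omega>))" using L2_fun_integrable[OF sZ] by simp
    fix \<omega> assume "\<omega> \<in> space M"
    then show "\<bar>F (L2_class N (\<phi> \<omega>)) - F (L2_class N (\<psi> \<omega>))\<bar> \<le> \<kappa> * sqrt (?Z \<omega>)"
      using F(3)[OF L2_class_in_L2[OF \<phi>(1)] L2_class_in_L2[OF \<psi>(1)]] \<phi>(1) \<psi>(1) by (simp add: L2_dist_class)
  qed
  also have "\<dots> \<le> \<kappa> * sqrt \<tau>"
  proof -
    have "expectation (\<lambda>\<omega>. sqrt (?Z \<omega>)) \<le> sqrt (expectation ?Z)"
      using expectation_abs_le_L2[OF sZ] by simp
    also have "\<dots> \<le> sqrt \<tau>" using Z(2) by simp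
    finally show ?thesis using F(2) by (simp add: mult_left_mono)
  qed
  finally show ?thesis .
qed

section \<open>Normalised sums of an independent sample\<close>

locale iid_sample = prob_space P for P :: "'a measure" +
  fixes W :: "nat \<Rightarrow> 'a \<Rightarrow> 's::{second_countable_topology, metric_space}" and \<mu> :: "'s measure"
  assumes indep: "indep_vars (\<lambda>_. borel) W UNIV"
    and distr_W: "\<And>j. distr P borel (W j) = \<mu>"
begin

lemma W_measurable [measurable]: "W j \<in> borel_measurable P"
  using indep by (auto simp: indep_vars_def)

lemma sets_mu: "sets \<mu> = sets borel"
  by (subst distr_W[symmetric, of 0]) simp

lemma expectation_W:
  fixes g :: "'s \<Rightarrow> real"
  assumes "g \<in> borel_measurable borel"
  shows "expectation (\<lambda>\<omega>. g (W j \<omega>)) = (LINT w|\<mu>. g w)"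
  using assms by (subst distr_W[symmetric, of j]) (simp add: integral_distr)

context
  fixes g :: "'s \<Rightarrow> real" and C :: real
  assumes g [measurable]: "g \<in> borel_measurable borel" and C: "\<And>w. \<bar>g w\<bar> \<le> C"
    and centred: "(LINT w|\<mu>. g w) = 0"
begin

lemma g_integrable: "integrable P (\<lambda>\<omega>. g (W j \<omega>))"
  by (rule integrable_const_bound[of _ C]) (use C in auto)

lemma g_mult_integrable: "integrable P (\<lambda>\<omega>. g (W i \<omega>) * g (W j \<omega>))"
proof (rule integrable_const_bound[of _ "C * C"])
  have "0 \<le> C" by (rule order_trans[OF abs_ge_zero C])
  then show "AE \<omega> in P. norm (g (W i \<omega>) * g (W j \<omega>)) \<le> C * C"
    using C by (intro AE_I2) (simp add: abs_mult mult_mono)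
qed simp

text \<open>Independence and centring kill the cross terms, so the bound is uniform in
  \<open>n\<close>. At \<open>n = 0\<close> the factor \<open>1 / sqrt n\<close> is 0 by convention
  and the sum is empty, hence an inequality instead of an equation.\<close>

lemma normalized_sum_square:
  "integrable P (\<lambda>\<omega>. (1 / sqrt n * (\<Sum>j<n. g (W j \<omega>)))\<^sup>2)"
  "expectation (\<lambda>\<omega>. (1 / sqrt n * (\<Sum>j<n. g (W j \<omega>)))\<^sup>2) \<le> (LINT w|\<mu>. (g w)\<^sup>2)"
proof -
  have ind: "indep_vars (\<lambda>_. borel) (\<lambda>j \<omega>. g (W j \<omega>)) UNIV"
    by (rule indep_vars_compose2[OF indep]) simp
  have eq: "(1 / sqrt n * (\<Sum>j<n. g (W j \<omega>)))\<^sup>2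
      = 1 / n * ((\<Sum>j<n. 1 * g (W j \<omega>)) * (\<Sum>j<n. 1 * g (W j \<omega>)))" for \<omega>
    by (simp add: power_mult_distrib power_divide power2_eq_square[symmetric])
  show "integrable P (\<lambda>\<omega>. (1 / sqrt n * (\<Sum>j<n. g (W j \<omega>)))\<^sup>2)"
    unfolding eq by (simp add: sum_product g_mult_integrable)
  have "expectation (\<lambda>\<omega>. g (W i \<omega>) * g (W j \<omega>)) = 0" if "i \<noteq> j" for i j
    using indep_uncorrelated(2)[OF ind UNIV_I UNIV_I that g_integrable g_integrable]
    by (simp add: expectation_W centred)
  moreover have "expectation (\<lambda>\<omega>. g (W i \<omega>) * g (W i \<omega>)) = (LINT w|\<mu>. (g w)\<^sup>2)" for i
    using expectation_W[of "\<lambda>w. g w * g w"] by (simp add: power2_eq_square)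
  ultimately have "expectation (\<lambda>\<omega>. (\<Sum>j<n. 1 * g (W j \<omega>)) * (\<Sum>j<n. 1 * g (W j \<omega>))) = n * (LINT w|\<mu>. (g w)\<^sup>2)"
    by (subst orthonormal_sum_product[OF finite_lessThan g_mult_integrable]) auto
  then show "expectation (\<lambda>\<omega>. (1 / sqrt n * (\<Sum>j<n. g (W j \<omega>)))\<^sup>2) \<le> (LINT w|\<mu>. (g w)\<^sup>2)"
    unfolding eq by simp
qed

text \<open>The central limit theorem concerns standardised sums; evaluating their characteristic
  function at \<open>\<sigma>\<close> undoes the standardisation. With variance 0 there is nothing
  to divide by, and the sums vanish almost surely.\<close>

lemma normalized_sum_char:
  "(\<lambda>n. char (distr P borel (\<lambda>\<omega>. 1 / sqrt (real n) * (\<Sum>j<n. g (W j \<omega>)))) 1)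
    \<longlonglongrightarrow> complex_of_real (exp (- (LINT w|\<mu>. (g w)\<^sup>2) / 2))"
proof (cases "(LINT w|\<mu>. (g w)\<^sup>2) = 0")
  case True
  have "char (distr P borel (\<lambda>\<omega>. 1 / sqrt (real n) * (\<Sum>j<n. g (W j \<omega>)))) 1 = 1" for n
  proof -
    let ?T = "\<lambda>\<omega>. 1 / sqrt (real n) * (\<Sum>j<n. g (W j \<omega>))"
    have "expectation (\<lambda>\<omega>. (?T \<omega>)\<^sup>2) = 0"
      using normalized_sum_square(2)[of n] True by (intro antisym) auto
    then have "AE \<omega> in P. (?T \<omega>)\<^sup>2 = 0"
      using normalized_sum_square(1)[of n] by (subst (asm) integral_nonneg_eq_0_iff_AE) auto
    then have "AE \<omega> in P. iexp (?T \<omega>) = 1" by eventually_elim (simp only: power_eq_0_iff, simp)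
    then have "(CLINT \<omega>|P. iexp (?T \<omega>)) = (CLINT \<omega>|P. 1)" by (intro integral_cong_AE) auto
    then show ?thesis by (simp add: char_def integral_distr prob_space)
  qed
  then show ?thesis using True by simp
next
  case False
  define \<sigma> where "\<sigma> = sqrt (LINT w|\<mu>. (g w)\<^sup>2)"
  have "(LINT w|\<mu>. (g w)\<^sup>2) \<ge> 0" by simp
  then have \<sigma>: "\<sigma> > 0" "\<sigma>\<^sup>2 = (LINT w|\<mu>. (g w)\<^sup>2)" using False by (auto simp: \<sigma>_def less_le)
  have ind: "indep_vars (\<lambda>_. borel) (\<lambda>j \<omega>. g (W j \<omega>)) UNIV"
    by (rule indep_vars_compose2[OF indep]) simp
  have zero: "expectation (\<lambda>\<omega>. g (W j \<omega>)) = 0" for j by (simp add: expectation_W centred)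
  have "weak_conv_m (\<lambda>n. distr P borel (\<lambda>\<omega>. (\<Sum>j<n. g (W j \<omega>)) / sqrt (n * \<sigma>\<^sup>2))) std_normal_distribution"
  proof (rule central_limit_theorem_zero_mean[OF ind zero \<sigma>(1)])
    show "integrable P (\<lambda>\<omega>. (g (W n \<omega>))\<^sup>2)" for n
      using g_mult_integrable[of n n] by (simp add: power2_eq_square)
    show "variance (\<lambda>\<omega>. g (W n \<omega>)) = \<sigma>\<^sup>2" for n
      using expectation_W[of "\<lambda>w. (g w)\<^sup>2"] by (simp add: zero \<sigma>(2))
    show "distr P borel (\<lambda>\<omega>. g (W n \<omega>)) = distr \<mu> borel g" for n
      by (subst distr_W[symmetric, of n]) (simp add: distr_distr comp_def)
  qed
  then have "(\<lambda>n. char (distr P borel (\<lambda>\<omega>. (\<Sum>j<n. g (W j \<omega>)) / sqrt (n * \<sigma>\<^sup>2))) \<sigma>)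
      \<longlonglongrightarrow> char std_normal_distribution \<sigma>"
    by (intro levy_continuity1 real_distribution_distr real_dist_normal_dist) auto
  moreover have "char (distr P borel (\<lambda>\<omega>. (\<Sum>j<n. g (W j \<omega>)) / sqrt (n * \<sigma>\<^sup>2))) \<sigma>
      = char (distr P borel (\<lambda>\<omega>. 1 / sqrt (real n) * (\<Sum>j<n. g (W j \<omega>)))) 1" for n
  proof -
    have "\<sigma> * ((\<Sum>j<n. g (W j \<omega>)) / sqrt (n * \<sigma>\<^sup>2)) = 1 * (1 / sqrt (real n) * (\<Sum>j<n. g (W j \<omega>)))" for \<omega>
      using \<sigma>(1) by (simp add: real_sqrt_mult)
    then show ?thesis by (simp add: char_def integral_distr del: mult_1 times_divide_eq_left times_divide_eq_right of_real_mult of_real_divide)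
  qed
  ultimately show ?thesis by (simp add: char_std_normal_distribution \<sigma>(2))
qed

end

end

section \<open>Truncating the empirical process\<close>

locale iid_kernel_process = kernel_process \<mu> M l L xs + sample: iid_sample P W \<mu>
  for P :: "'a measure" and W :: "nat \<Rightarrow> 'a \<Rightarrow> 's::{second_countable_topology, metric_space}"
    and \<mu> :: "'s measure" and M :: "'x measure" and l :: "'s \<Rightarrow> 'x \<Rightarrow> real" and L xs
begin

definition emp :: "nat \<Rightarrow> 'a \<Rightarrow> 'x \<Rightarrow> real" where
  "emp n \<omega> x = 1 / sqrt (real n) * (\<Sum>j<n. l (W j \<omega>) x)"

text \<open>These coefficients take the place of the normal coordinates, so the truncated empirical
  process and the truncated limit are the same function \<open>psum N\<close> of two random
  sequences.\<close>

definition score :: "nat \<Rightarrow> 'a \<Rightarrow> nat \<Rightarrow> real" where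
  "score n \<omega> k = 1 / sqrt (real n) * (\<Sum>j<n. basis k (W j \<omega>))"

definition rem :: "nat \<Rightarrow> nat \<Rightarrow> 'a \<Rightarrow> 'x \<Rightarrow> real" where
  "rem N n \<omega> x = 1 / sqrt (real n) * (\<Sum>j<n. res N (W j \<omega>) x)"

lemma emp_decomp: "emp n \<omega> x = psum N (score n \<omega>) x + rem N n \<omega> x"
proof -
  have "(\<Sum>j<n. l (W j \<omega>) x) = (\<Sum>k<N. (\<Sum>j<n. basis k (W j \<omega>)) * coef k x) + (\<Sum>j<n. res N (W j \<omega>) x)"
    by (subst l_expansion[of _ _ N]) (simp add: sum.distrib sum_distrib_right sum.swap[of _ "{..<n}"])
  then show ?thesis
    unfolding emp_def psum_def score_def rem_def
    by (simp add: distrib_left sum_distrib_left[of _ _ "{..<N}"])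
qed

lemma score_measurable [measurable]: "score n \<in> borel_measurable P"
  unfolding score_def by (rule measurable_coordinatewise_then_product) measurable

lemma rem_measurable [measurable]: "(\<lambda>(\<omega>, x). rem N n \<omega> x) \<in> borel_measurable (P \<Otimes>\<^sub>M M)"
  unfolding rem_def by measurable

lemma score_square:
  "integrable P (\<lambda>\<omega>. (score n \<omega> k)\<^sup>2)" "sample.expectation (\<lambda>\<omega>. (score n \<omega> k)\<^sup>2) \<le> 1"
proof -
  obtain C where C: "\<And>w. \<bar>basis k w\<bar> \<le> C" using basis_bounded by blast
  note * = sample.normalized_sum_square[OF basis_measurable C basis_centred, of n]
  show "integrable P (\<lambda>\<omega>. (score n \<omega> k)\<^sup>2)" using *(1) by (simp add: score_def)
  show "sample.expectation (\<lambda>\<omega>. (score n \<omega> k)\<^sup>2) \<le> 1"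
    using *(2) basis_norm[of k] by (simp add: score_def power2_eq_square split: if_splits)
qed

lemma rem_square:
  assumes x: "x \<in> space M"
  shows "integrable P (\<lambda>\<omega>. (rem N n \<omega> x)\<^sup>2)" "sample.expectation (\<lambda>\<omega>. (rem N n \<omega> x)\<^sup>2) \<le> cov N x x"
proof -
  obtain C where C: "\<And>w. \<bar>res N w x\<bar> \<le> C" using res_bounded x by blast
  note * = sample.normalized_sum_square[OF res_measurable_fst[OF x] C res_centred[OF x], of n]
  show "integrable P (\<lambda>\<omega>. (rem N n \<omega> x)\<^sup>2)" using *(1) by (simp add: rem_def)
  show "sample.expectation (\<lambda>\<omega>. (rem N n \<omega> x)\<^sup>2) \<le> cov N x x"
    using *(2) by (simp add: rem_def cov_def power2_eq_square)
qed

lemma emp_L2: "emp n \<omega> \<in> L2_fun M"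
proof -
  have "l w \<in> L2_fun M" for w
  proof (rule L2_fun_bounded[OF M.finite_measure_axioms _ l_bounded])
    show "l w \<in> borel_measurable M"
      using measurable_compose[OF measurable_Pair1' l_measurable, of w] by simp
  qed
  then show ?thesis unfolding emp_def by (intro L2_fun_scale L2_fun_sum)
qed

lemma rem_L2: "rem N n \<omega> \<in> L2_fun M"
proof -
  have "rem N n \<omega> = (\<lambda>x. emp n \<omega> x - psum N (score n \<omega>) x)"
    by (simp add: fun_eq_iff emp_decomp[of n \<omega> _ N])
  then show ?thesis using L2_fun_diff[OF emp_L2 psum_L2] by simp
qed

text \<open>Tonelli together with the variance bound at each \<open>x\<close>. The bound is free of
  \<open>n\<close>, which lets the truncation level be fixed first.\<close>

lemma rem_total:
  "integrable P (\<lambda>\<omega>. LINT x|M. (rem N n \<omega> x)\<^sup>2)"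
  "sample.expectation (\<lambda>\<omega>. LINT x|M. (rem N n \<omega> x)\<^sup>2) \<le> tail N"
proof -
  interpret PM: pair_sigma_finite P M ..
  let ?f = "\<lambda>\<omega>. LINT x|M. (rem N n \<omega> x)\<^sup>2"
  have m: "?f \<in> borel_measurable P" by measurable
  have "(\<integral>\<^sup>+ \<omega>. ennreal (?f \<omega>) \<partial>P) = (\<integral>\<^sup>+ \<omega>. \<integral>\<^sup>+ x. ennreal ((rem N n \<omega> x)\<^sup>2) \<partial>M \<partial>P)"
    by (intro nn_integral_cong nn_integral_eq_integral[symmetric] L2_fun_integrable_square rem_L2) auto
  also have "\<dots> = (\<integral>\<^sup>+ x. \<integral>\<^sup>+ \<omega>. ennreal ((rem N n \<omega> x)\<^sup>2) \<partial>P \<partial>M)"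
    by (rule PM.Fubini'[symmetric]) measurable
  also have "\<dots> \<le> (\<integral>\<^sup>+ x. ennreal (cov N x x) \<partial>M)"
  proof (rule nn_integral_mono)
    fix x assume x: "x \<in> space M"
    show "(\<integral>\<^sup>+ \<omega>. ennreal ((rem N n \<omega> x)\<^sup>2) \<partial>P) \<le> ennreal (cov N x x)"
      using rem_square[OF x, of N n] by (subst nn_integral_eq_integral) (auto intro: ennreal_leI)
  qed
  also have "\<dots> = ennreal (tail N)"
    unfolding tail_def using cov_nonneg by (intro nn_integral_eq_integral cov_diag_integrable) auto
  finally have le: "(\<integral>\<^sup>+ \<omega>. ennreal (?f \<omega>) \<partial>P) \<le> ennreal (tail N)" .
  then have "(\<integral>\<^sup>+ \<omega>. ennreal (?f \<omega>) \<partial>P) < \<infinity>" by (rule le_less_trans) simp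
  then show int: "integrable P ?f" using m by (intro integrableI_nonneg) auto
  show "sample.expectation ?f \<le> tail N"
    using le tail_nonneg[of N] by (simp add: nn_integral_eq_integral[OF int])
qed

text \<open>The empirical process is a continuous function of the sample sequence, by continuity of
  \<open>l\<close> in its first argument and dominated convergence over the finite measure
  \<open>M\<close>.\<close>

lemma emp_class_measurable: "(\<lambda>\<omega>. L2_class M (emp n \<omega>)) \<in> measurable P (borel_of (L2_topology M))"
proof -
  define \<phi> where "\<phi> v x = 1 / sqrt (real n) * (\<Sum>j<n. l (v j) x)" for v :: "nat \<Rightarrow> 's" and x
  have lm: "l w \<in> borel_measurable M" for w
    using measurable_compose[OF measurable_Pair1' l_measurable, of w] by simp
  then have [measurable]: "\<phi> v \<in> borel_measurable M" for v unfolding \<phi>_def by measurable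
  have bnd: "\<bar>\<phi> v x\<bar> \<le> 1 / sqrt (real n) * (real n * L)" if x: "x \<in> space M" for v x
  proof -
    have "\<bar>\<Sum>j<n. l (v j) x\<bar> \<le> (\<Sum>j<n. L)"
      by (rule order_trans[OF sum_abs]) (intro sum_mono l_bounded x)
    then show ?thesis unfolding \<phi>_def abs_mult by (simp add: divide_right_mono)
  qed
  let ?K = "1 / sqrt (real n) * (real n * L)"
  have "continuous_map euclidean (L2_topology M) (\<lambda>v. L2_class M (\<phi> v))"
  proof (rule continuous_map_L2_class)
    show "\<phi> v \<in> L2_fun M" for v
      by (rule L2_fun_bounded[OF M.finite_measure_axioms _ bnd]) simp_all
    fix X :: "nat \<Rightarrow> nat \<Rightarrow> 's" and v assume X: "X \<longlonglongrightarrow> v"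
    have Xk: "(\<lambda>i. X i k) \<longlonglongrightarrow> v k" for k
      using continuous_on_tendsto_compose[OF continuous_on_product_coordinates[of k] X] by simp
    have "(\<lambda>i. LINT x|M. (\<phi> (X i) x - \<phi> v x)\<^sup>2) \<longlonglongrightarrow> (LINT x|M. 0)"
    proof (rule integral_dominated_convergence[where w="\<lambda>_. (2 * ?K)\<^sup>2"])
      show "AE x in M. (\<lambda>i. (\<phi> (X i) x - \<phi> v x)\<^sup>2) \<longlonglongrightarrow> 0"
      proof (rule AE_I2)
        fix x assume x: "x \<in> space M"
        have "(\<lambda>i. l (X i k) x) \<longlonglongrightarrow> l (v k) x" for k
          using continuous_on_tendsto_compose[OF l_continuous[OF x] Xk] by simp
        then have "(\<lambda>i. (\<phi> (X i) x - \<phi> v x)\<^sup>2) \<longlonglongrightarrow> (\<phi> v x - \<phi> v x)\<^sup>2"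
          unfolding \<phi>_def by (intro tendsto_intros)
        then show "(\<lambda>i. (\<phi> (X i) x - \<phi> v x)\<^sup>2) \<longlonglongrightarrow> 0" by simp
      qed
      show "AE x in M. norm ((\<phi> (X i) x - \<phi> v x)\<^sup>2) \<le> (2 * ?K)\<^sup>2" for i
      proof (rule AE_I2)
        fix x assume x: "x \<in> space M"
        have "\<bar>\<phi> (X i) x - \<phi> v x\<bar> \<le> 2 * ?K" using bnd[OF x, of "X i"] bnd[OF x, of v] by linarith
        then have "\<bar>\<phi> (X i) x - \<phi> v x\<bar>\<^sup>2 \<le> (2 * ?K)\<^sup>2" by (intro power_mono) auto
        then show "norm ((\<phi> (X i) x - \<phi> v x)\<^sup>2) \<le> (2 * ?K)\<^sup>2" by simp
      qed
    qed auto
    then show "(\<lambda>i. LINT x|M. (\<phi> (X i) x - \<phi> v x)\<^sup>2) \<longlonglongrightarrow> 0" by simp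
  qed
  from measurable_continuous_map[OF this, of "\<lambda>\<omega> j. W j \<omega>" P]
  show ?thesis
    by (simp add: \<phi>_def[abs_def] emp_def[abs_def] measurable_coordinatewise_then_product)
qed

text \<open>The Cramer-Wold device: a linear combination of scores is a normalised sum of the single
  function \<open>g\<close>. At a zero pivot \<open>basis k\<close> vanishes and the score with it,
  hence the limit coordinate is set to 0 there.\<close>

lemma score_convergence:
  fixes h :: "(nat \<Rightarrow> real) \<Rightarrow> real"
  assumes h: "continuous_on UNIV h" and B: "\<And>y. \<bar>h y\<bar> \<le> B"
  shows "(\<lambda>n. LINT \<omega>|P. h (\<lambda>k. if k < N then score n \<omega> k else 0)) \<longlonglongrightarrow>
    (LINT \<omega>|gauss_seq. h (\<lambda>k. if k < N \<and> pivot k \<noteq> 0 then \<omega> k else 0))"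
proof (rule finite_dim_convergence[where N=N, OF sample.prob_space_axioms gauss_seq.prob_space_axioms _ _ _ _ _ _ _ _ _ h B])
  show "(\<lambda>\<omega> k. if k < N then score n \<omega> k else 0) \<in> borel_measurable P" for n
  proof (rule measurable_coordinatewise_then_product)
    have "(\<lambda>\<omega>. score n \<omega> k) \<in> borel_measurable P" for k
      by (rule measurable_product_then_coordinatewise[OF score_measurable])
    then show "(\<lambda>\<omega>. if k < N then score n \<omega> k else 0) \<in> borel_measurable P" for k by (cases "k < N") auto
  qed
  show "(\<lambda>\<omega> k. if k < N \<and> pivot k \<noteq> 0 then \<omega> k else 0) \<in> borel_measurable gauss_seq"
    by (rule measurable_coordinatewise_then_product) measurable
  show "integrable P (\<lambda>\<omega>. (if k < N then score n \<omega> k else 0)\<^sup>2)" for n k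
    by (cases "k < N") (simp_all add: score_square)
  show "(LINT \<omega>|P. (if k < N then score n \<omega> k else 0)\<^sup>2) \<le> 1" for n k
    by (cases "k < N") (simp_all add: score_square)
  show "integrable gauss_seq (\<lambda>\<omega>. (if k < N \<and> pivot k \<noteq> 0 then \<omega> k else 0)\<^sup>2)" for k
    by (cases "k < N"; cases "pivot k = 0") (simp_all add: gauss_seq_coordinate)
  show "(LINT \<omega>|gauss_seq. (if k < N \<and> pivot k \<noteq> 0 then \<omega> k else 0)\<^sup>2) \<le> 1" for k
    by (cases "k < N"; cases "pivot k = 0") (simp_all add: gauss_seq_coordinate)
  fix t :: "nat \<Rightarrow> real" and c :: real
  define g where "g w = (\<Sum>k<N. t k * basis k w)" for w
  have gm: "g \<in> borel_measurable borel" unfolding g_def by measurable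
  have "\<exists>C. \<forall>w. \<bar>g w\<bar> \<le> C"
  proof -
    have "\<forall>k. \<exists>C. \<forall>w. \<bar>basis k w\<bar> \<le> C" using basis_bounded by blast
    from choice[OF this] obtain b where b: "\<forall>k. \<forall>w. \<bar>basis k w\<bar> \<le> b k" by (rule exE)
    have "\<bar>g w\<bar> \<le> (\<Sum>k<N. \<bar>t k\<bar> * b k)" for w
      unfolding g_def using b by (intro order_trans[OF sum_abs] sum_mono) (simp add: abs_mult mult_left_mono)
    then show ?thesis by blast
  qed
  then obtain C where C: "\<And>w. \<bar>g w\<bar> \<le> C" by blast
  have g0: "(LINT w|\<mu>. g w) = 0"
    unfolding g_def using basis_integrable basis_centred by (simp add: Bochner_Integration.integral_sum)
  \<comment> \<open>Drops the directions with zero pivot, which contribute nothing to the variance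
    of \<open>g\<close>.\<close>
  define q where "q k = (if pivot k = 0 then 0 else t k)" for k
  have g2: "(LINT w|\<mu>. (g w)\<^sup>2) = (\<Sum>k<N. (q k)\<^sup>2)"
  proof -
    have "(LINT w|\<mu>. (g w)\<^sup>2) = (\<Sum>k<N. t k * t k * (LINT w|\<mu>. basis k w * basis k w))"
      unfolding g_def power2_eq_square
      by (rule mu.orthonormal_sum_product) (auto intro: basis_basis_integrable basis_orthogonal)
    also have "\<dots> = (\<Sum>k<N. (q k)\<^sup>2)"
      by (intro sum.cong) (auto simp: basis_norm q_def power2_eq_square)
    finally show ?thesis .
  qed
  let ?T = "\<lambda>n \<omega>. 1 / sqrt (real n) * (\<Sum>j<n. g (W j \<omega>))"
  let ?Y = "\<lambda>\<omega>. \<Sum>k<N. q k * \<omega> k"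
  have T: "(\<Sum>k<N. t k * (if k < N then score n \<omega> k else 0)) = ?T n \<omega>" for n \<omega>
  proof -
    have "(\<Sum>k<N. t k * (if k < N then score n \<omega> k else 0)) = (\<Sum>k<N. \<Sum>j<n. 1 / sqrt (real n) * (t k * basis k (W j \<omega>)))"
      by (intro sum.cong) (auto simp: score_def sum_distrib_left algebra_simps)
    also have "\<dots> = ?T n \<omega>"
      unfolding g_def by (subst sum.swap) (simp add: sum_distrib_left)
    finally show ?thesis .
  qed
  have Y: "(\<Sum>k<N. t k * (if k < N \<and> pivot k \<noteq> 0 then \<omega> k else 0)) = ?Y \<omega>" for \<omega>
    by (intro sum.cong) (auto simp: q_def)
  have Ym: "?Y \<in> borel_measurable gauss_seq" by measurable
  have gm': "?T n \<in> borel_measurable P" for n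
    using gm by measurable
  have "(\<lambda>n. Re (iexp c * char (distr P borel (?T n)) 1)) \<longlonglongrightarrow>
      Re (iexp c * complex_of_real (exp (- (LINT w|\<mu>. (g w)\<^sup>2) / 2)))"
    by (intro tendsto_intros sample.normalized_sum_char[OF gm C g0])
  also have "complex_of_real (exp (- (LINT w|\<mu>. (g w)\<^sup>2) / 2)) = char (distr gauss_seq borel ?Y) 1"
    by (subst gauss_seq_char) (simp_all add: g2)
  finally show "(\<lambda>n. LINT \<omega>|P. cos ((\<Sum>k<N. t k * (if k < N then score n \<omega> k else 0)) + c)) \<longlonglongrightarrow>
      (LINT \<omega>|gauss_seq. cos ((\<Sum>k<N. t k * (if k < N \<and> pivot k \<noteq> 0 then \<omega> k else 0)) + c))"
    unfolding T Y sample.expectation_cos_char[OF gm'] gauss_seq.expectation_cos_char[OF Ym] .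
qed simp_all

theorem emp_converges:
  "converges_in_distribution (L2_topology M) P (\<lambda>n \<omega>. L2_class M (emp n \<omega>))
     gauss_seq (\<lambda>\<omega>. L2_class M (V \<omega>))"
  unfolding L2_topology_def
proof (rule Metric_space.converges_in_distribution_lipschitzI[OF Metric_space_L2 sample.prob_space_axioms
      gauss_seq.prob_space_axioms])
  show "(\<lambda>\<omega>. L2_class M (emp n \<omega>)) \<in> measurable P (borel_of (Metric_space.mtopology (L2 M) (L2_dist M)))" for n
    using emp_class_measurable by (simp add: L2_topology_def)
  show "(\<lambda>\<omega>. L2_class M (V \<omega>)) \<in> measurable gauss_seq (borel_of (Metric_space.mtopology (L2 M) (L2_dist M)))"
    using V_class_measurable by (simp add: L2_topology_def)
  fix F :: "('x \<Rightarrow> real) set \<Rightarrow> real" and B \<kappa>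
  assume F: "\<And>u. u \<in> L2 M \<Longrightarrow> \<bar>F u\<bar> \<le> B" "0 \<le> \<kappa>"
    "\<And>u v. u \<in> L2 M \<Longrightarrow> v \<in> L2 M \<Longrightarrow> \<bar>F u - F v\<bar> \<le> \<kappa> * L2_dist M u v"
  have Fc: "continuous_map (L2_topology M) euclideanreal F"
    unfolding L2_topology_def by (rule Metric_space.lipschitz_continuous_map[OF Metric_space_L2 F(3)])
  have fin: "(\<lambda>n. LINT \<omega>|P. F (L2_class M (psum N (score n \<omega>)))) \<longlonglongrightarrow> (LINT \<omega>|gauss_seq. F (L2_class M (psum N \<omega>)))" for N
  proof -
    define h where "h y = F (L2_class M (psum N y))" for y
    have "continuous_on UNIV h"
      using continuous_map_compose[OF psum_continuous_map Fc, of N] by (simp add: h_def[abs_def] comp_def)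
    moreover have "\<bar>h y\<bar> \<le> B" for y unfolding h_def by (intro F(1) L2_class_in_L2 psum_L2)
    moreover have "h (\<lambda>k. if k < N then score n \<omega> k else 0) = F (L2_class M (psum N (score n \<omega>)))" for n \<omega>
      by (simp add: h_def psum_def[abs_def])
    moreover have "h (\<lambda>k. if k < N \<and> pivot k \<noteq> 0 then \<omega> k else 0) = F (L2_class M (psum N \<omega>))" for \<omega>
    proof -
      \<comment> \<open>The coordinates at zero pivots may be restored, because their
        \<open>coef k\<close> is 0.\<close>
      have "psum N (\<lambda>k. if k < N \<and> pivot k \<noteq> 0 then \<omega> k else 0) = psum N \<omega>"
        unfolding psum_def by (intro ext sum.cong) (auto simp: coef_pivot_0)
      then show ?thesis by (simp add: h_def)
    qed
    ultimately show ?thesis using score_convergence[of h B N] by simp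
  qed
  have eP: "\<bar>(LINT \<omega>|P. F (L2_class M (emp n \<omega>))) - (LINT \<omega>|P. F (L2_class M (psum N (score n \<omega>))))\<bar>
      \<le> \<kappa> * sqrt (tail N)" for n N
    using rem_total[of N n]
    by (intro sample.L2_lipschitz_error[OF emp_L2 emp_class_measurable psum_L2
          measurable_continuous_map[OF psum_continuous_map score_measurable] _ _ F])
       (simp_all add: emp_decomp[of n _ _ N])
  have eQ: "\<bar>(LINT \<omega>|gauss_seq. F (L2_class M (V \<omega>))) - (LINT \<omega>|gauss_seq. F (L2_class M (psum N \<omega>)))\<bar>
      \<le> \<kappa> * sqrt (tail N)" for N
    using measurable_continuous_map[OF psum_continuous_map[of N], of "\<lambda>\<omega>. \<omega>" gauss_seq]
    by (intro gauss_seq.L2_lipschitz_error[OF V_L2 V_class_measurable psum_L2 _ V_total_error F])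
       (simp add: measurable_cong_sets[OF sets_gauss_seq refl])
  show "(\<lambda>n. LINT \<omega>|P. F (L2_class M (emp n \<omega>))) \<longlonglongrightarrow> (LINT \<omega>|gauss_seq. F (L2_class M (V \<omega>)))"
    unfolding tendsto_iff
  proof (intro allI impI)
    fix e :: real assume e: "e > 0"
    \<comment> \<open>The level \<open>N\<close> is fixed before \<open>n\<close> grows, as
      \<open>eP\<close> is uniform in \<open>n\<close>.\<close>
    have "(\<lambda>N. \<kappa> * sqrt (tail N)) \<longlonglongrightarrow> \<kappa> * sqrt 0" by (intro tendsto_intros tail_tendsto_0)
    then have "\<forall>\<^sub>F N in sequentially. \<kappa> * sqrt (tail N) < e / 3"
      using e by (intro order_tendstoD(2)) auto
    then obtain N where N: "\<kappa> * sqrt (tail N) < e / 3"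
      using eventually_happens'[OF sequentially_bot] by blast
    have "\<forall>\<^sub>F n in sequentially. dist (LINT \<omega>|P. F (L2_class M (psum N (score n \<omega>))))
        (LINT \<omega>|gauss_seq. F (L2_class M (psum N \<omega>))) < e / 3"
      using e by (intro tendstoD[OF fin]) simp
    then show "\<forall>\<^sub>F n in sequentially. dist (LINT \<omega>|P. F (L2_class M (emp n \<omega>))) (LINT \<omega>|gauss_seq. F (L2_class M (V \<omega>))) < e"
    proof eventually_elim
      case (elim n)
      then show ?case using eP[of n N] eQ[of N] N unfolding dist_real_def by linarith
    qed
  qed
qed

end

section \<open>The statistic\<close>

text \<open>Events are relabelled through the inverse of \<open>f\<close>, and injectivity keeps the
  products over finite index sets unchanged. With \<open>Suc\<close> for \<open>f\<close> it
  discards the index 0.\<close>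

lemma (in prob_space) indep_vars_reindex:
  assumes "indep_vars N X UNIV" and f: "inj f"
  shows "indep_vars (\<lambda>i. N (f i)) (\<lambda>i. X (f i)) UNIV"
proof -
  let ?F = "\<lambda>i. {X i -` A \<inter> space M |A. A \<in> sets (N i)}"
  have rv: "\<And>i. random_variable (N i) (X i)" and ind: "indep_sets ?F UNIV"
    using assms(1) by (auto simp: indep_vars_def2)
  have prod: "prob (\<Inter>j\<in>J. A j) = (\<Prod>j\<in>J. prob (A j))"
    if J: "J \<noteq> {}" "finite J" and A: "\<forall>j\<in>J. A j \<in> ?F (f j)" for J A
  proof -
    have "prob (\<Inter>j\<in>f ` J. A (inv f j)) = (\<Prod>j\<in>f ` J. prob (A (inv f j)))"
      using ind J A f by (intro indep_setsD[OF ind]) auto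
    then show ?thesis
      using f by (simp add: prod.reindex[OF inj_on_subset[OF f subset_UNIV]] image_image)
  qed
  have "indep_sets (\<lambda>i. ?F (f i)) UNIV"
    unfolding indep_sets_def
  proof (intro conjI ballI allI impI)
    show "?F (f i) \<subseteq> events" for i using ind unfolding indep_sets_def by simp
    show "prob (\<Inter>j\<in>J. A j) = (\<Prod>j\<in>J. prob (A j))"
      if "J \<noteq> {}" "finite J" "A \<in> (\<Pi> j\<in>J. ?F (f j))" for J A
      using that(1,2) Pi_mem[OF that(3)] by (intro prod ballI)
  qed
  then show ?thesis using rv by (simp add: indep_vars_def2)
qed

section \<open>Rotations in real coordinates\<close>

lemma sum_UNIV_Plus:
  fixes f :: "'a::finite + 'b::finite \<Rightarrow> 'c::comm_monoid_add"
  shows "(\<Sum>j\<in>UNIV. f j) = (\<Sum>k\<in>UNIV. f (Inl k)) + (\<Sum>k\<in>UNIV. f (Inr k))"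
  using sum.Plus[of "UNIV :: 'a set" "UNIV :: 'b set" f] by (simp add: UNIV_Plus_UNIV)

lemma sum_mat_mult:
  fixes c :: real and k :: "'d::finite"
  shows "(\<Sum>l\<in>UNIV. mat c $ k $ l * g l) = c * g k"
proof -
  have "(\<Sum>l\<in>UNIV. mat c $ k $ l * g l) = (\<Sum>l\<in>UNIV. if l = k then c * g k else 0)"
    by (intro sum.cong) (auto simp: mat_def)
  then show ?thesis by simp
qed

text \<open>Multiplication by the imaginary unit, seen through \<open>RI\<close>.\<close>

definition quarter_turn :: "real ^ ('d::finite + 'd) \<Rightarrow> real ^ ('d + 'd)" where
  "quarter_turn v = (\<chi> i. case i of Inl k \<Rightarrow> - (v $ Inr k) | Inr k \<Rightarrow> v $ Inl k)"

text \<open>Separates the angle from the vector, so that joint continuity in both can be read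
  off.\<close>

lemma rot_matrix_mult: "rot_matrix \<theta> *v v = cos \<theta> *\<^sub>R v + sin \<theta> *\<^sub>R quarter_turn v"
proof (subst vec_eq_iff, rule allI)
  fix i :: "'a + 'a"
  show "(rot_matrix \<theta> *v v) $ i = (cos \<theta> *\<^sub>R v + sin \<theta> *\<^sub>R quarter_turn v) $ i"
    by (cases i) (simp_all add: matrix_vector_mult_def rot_matrix_def quarter_turn_def sum_UNIV_Plus
        sum_mat_mult sum_negf)
qed

lemma linear_quarter_turn: "linear quarter_turn"
  by (rule linearI) (auto simp: quarter_turn_def vec_eq_iff split: sum.split)

lemma continuous_quarter_turn [continuous_intros]:
  "continuous_on S f \<Longrightarrow> continuous_on S (\<lambda>x. quarter_turn (f x))"
  by (rule bounded_linear.continuous_on) (simp_all add: linear_conv_bounded_linear[symmetric] linear_quarter_turn)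

lemma linear_RI: "linear RI"
  by (rule linearI) (auto simp: RI_def vec_eq_iff split: sum.split)

lemma RI_measurable [measurable]: "RI \<in> borel_measurable borel"
  by (intro borel_measurable_continuous_onI linear_continuous_on_compose[OF continuous_on_id linear_RI, simplified])

lemma scalar_mult_measurable: "(\<lambda>z :: complex ^ 'd::finite. c *s z) \<in> borel_measurable borel"
proof -
  have "linear (\<lambda>z :: complex ^ 'd. c *s z)"
    by (rule linearI) (auto simp: vec_eq_iff algebra_simps)
  from linear_continuous_on_compose[OF continuous_on_id this]
  show ?thesis by (intro borel_measurable_continuous_onI) simp
qed

lemma RI_rotate: "RI (exp (\<i> * of_real \<theta>) *s z) = rot_matrix \<theta> *v RI z"
proof (subst vec_eq_iff, rule allI)
  fix i :: "'a + 'a"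
  show "RI (exp (\<i> * of_real \<theta>) *s z) $ i = (rot_matrix \<theta> *v RI z) $ i"
    by (cases i) (simp_all add: rot_matrix_mult RI_def quarter_turn_def Re_exp Im_exp)
qed

lemma abs_CSp_le: "\<bar>CSp \<xi>\<bar> \<le> 2"
  using abs_cos_le_one[of \<xi>] abs_sin_le_one[of \<xi>] unfolding CSp_def by linarith

lemma abs_ell_le: "\<bar>ell v s \<theta>\<bar> \<le> 4"
  using abs_CSp_le[of "s \<bullet> v"] abs_CSp_le[of "s \<bullet> (rot_matrix \<theta> *v v)"] unfolding ell_def by linarith

lemma continuous_ell:
  fixes S :: "'a::t2_space set"
  assumes "continuous_on S f" "continuous_on S g" "continuous_on S h"
  shows "continuous_on S (\<lambda>x. ell (f x) (g x) (h x))"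
  unfolding ell_def CSp_def rot_matrix_mult by (intro continuous_intros assms)

text \<open>\<open>ell\<close> is the difference of one bounded function at two vectors to which
  circular symmetry gives the same law, so the expectations cancel.\<close>

lemma ell_centred:
  assumes P: "prob_space P" and Z [measurable]: "Z \<in> borel_measurable P"
    and sym: "circularly_symmetric P Z" and \<theta>: "\<theta> \<in> Theta"
  shows "(LINT v|distr P borel (\<lambda>\<omega>. RI (Z \<omega>)). ell v s \<theta>) = 0"
proof -
  interpret prob_space P by (rule P)
  note [measurable] = scalar_mult_measurable
  have [measurable]: "CSp \<in> borel_measurable borel" unfolding CSp_def by measurable
  have int: "integrable P (\<lambda>\<omega>. CSp (s \<bullet> RI (f (Z \<omega>))))" if [measurable]: "f \<in> borel_measurable borel" for f
    by (rule integrable_const_bound[of _ 2]) (auto simp: abs_CSp_le)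
  have "(LINT v|distr P borel (\<lambda>\<omega>. RI (Z \<omega>)). ell v s \<theta>) = (LINT \<omega>|P. ell (RI (Z \<omega>)) s \<theta>)"
    by (intro integral_distr borel_measurable_continuous_onI continuous_ell continuous_intros) simp
  also have "\<dots> = (LINT \<omega>|P. CSp (s \<bullet> RI (Z \<omega>)) - CSp (s \<bullet> RI (exp (\<i> * of_real \<theta>) *s Z \<omega>)))"
    by (simp add: ell_def RI_rotate)
  also have "\<dots> = (LINT \<omega>|P. CSp (s \<bullet> RI (Z \<omega>))) - (LINT \<omega>|P. CSp (s \<bullet> RI (exp (\<i> * of_real \<theta>) *s Z \<omega>)))"
    using int[of "\<lambda>z. z"] int[OF scalar_mult_measurable] by simp
  also have "(LINT \<omega>|P. CSp (s \<bullet> RI (exp (\<i> * of_real \<theta>) *s Z \<omega>)))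
      = (LINT z|distr P borel (\<lambda>\<omega>. exp (\<i> * of_real \<theta>) *s Z \<omega>). CSp (s \<bullet> RI z))"
    by (rule integral_distr[symmetric]) measurable
  also have "\<dots> = (LINT z|distr P borel Z. CSp (s \<bullet> RI z))"
    using sym \<theta> by (simp add: circularly_symmetric_def)
  also have "\<dots> = (LINT \<omega>|P. CSp (s \<bullet> RI (Z \<omega>)))"
    by (rule integral_distr) measurable
  finally show ?thesis by simp
qed

section \<open>The weighted parameter space\<close>

lemma space_weight_measure: "space (weight_measure w) = UNIV \<times> Theta"
  by (simp add: weight_measure_def space_pair_measure space_restrict_space)

lemma sets_weight_measure [measurable_cong]:
  "sets (weight_measure w) = sets (borel \<Otimes>\<^sub>M restrict_space borel Theta)"
proof -
  have "sets (restrict_space lborel Theta) = sets (restrict_space borel Theta)"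
    by (rule sets_restrict_space_cong) simp
  then show ?thesis
    unfolding weight_measure_def sets_density by (rule sets_pair_measure_cong[OF sets_lborel])
qed

text \<open>By Tonelli the total mass is \<open>2 * pi\<close> times the integral of the
  weight.\<close>

lemma finite_measure_weight_measure:
  fixes w :: "real \<Rightarrow> real"
  assumes w: "\<And>r. r \<ge> 0 \<Longrightarrow> w r > 0" and int: "integrable lborel (\<lambda>s :: real ^ ('d::finite + 'd). w (norm s))"
  shows "finite_measure (weight_measure w :: ((real ^ ('d + 'd)) \<times> real) measure)"
proof (rule finite_measureI)
  let ?T = "restrict_space lborel Theta :: real measure"
  have T: "emeasure ?T (space ?T) = ennreal (2 * pi)"
    by (simp add: space_restrict_space emeasure_restrict_space Theta_def)
  interpret T: finite_measure ?T by (rule finite_measureI) (use T in simp)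
  have [measurable]: "(\<lambda>s :: real ^ ('d + 'd). w (norm s)) \<in> borel_measurable borel"
    using borel_measurable_integrable[OF int] by simp
  have m: "(\<lambda>(s, \<theta>). ennreal (w (norm s))) \<in> borel_measurable ((lborel :: (real ^ ('d + 'd)) measure) \<Otimes>\<^sub>M ?T)"
    by measurable
  have "emeasure (weight_measure w :: ((real ^ ('d + 'd)) \<times> real) measure) (space (weight_measure w))
      = (\<integral>\<^sup>+ x. (case x of (s, \<theta>) \<Rightarrow> ennreal (w (norm s))) \<partial>((lborel :: (real ^ ('d + 'd)) measure) \<Otimes>\<^sub>M ?T))"
    unfolding weight_measure_def space_density emeasure_density[OF m sets.top]
    by (rule nn_integral_cong) simp
  also have "\<dots> = (\<integral>\<^sup>+ s. \<integral>\<^sup>+ \<theta>. ennreal (w (norm s)) \<partial>?T \<partial>(lborel :: (real ^ ('d + 'd)) measure))"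
    using T.nn_integral_fst[OF m] by simp
  also have "\<dots> = (\<integral>\<^sup>+ s. ennreal (w (norm s)) * ennreal (2 * pi) \<partial>(lborel :: (real ^ ('d + 'd)) measure))"
    by (simp add: T)
  also have "\<dots> = (\<integral>\<^sup>+ s. ennreal (w (norm s)) \<partial>(lborel :: (real ^ ('d + 'd)) measure)) * ennreal (2 * pi)"
    by (rule nn_integral_multc) simp
  also have "\<dots> = ennreal (LINT s|(lborel :: (real ^ ('d + 'd)) measure). w (norm s)) * ennreal (2 * pi)"
    using w by (subst nn_integral_eq_integral[OF int]) (auto simp: less_imp_le)
  also have "\<dots> \<noteq> \<infinity>" by (simp add: ennreal_mult_eq_top_iff)
  finally show "emeasure (weight_measure w :: ((real ^ ('d + 'd)) \<times> real) measure) (space (weight_measure w)) \<noteq> \<infinity>" .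
qed

lemma ell_measurable:
  "(\<lambda>(v, x). ell v (fst x) (snd x)) \<in>
    borel_measurable (borel \<Otimes>\<^sub>M (weight_measure w :: ((real ^ ('d::finite + 'd)) \<times> real) measure))"
proof -
  have c: "(\<lambda>z. ell (fst z) (fst (snd z)) (snd (snd z))) \<in>
      borel_measurable (borel :: ((real ^ ('d + 'd)) \<times> (real ^ ('d + 'd)) \<times> real) measure)"
    by (intro borel_measurable_continuous_onI continuous_ell continuous_intros)
  have i: "(\<lambda>z. (fst z, fst (snd z), snd (snd z))) \<in>
      (borel \<Otimes>\<^sub>M weight_measure w) \<rightarrow>\<^sub>M (borel :: ((real ^ ('d + 'd)) \<times> (real ^ ('d + 'd)) \<times> real) measure)"
  proof -
    have "(\<lambda>\<theta>. \<theta>) \<in> restrict_space borel Theta \<rightarrow>\<^sub>M (borel :: real measure)"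
      by (rule measurable_restrict_space1) simp
    from measurable_compose[OF _ this] have [measurable]:
      "(\<lambda>z. snd (snd z)) \<in> ((borel :: (real ^ ('d + 'd)) measure) \<Otimes>\<^sub>M weight_measure w) \<rightarrow>\<^sub>M borel"
      by measurable
    show ?thesis unfolding borel_prod[symmetric] by measurable
  qed
  from measurable_compose[OF i c] show ?thesis by (simp add: case_prod_beta')
qed

text \<open>Density in the usual topology suffices: \<open>ell\<close> is bounded and continuous in
  its parameters, so convergent parameters give L2 convergence by dominated convergence.\<close>

lemma ell_dense_sequence:
  fixes \<mu> :: "(real ^ ('d::finite + 'd)) measure"
  assumes "prob_space \<mu>" and sets: "sets \<mu> = sets borel"
  shows "\<exists>xs :: nat \<Rightarrow> _. (\<forall>n. xs n \<in> UNIV \<times> Theta) \<and>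
    (\<forall>x\<in>UNIV \<times> Theta. \<forall>e>0. \<exists>j. (LINT v|\<mu>. (ell v (fst x) (snd x) - ell v (fst (xs j)) (snd (xs j)))\<^sup>2) < e)"
proof -
  interpret prob_space \<mu> by fact
  note [measurable_cong] = sets
  let ?X = "UNIV \<times> Theta :: ((real ^ ('d + 'd)) \<times> real) set"
  have [measurable]: "(\<lambda>v. ell v (fst x) (snd x)) \<in> borel_measurable borel" for x
    by (intro borel_measurable_continuous_onI continuous_ell continuous_intros)
  obtain D where D: "countable D" "D \<subseteq> ?X" "?X \<subseteq> closure D"
    using separable[of ?X] by blast
  have "(0, 0) \<in> ?X" by (simp add: Theta_def)
  then have "D \<noteq> {}" using D(3) by auto
  define xs where "xs = from_nat_into D"
  have "xs n \<in> ?X" for n using from_nat_into[OF \<open>D \<noteq> {}\<close>] D(2) by (auto simp: xs_def)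
  moreover have "\<exists>j. (LINT v|\<mu>. (ell v (fst x) (snd x) - ell v (fst (xs j)) (snd (xs j)))\<^sup>2) < e"
    if x: "x \<in> ?X" and e: "e > 0" for x e
  proof -
    have "x \<in> closure D" using D(3) x by (rule subsetD)
    then obtain y where y': "(\<forall>i. y i \<in> D) \<and> y \<longlonglongrightarrow> x"
      unfolding closure_sequential by (rule exE)
    then have y: "\<And>i. y i \<in> D" "y \<longlonglongrightarrow> x" by simp_all
    have "(\<lambda>i. LINT v|\<mu>. (ell v (fst x) (snd x) - ell v (fst (y i)) (snd (y i)))\<^sup>2) \<longlonglongrightarrow> (LINT v|\<mu>. 0)"
    \<comment> \<open>Two values of \<open>ell\<close>, each of modulus at most 4, differ by at most
      8.\<close>
    proof (rule integral_dominated_convergence[where w="\<lambda>_. 8\<^sup>2"])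
      show "AE v in \<mu>. (\<lambda>i. (ell v (fst x) (snd x) - ell v (fst (y i)) (snd (y i)))\<^sup>2) \<longlonglongrightarrow> 0"
      proof (rule AE_I2)
        fix v :: "real ^ ('d + 'd)"
        have cont: "continuous_on UNIV (\<lambda>x. ell v (fst x) (snd x))"
          by (intro continuous_ell continuous_intros)
        have "(\<lambda>i. ell v (fst (y i)) (snd (y i))) \<longlonglongrightarrow> ell v (fst x) (snd x)"
          using continuous_on_tendsto_compose[OF cont y(2)] by simp
        then have "(\<lambda>i. (ell v (fst x) (snd x) - ell v (fst (y i)) (snd (y i)))\<^sup>2) \<longlonglongrightarrow> (ell v (fst x) (snd x) - ell v (fst x) (snd x))\<^sup>2"
          by (intro tendsto_intros)
        then show "(\<lambda>i. (ell v (fst x) (snd x) - ell v (fst (y i)) (snd (y i)))\<^sup>2) \<longlonglongrightarrow> 0" by simp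
      qed
      show "AE v in \<mu>. norm ((ell v (fst x) (snd x) - ell v (fst (y i)) (snd (y i)))\<^sup>2) \<le> 8\<^sup>2" for i
      proof (rule AE_I2)
        fix v :: "real ^ ('d + 'd)"
        have "\<bar>ell v (fst x) (snd x) - ell v (fst (y i)) (snd (y i))\<bar> \<le> 8"
          using abs_ell_le[of v "fst x" "snd x"] abs_ell_le[of v "fst (y i)" "snd (y i)"] by linarith
        from power_mono[OF this abs_ge_zero, of 2]
        show "norm ((ell v (fst x) (snd x) - ell v (fst (y i)) (snd (y i)))\<^sup>2) \<le> 8\<^sup>2" by simp
      qed
    qed auto
    then have "\<forall>\<^sub>F i in sequentially. (LINT v|\<mu>. (ell v (fst x) (snd x) - ell v (fst (y i)) (snd (y i)))\<^sup>2) < e"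
      using e by (intro order_tendstoD(2)) auto
    then obtain i where i: "(LINT v|\<mu>. (ell v (fst x) (snd x) - ell v (fst (y i)) (snd (y i)))\<^sup>2) < e"
      using eventually_happens'[OF sequentially_bot] by blast
    obtain j where j: "xs j = y i" using from_nat_into_surj[OF D(1) y(1)] by (auto simp: xs_def)
    show ?thesis by (rule exI[of _ j]) (simp only: j i)
  qed
  ultimately show ?thesis by blast
qed

theorem theorem4p2:
  fixes P :: "'a measure"
    and Z :: "'a \<Rightarrow> complex ^ 'd::finite"
    and Zs :: "nat \<Rightarrow> 'a \<Rightarrow> complex ^ 'd"
    and w :: "real \<Rightarrow> real"
  assumes "prob_space P"
    and "prob_space.indep_vars P (\<lambda>_. borel) (\<lambda>j. if j = 0 then Z else Zs j) (UNIV :: nat set)"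
    and "\<And>j. j \<ge> 1 \<Longrightarrow> distr P borel (Zs j) = distr P borel Z"
    and "w \<in> borel_measurable (restrict_space borel {0..})"
    and "\<And>r. r \<ge> 0 \<Longrightarrow> w r > 0"
    and "integrable lborel (\<lambda>s :: real ^ ('d + 'd). w (norm s))"
    and "circularly_symmetric P Z"
  shows "\<exists>(Q :: (nat \<Rightarrow> real) measure) (V :: (nat \<Rightarrow> real) \<Rightarrow> (real ^ ('d + 'd)) \<times> real \<Rightarrow> real).
     prob_space Q \<and>
     centred_gaussian_with_kernel (weight_measure w) Q V (cov_kernel P Z) \<and>
     converges_in_distribution (L2_topology (weight_measure w))
       P (\<lambda>n \<omega>. L2_class (weight_measure w) (Vstat Zs n \<omega>))
       Q (\<lambda>\<omega>. L2_class (weight_measure w) (V \<omega>))"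
proof -
  interpret P: prob_space P by fact
  let ?M = "weight_measure w :: ((real ^ ('d + 'd)) \<times> real) measure"
  let ?\<mu> = "distr P borel (\<lambda>\<omega>. RI (Z \<omega>))"
  let ?l = "\<lambda>v x. ell v (fst x) (snd x)"
  have Zj: "(if j = 0 then Z else Zs j) \<in> borel_measurable P" for j
    using assms(2) by (auto simp: P.indep_vars_def simp del: if_image_distrib)
  have Z [measurable]: "Z \<in> borel_measurable P" using Zj[of 0] by simp
  have Zs [measurable]: "Zs (Suc j) \<in> borel_measurable P" for j using Zj[of "Suc j"] by simp
  have mu: "prob_space ?\<mu>" by (rule P.prob_space_distr) measurable
  from ell_dense_sequence[OF mu sets_distr] obtain xs :: "nat \<Rightarrow> _" where xs': "(\<forall>n. xs n \<in> UNIV \<times> Theta) \<and>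
    (\<forall>x\<in>UNIV \<times> Theta. \<forall>e>0. \<exists>j. (LINT v|?\<mu>. (?l v x - ?l v (xs j))\<^sup>2) < e)" by (rule exE)
  note xs = xs'[THEN conjunct1, rule_format] xs'[THEN conjunct2, rule_format]
  \<comment> \<open>The constant 4 bounds \<open>ell\<close>, a difference of two values of
    \<open>CSp\<close> of modulus at most 2.\<close>
  have kp: "kernel_process ?\<mu> ?M ?l 4 xs"
  proof (intro kernel_process.intro kernel_process_axioms.intro)
    show "prob_space ?\<mu>" by (rule mu)
    show "finite_measure ?M" by (rule finite_measure_weight_measure[OF assms(5,6)])
    show "(\<lambda>(v, x). ?l v x) \<in> borel_measurable (borel \<Otimes>\<^sub>M ?M)" by (rule ell_measurable)
    show "continuous_on UNIV (\<lambda>v. ?l v x)" for x by (intro continuous_ell continuous_intros)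
    show "(LINT v|?\<mu>. ?l v x) = 0" if "x \<in> space ?M" for x
      using that by (intro ell_centred[OF assms(1) Z assms(7)]) (auto simp: space_weight_measure)
    show "\<exists>j. (LINT v|?\<mu>. (?l v x - ?l v (xs j))\<^sup>2) < e" if "x \<in> space ?M" "0 < e" for x e
      using that by (intro xs(2)) (simp_all add: space_weight_measure)
  qed (auto simp: abs_ell_le space_weight_measure xs(1))
  \<comment> \<open>Index 0 of the independent family is \<open>Z\<close> itself; the shift by
    \<open>Suc\<close> drops it and lets the sample start at index 0, as in
    \<open>emp\<close>.\<close>
  have iid: "iid_sample P (\<lambda>j \<omega>. RI (Zs (Suc j) \<omega>)) ?\<mu>"
  proof (intro iid_sample.intro iid_sample_axioms.intro assms(1))
    have "P.indep_vars (\<lambda>_. borel) (\<lambda>j. Zs (Suc j)) UNIV"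
      using P.indep_vars_reindex[OF assms(2) inj_Suc] by simp
    then show "P.indep_vars (\<lambda>_. borel) (\<lambda>j \<omega>. RI (Zs (Suc j) \<omega>)) UNIV"
      by (rule P.indep_vars_compose2) simp
    show "distr P borel (\<lambda>\<omega>. RI (Zs (Suc j) \<omega>)) = ?\<mu>" for j
    proof -
      have "distr P borel (\<lambda>\<omega>. RI (Zs (Suc j) \<omega>)) = distr (distr P borel (Zs (Suc j))) borel RI"
        by (simp add: distr_distr comp_def)
      also have "\<dots> = distr (distr P borel Z) borel RI" by (simp add: assms(3))
      also have "\<dots> = ?\<mu>" by (simp add: distr_distr comp_def)
      finally show ?thesis .
    qed
  qed
  interpret iid_kernel_process P "\<lambda>j \<omega>. RI (Zs (Suc j) \<omega>)" ?\<mu> ?M ?l 4 xs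
    by (intro iid_kernel_process.intro kp iid)
  have "cov 0 = cov_kernel P Z"
  proof (intro ext)
    fix x y :: "(real ^ ('d + 'd)) \<times> real"
    have "(\<lambda>v. ?l v x * ?l v y) \<in> borel_measurable borel"
      by (intro borel_measurable_continuous_onI continuous_intros continuous_ell)
    then show "cov 0 x y = cov_kernel P Z x y"
      by (simp add: cov_def cov_kernel_def integral_distr case_prod_beta)
  qed
  \<comment> \<open>The sum over \<open>1..n\<close> is the sum of the shifted sample over indices
    below \<open>n\<close>.\<close>
  moreover have "emp = Vstat Zs"
    by (intro ext) (simp add: emp_def Vstat_def sum.atLeast1_atMost_eq case_prod_beta)
  ultimately show ?thesis
    using gauss_seq.prob_space_axioms centred_gaussian_V emp_converges by auto
qed

end
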